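(* For all $n \geq 0$, $$p_{\xi}(24n+19) \equiv 0 \pmod{3},\qquad p_{\xi}(27n+18) \equiv 0 \pmod{3},\qquad p_{\xi}(72n+51) \equiv 0 \pmod{3}.$$
   Context: $(a;q)_n=(1-a)(1-aq)\cdots(1-aq^{n-1})$, $(a;q)_0=1$. The coefficients $p_\xi(n)$ are defined by $\sum_{n\ge0}p_\xi(n)q^n=\xi(q)=1+2\sum_{n\ge1}\frac{q^{6n^2-6n+1}}{(q;q^6)_n(q^5;q^6)_n}$. *)

theory Defs
  imports
    "HOL-Computational_Algebra.Formal_Power_Series"
    "HOL-Number_Theory.Cong"
begin

definition qpoch :: "'a::comm_ring_1 \<Rightarrow> 'a \<Rightarrow> nat \<Rightarrow> 'a" where
  "qpoch a q n = (\<Prod>k<n. 1 - a * q ^ k)"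

definition xi_denom :: "nat \<Rightarrow> int fps" where
  "xi_denom n = qpoch fps_X (fps_X ^ 6) n * qpoch (fps_X ^ 5) (fps_X ^ 6) n"

(* The type int fps has no inverse operation; the reciprocal of a series with
   constant coefficient 1 is fps_right_inverse _ 1 (see xi_denom_inverse below).
   The natural-number subtraction in the exponent does not truncate, as n \<le> n^2. *)
definition xi_term :: "nat \<Rightarrow> int fps" where
  "xi_term n = fps_X ^ (6 * n ^ 2 - 6 * n + 1) * fps_right_inverse (xi_denom n) 1"

(* The infinite sum is taken in the X-adic topology of int fps; it converges by
   summable_xi_term below. *)
definition xi :: "int fps" where
  "xi = 1 + 2 * (\<Sum>n. xi_term (Suc n))"

definition p_xi :: "nat \<Rightarrow> int" where
  "p_xi n = fps_nth xi n"

lemma qpoch_nth_0: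
  fixes a q :: "'a::comm_ring_1 fps"
  assumes "fps_nth a 0 = 0"
  shows "fps_nth (qpoch a q n) 0 = 1"
  using assms by (induction n) (simp_all add: qpoch_def)

lemma xi_denom_inverse: "xi_denom n * fps_right_inverse (xi_denom n) 1 = 1"
  by (rule fps_right_inverse) (simp add: xi_denom_def qpoch_nth_0)

lemma xi_term_nth_eq_0:
  assumes "k < n"
  shows "fps_nth (xi_term (Suc n)) k = 0"
proof -
  have "k < 6 * (Suc n) ^ 2 - 6 * Suc n + 1"
    using assms by (simp add: power2_eq_square algebra_simps)
  then show ?thesis
    unfolding xi_term_def fps_X_power_mult_nth by presburger
qed

lemma summable_xi_term: "summable (\<lambda>n. xi_term (Suc n))"
proof -
  let ?L = "Abs_fps (\<lambda>k. \<Sum>n<Suc k. fps_nth (xi_term (Suc n)) k)"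
  have "(\<lambda>N. \<Sum>n<N. xi_term (Suc n)) \<longlonglongrightarrow> ?L"
  proof (rule tendsto_fpsI)
    fix k
    have "fps_nth (\<Sum>n<N. xi_term (Suc n)) k = fps_nth ?L k" if "Suc k \<le> N" for N
    proof -
      have "(\<Sum>n<N. fps_nth (xi_term (Suc n)) k) = (\<Sum>n<Suc k. fps_nth (xi_term (Suc n)) k)"
        using that by (intro sum.mono_neutral_right) (auto intro!: xi_term_nth_eq_0)
      then show ?thesis
        by (simp add: fps_sum_nth)
    qed
    then show "\<forall>\<^sub>F N in sequentially. fps_nth (\<Sum>n<N. xi_term (Suc n)) k = fps_nth ?L k"
      unfolding eventually_sequentially by blast
  qed
  then show ?thesis
    by (auto simp: summable_def sums_def)
qed

end

theory Submission
  imports Defs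
begin

text \<open>
  Bailey's lemma for the unit Bailey pair writes \<open>\<xi>(q)\<close> as an Appell--Lerch sum over the
  denominators \<open>1 - q\<^bsup>6k+1\<^esup>\<close>, divided by \<open>(q\<^sup>6;q\<^sup>6)\<close>. Expanding
  \<open>1/(1 - z) = (1 + z + z\<^sup>2)/(1 - z\<^sup>3)\<close> splits that sum according to the exponents modulo 3.
  The mock part sits entirely in the exponents \<open>2\<close> modulo \<open>3\<close>; the other two parts are infinite
  products (partial fractions of theta quotients, and for the class \<open>0\<close> a half-period evaluation of
  an Appell sum). Modulo 3 these products collapse to ternary theta series, so that the
  coefficients count representations by \<open>x\<^sup>2 + y\<^sup>2 + 3z\<^sup>2\<close> and \<open>x\<^sup>2 + y\<^sup>2 + 3z\<^sup>2 - 2z\<close>.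
  In the given progressions there is either a local obstruction, or multiplication by a cube root
  of unity in the Eisenstein integers permutes the representations without fixed points.
\<close>

text \<open>Before division by (q^6;q^6), the summand with index k contributes the exponents 9k^2 +
  9k + 1 + (6k + 1)m, which are m + 1 modulo 3. As (q^6;q^6) is a series in q^3, dividing by it
  keeps the classes apart. The progressions are 3(8n + 6) + 1, 3(9n + 6) and 3(24n + 17), so only
  the classes 0 and 1 occur. The obstacle is class 0: its Appell sum has numerators q^(3k^2 + k),
  whereas the partial fractions give products for the numerators q^(3k^2 + 3k) and q^(3k). It is
  tied to the last case by multiplying with a theta series and reflecting the summation indices.
  Every analytic identity is first proved in finite form over an integral domain, where 1/(q;q)_m
  enters only through its recursion, and then passed to the limit coefficient by coefficient. Over
  the integers quotients are written cross-multiplied. The ternary theta series carry the sign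
  (-1)^(x+y+z). It is constant on each exponent, so a signed count is a count up to sign.\<close>

unbundle fps_syntax

section \<open>Finite partial fraction identities\<close>

text \<open>
  In this section \<open>iq m\<close> stands for \<open>1/(q;q)\<^sub>m\<close>, \<open>e k\<close> for \<open>(-1)\<^sup>k q\<^bsup>k(k+1)/2\<^esup>\<close>, and \<open>D k\<close> for
  \<open>(1 - x q\<^sup>k)(1 - q\<^bsup>k+1\<^esup>/x)\<close>, which depends on \<open>x\<close> only through \<open>y = x + q/x\<close>.
\<close>

lemma partial_fraction_sum_eq_0:
  fixes q :: "'a::idom" and iq e :: "nat \<Rightarrow> 'a"
  assumes q: "\<And>n. n > 0 \<Longrightarrow> q ^ n \<noteq> 1"
    and iq: "\<And>m. iq m = (1 - q ^ Suc m) * iq (Suc m)"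
    and e: "\<And>k. e (Suc k) = - (q ^ Suc k) * e k"
    and e0: "e 0 = 1"
    and n: "n > 0"
  shows "(\<Sum>k\<le>n. e k * (1 - q ^ (2 * k + 1)) * iq (n - k) * iq (n + k + 1) * q ^ (n - k)) = 0"
proof -
  let ?c = "\<lambda>k. e k * (1 - q ^ (2 * k + 1)) * iq (n - k) * iq (n + k + 1) * q ^ (n - k)"
  \<comment> \<open>Regarded in y, the full sum is, up to sign and the factor \<open>q ^ n\<close>,
    the coefficient of 1/y at infinity in the simple fraction expansion of
    \<open>\<Prod>j\<le>n. g j\<close>. That product decays like y^(-n-1), so the sum vanishes for n
    > 0. The proof telescopes instead: times \<open>1 - q ^ n\<close>, the truncated sums have a
    closed form.\<close>
  have partial: "(1 - q ^ n) * (\<Sum>k\<le>m. ?c k) =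
      q ^ n * e m * (1 - q ^ Suc m) * iq (n - m - 1) * iq (n + m + 1)" if "m < n" for m
    using that
  proof (induction m)
    case 0
    then obtain d where d: "n = Suc d" by (cases n) auto
    show ?case by (simp add: d e0 iq[of d] mult_ac)
  next
    case (Suc m)
    then obtain d where d: "n = m + 2 + d"
      by (metis add_2_eq_Suc' add_Suc_right le_Suc_ex less_eq_Suc_le add_Suc)
    have i1: "iq d = (1 - q ^ Suc d) * iq (Suc d)" by (rule iq)
    have i2: "iq (2 * m + d + 3) = (1 - q ^ (2 * m + d + 4)) * iq (2 * m + d + 4)"
      using iq[of "2 * m + d + 3"] by (simp add: numeral_eq_Suc)
    have "(1 - q ^ n) * (\<Sum>k\<le>Suc m. ?c k) = (1 - q ^ n) * (\<Sum>k\<le>m. ?c k) + (1 - q ^ n) * ?c (Suc m)"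
      by (simp add: distrib_left)
    also have "(1 - q ^ n) * (\<Sum>k\<le>m. ?c k) =
        q ^ (m + 2 + d) * e m * (1 - q ^ Suc m) * iq (Suc d) * ((1 - q ^ (2 * m + d + 4)) * iq (2 * m + d + 4))"
      using Suc d i2 by (simp add: numeral_eq_Suc ac_simps)
    also have "(1 - q ^ n) * ?c (Suc m) = (1 - q ^ (m + 2 + d)) * (- (q ^ Suc m) * e m * (1 - q ^ (2 * m + 3))
        * iq (Suc d) * iq (2 * m + d + 4) * q ^ Suc d)"
    proof -
      have "n - Suc m = Suc d" "n + Suc m + 1 = 2 * m + d + 4" "2 * Suc m + 1 = 2 * m + 3"
        using d by auto
      then show ?thesis by (simp only: e d) 
    qed
    also have "q ^ (m + 2 + d) * e m * (1 - q ^ Suc m) * iq (Suc d) * ((1 - q ^ (2 * m + d + 4)) * iq (2 * m + d + 4))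
       + (1 - q ^ (m + 2 + d)) * (- (q ^ Suc m) * e m * (1 - q ^ (2 * m + 3))
        * iq (Suc d) * iq (2 * m + d + 4) * q ^ Suc d) =
       q ^ (m + 2 + d) * (- (q ^ Suc m) * e m) * (1 - q ^ Suc (Suc m)) * ((1 - q ^ Suc d) * iq (Suc d)) * iq (2 * m + d + 4)"
      by (simp add: power_add mult_2 eval_nat_numeral) algebra
    also have "\<dots> = q ^ n * e (Suc m) * (1 - q ^ Suc (Suc m)) * iq (n - Suc m - 1) * iq (n + Suc m + 1)"
    proof -
      have "n - Suc m - 1 = d" "n + Suc m + 1 = 2 * m + d + 4"
        using d by auto
      then show ?thesis by (simp only: e d i1)
    qed
    finally show ?case .
  qed
  \<comment> \<open>The closed form at m = n would contain 1/(q;q) with index -1, to be read as 0,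
    whereas natural subtraction returns \<open>iq 0\<close>. The last summand is therefore added
    separately.\<close>
  obtain m where m: "n = Suc m" using n by (cases n) auto
  have i: "iq (n + m + 1) = (1 - q ^ (2 * n + 1)) * iq (n + n + 1)"
    using iq[of "n + m + 1"] by (simp add: m mult_2)
  have "(1 - q ^ n) * (\<Sum>k\<le>n. ?c k) = (1 - q ^ n) * (\<Sum>k\<le>m. ?c k) + (1 - q ^ n) * ?c n"
    by (simp add: m distrib_left)
  also have "(1 - q ^ n) * (\<Sum>k\<le>m. ?c k) =
      q ^ n * e m * (1 - q ^ n) * iq 0 * ((1 - q ^ (2 * n + 1)) * iq (n + n + 1))"
    using partial[of m] unfolding i by (simp add: m)
  also have "(1 - q ^ n) * ?c n =
      (1 - q ^ n) * (- (q ^ n) * e m * (1 - q ^ (2 * n + 1)) * iq 0 * iq (n + n + 1))"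
    by (simp add: m e)
  also have "q ^ n * e m * (1 - q ^ n) * iq 0 * ((1 - q ^ (2 * n + 1)) * iq (n + n + 1)) +
      (1 - q ^ n) * (- (q ^ n) * e m * (1 - q ^ (2 * n + 1)) * iq 0 * iq (n + n + 1)) = 0"
    by (simp add: mult_ac)
  finally show ?thesis using q[OF n] by simp
qed

text \<open>The case \<open>n = \<infinity>\<close> expands the reciprocal of a theta function into simple fractions.\<close>
lemma partial_fraction_reciprocal:
  fixes q y :: "'a::idom" and iq e D g :: "nat \<Rightarrow> 'a"
  assumes q: "\<And>n. n > 0 \<Longrightarrow> q ^ n \<noteq> 1"
    and iq: "\<And>m. iq m = (1 - q ^ Suc m) * iq (Suc m)" and iq0: "iq 0 = 1"
    and e: "\<And>k. e (Suc k) = - (q ^ Suc k) * e k" and e0: "e 0 = 1"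
    and D: "\<And>k. D k = 1 - y * q ^ k + q ^ (2 * k + 1)"
    and g: "\<And>k. D k * g k = 1"
  shows "(\<Prod>j\<le>n. g j) = (\<Sum>k\<le>n. e k * (1 - q ^ (2 * k + 1)) * iq (n - k) * iq (n + k + 1) * g k)"
proof (induction n)
  case 0
  have "(1 - q) * iq (Suc 0) = 1" using iq[of 0] iq0 by simp
  then show ?case by (simp add: e0 iq0)
next
  case (Suc n)
  let ?c = "\<lambda>n k. e k * (1 - q ^ (2 * k + 1)) * iq (n - k) * iq (n + k + 1)"
  have step: "?c n k * g k = D (Suc n) * (?c (Suc n) k * g k) - ?c (Suc n) k * q ^ (Suc n - k)"
    if "k \<le> n" for k
  proof -
    obtain d where d: "n = k + d" using \<open>k \<le> n\<close> le_Suc_ex by blast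
    have 1: "iq d = (1 - q ^ Suc d) * iq (Suc d)" by (rule iq)
    have 2: "iq (n + k + 1) = (1 - q ^ (n + k + 2)) * iq (n + k + 2)" using iq[of "n + k + 1"] by simp
    \<comment> \<open>Division with remainder in y: \<open>D (Suc n)\<close> is a multiple of
      \<open>D k\<close> plus a term free of y.\<close>
    have 3: "(1 - q ^ Suc d) * (1 - q ^ (n + k + 2)) = D (Suc n) - q ^ Suc d * D k"
      by (simp add: D d power_add mult_2 eval_nat_numeral algebra_simps)
    have "?c n k * g k = e k * (1 - q ^ (2 * k + 1)) * iq (Suc d) * iq (n + k + 2) * ((1 - q ^ Suc d) * (1 - q ^ (n + k + 2))) * g k"
      using 1 2 by (simp add: d)
    also have "\<dots> = e k * (1 - q ^ (2 * k + 1)) * iq (Suc d) * iq (n + k + 2) * (D (Suc n) * g k - q ^ Suc d * (D k * g k))"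
      unfolding 3 by (simp only: algebra_simps)
    also have "\<dots> = D (Suc n) * (?c (Suc n) k * g k) - ?c (Suc n) k * q ^ (Suc n - k)"
      unfolding g using d by (simp add: algebra_simps Suc_diff_le)
    finally show ?thesis .
  qed
  have last: "D (Suc n) * (?c (Suc n) (Suc n) * g (Suc n)) - ?c (Suc n) (Suc n) * q ^ (Suc n - Suc n) = 0"
    unfolding mult.left_commute[of "D (Suc n)"] g by simp
  have "(\<Prod>j\<le>n. g j) = (\<Sum>k\<le>n. ?c n k * g k)"
    by (rule Suc.IH)
  also have "\<dots> = (\<Sum>k\<le>Suc n. D (Suc n) * (?c (Suc n) k * g k) - ?c (Suc n) k * q ^ (Suc n - k))"
    unfolding sum.atMost_Suc last add_0_right by (intro sum.cong refl step) simp
  also have "\<dots> = D (Suc n) * (\<Sum>k\<le>Suc n. ?c (Suc n) k * g k)"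
    unfolding sum_subtractf sum_distrib_left
    by (subst partial_fraction_sum_eq_0[of q iq e "Suc n"]) (rule q iq e e0 zero_less_Suc diff_zero | assumption)+
  finally have "(\<Prod>j\<le>n. g j) = D (Suc n) * (\<Sum>k\<le>Suc n. ?c (Suc n) k * g k)" .
  then have "(\<Prod>j\<le>Suc n. g j) = (D (Suc n) * g (Suc n)) * (\<Sum>k\<le>Suc n. ?c (Suc n) k * g k)"
    by (simp only: prod.atMost_Suc ac_simps)
  then show ?case by (simp only: g mult_1)
qed

text \<open>A limiting case of the q-Chu-Vandermonde sum: times (q;q)_n, it sorts the partitions
  into at most n + s parts by their Durfee rectangle with sides m and m + s. In the induction,
  splitting 1 - q^(n+1) into q^m (1 - q^(n+1-m)) and 1 - q^m produces two sums that merge into the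
  case n with s + 1, hence the arbitrary \<open>s\<close>.\<close>

lemma durfee_rectangle_sum:
  fixes q :: "'a::idom" and iq :: "nat \<Rightarrow> 'a"
  assumes q: "\<And>n. n > 0 \<Longrightarrow> q ^ n \<noteq> 1"
    and iq: "\<And>m. iq m = (1 - q ^ Suc m) * iq (Suc m)" and iq0: "iq 0 = 1"
  shows "(\<Sum>m\<le>n. q ^ (m * (m + s)) * iq m * iq (n - m) * iq (m + s)) = iq n * iq (n + s)"
proof (induction n arbitrary: s)
  case 0
  then show ?case by (simp add: iq0)
next
  case (Suc n)
  let ?f = "\<lambda>n s m. q ^ (m * (m + s)) * iq m * iq (n - m) * iq (m + s)"
  let ?A = "\<lambda>m. q ^ (m * (m + s)) * iq m * (q ^ m * (1 - q ^ (Suc n - m)) * iq (Suc n - m)) * iq (m + s)"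
  let ?B = "\<lambda>m. q ^ (m * (m + s)) * ((1 - q ^ m) * iq m) * iq (Suc n - m) * iq (m + s)"
  have "(1 - q ^ Suc n) * ?f (Suc n) s m = ?A m + ?B m" if "m \<le> Suc n" for m
  proof -
    have "q ^ Suc n = q ^ m * q ^ (Suc n - m)" using that by (simp flip: power_add)
    then show ?thesis by (simp only: algebra_simps mult_1_left mult_1_right)
  qed
  then have "(1 - q ^ Suc n) * (\<Sum>m\<le>Suc n. ?f (Suc n) s m) = (\<Sum>m\<le>Suc n. ?A m) + (\<Sum>m\<le>Suc n. ?B m)"
    by (simp only: sum_distrib_left flip: sum.distrib) (intro sum.cong, auto)
  also have "(\<Sum>m\<le>Suc n. ?A m) = (\<Sum>m\<le>n. ?A m)" by simp
  also have "(\<Sum>m\<le>Suc n. ?B m) = (\<Sum>m\<le>n. ?B (Suc m))"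
    by (subst sum.atMost_Suc_shift) simp
  also have "(\<Sum>m\<le>n. ?A m) + (\<Sum>m\<le>n. ?B (Suc m)) = (\<Sum>m\<le>n. ?f n (Suc s) m)"
    unfolding sum.distrib[symmetric]
  proof (intro sum.cong refl)
    fix m assume "m \<in> {..n}"
    then have m: "Suc n - m = Suc (n - m)" by auto
    have "?A m = q ^ (m * (m + Suc s)) * iq m * iq (n - m) * ((1 - q ^ Suc (m + s)) * iq (Suc (m + s)))"
      unfolding m iq[symmetric] by (simp add: iq[of "n - m"] power_add algebra_simps)
    moreover have "?B (Suc m) = q ^ (m * (m + Suc s)) * iq m * iq (n - m) * (q ^ Suc (m + s) * iq (Suc (m + s)))"
      unfolding iq[symmetric] by (simp add: power_add algebra_simps)
    ultimately show "?A m + ?B (Suc m) = ?f n (Suc s) m"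
      by (simp add: algebra_simps)
  qed
  also have "\<dots> = (1 - q ^ Suc n) * (iq (Suc n) * iq (Suc n + s))"
    unfolding Suc.IH by (subst iq[of n]) (simp add: mult.assoc)
  finally show ?case using q[of "Suc n"] by simp
qed

text \<open>A finite Bailey lemma. Each product is expanded by
  \<open>partial_fraction_reciprocal\<close>; after exchanging the sums and putting n = k + m, the
  exponent n(n + 1) becomes k(k + 1) + m(m + 2k + 1), and the inner sum is
  \<open>durfee_rectangle_sum\<close> with s = 2k + 1.\<close>

lemma bailey_pair_sum:
  fixes q y :: "'a::idom" and iq e D g :: "nat \<Rightarrow> 'a"
  assumes q: "\<And>n. n > 0 \<Longrightarrow> q ^ n \<noteq> 1"
    and iq: "\<And>m. iq m = (1 - q ^ Suc m) * iq (Suc m)" and iq0: "iq 0 = 1"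
    and e: "\<And>k. e (Suc k) = - (q ^ Suc k) * e k" and e0: "e 0 = 1"
    and D: "\<And>k. D k = 1 - y * q ^ k + q ^ (2 * k + 1)"
    and g: "\<And>k. D k * g k = 1"
  shows "(\<Sum>n\<le>N. q ^ (n * (n + 1)) * iq (N - n) * (\<Prod>j\<le>n. g j)) =
    (\<Sum>k\<le>N. q ^ (k * (k + 1)) * e k * (1 - q ^ (2 * k + 1)) * iq (N - k) * iq (N + k + 1) * g k)"
proof -
  let ?c = "\<lambda>k. e k * (1 - q ^ (2 * k + 1)) * g k"
  let ?F = "\<lambda>n k. q ^ (n * (n + 1)) * iq (N - n) * iq (n - k) * iq (n + k + 1) * ?c k"
  have "(\<Sum>n\<le>N. q ^ (n * (n + 1)) * iq (N - n) * (\<Prod>j\<le>n. g j)) = (\<Sum>n\<le>N. \<Sum>k\<le>n. ?F n k)"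
  proof (intro sum.cong refl)
    fix n
    have "(\<Prod>j\<le>n. g j) = (\<Sum>k\<le>n. e k * (1 - q ^ (2 * k + 1)) * iq (n - k) * iq (n + k + 1) * g k)"
      by (rule partial_fraction_reciprocal[of q iq e D y g]) (rule q iq iq0 e e0 D g | assumption)+
    then show "q ^ (n * (n + 1)) * iq (N - n) * (\<Prod>j\<le>n. g j) = (\<Sum>k\<le>n. ?F n k)"
      by (simp only: sum_distrib_left mult_ac)
  qed
  also have "\<dots> = (\<Sum>k\<le>N. \<Sum>n\<in>{k..N}. ?F n k)"
    by (subst (1 2) sum.Sigma)
      (auto intro!: sum.reindex_bij_witness[of _ "\<lambda>(k, n). (n, k)" "\<lambda>(n, k). (k, n)"])
  also have "\<dots> = (\<Sum>k\<le>N. q ^ (k * (k + 1)) * e k * (1 - q ^ (2 * k + 1)) * iq (N - k) * iq (N + k + 1) * g k)"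
  proof (intro sum.cong refl)
    fix k assume "k \<in> {..N}"
    then obtain d where d: "N = k + d" using le_Suc_ex by auto
    have "(\<Sum>n\<in>{k..N}. ?F n k) = (\<Sum>m\<le>d. ?F (k + m) k)"
      by (intro sum.reindex_bij_witness[of _ "\<lambda>m. k + m" "\<lambda>n. n - k"]) (auto simp: d)
    also have "\<dots> = (\<Sum>m\<le>d. q ^ (k * (k + 1)) * ?c k * (q ^ (m * (m + (2 * k + 1))) * iq m * iq (d - m) * iq (m + (2 * k + 1))))"
      by (intro sum.cong refl) (simp add: d power_add algebra_simps mult_2_right mult_2)
    also have "\<dots> = q ^ (k * (k + 1)) * ?c k * (iq d * iq (d + (2 * k + 1)))"
      unfolding sum_distrib_left[symmetric]
      by (subst durfee_rectangle_sum[of q iq]) (rule q iq iq0 refl | assumption)+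
    moreover have "N - k = d" "N + k + 1 = d + (2 * k + 1)" using d by auto
    ultimately show "(\<Sum>n\<in>{k..N}. ?F n k) =
        q ^ (k * (k + 1)) * e k * (1 - q ^ (2 * k + 1)) * iq (N - k) * iq (N + k + 1) * g k"
      by (simp only: mult_ac)
  qed
  finally show ?thesis .
qed

text \<open>
  Here and below \<open>r m\<close> stands for \<open>(-p;p\<^sup>2)\<^sub>m/(p\<^sup>2;p\<^sup>2)\<^sub>m\<close>. By the \<open>q\<close>-binomial theorem its generating
  function \<open>R\<close> satisfies \<open>R(z) R(-pz) = 1/(1 - z)\<close>, which is the next identity.
\<close>

lemma q_binomial_convolution:
  fixes p :: "'a::idom" and r :: "nat \<Rightarrow> 'a"
  assumes p: "\<And>n. n > 0 \<Longrightarrow> p ^ n \<noteq> 1"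
    and r: "\<And>m. (1 - p ^ (2 * m + 2)) * r (Suc m) = (1 + p ^ (2 * m + 1)) * r m" and r0: "r 0 = 1"
  shows "(\<Sum>i\<le>m. (- p) ^ i * r i * r (m - i)) = 1"
proof (induction m)
  case 0
  then show ?case by (simp add: r0)
next
  case (Suc m)
  let ?a = "\<lambda>i. (- p) ^ i * r i"
  let ?F = "\<lambda>i. ?a i * ((1 - p ^ (2 * (Suc m - i))) * r (Suc m - i))"
  let ?G = "\<lambda>i. ((1 - p ^ (2 * i)) * ?a i) * (p ^ (2 * (Suc m - i)) * r (Suc m - i))"
  \<comment> \<open>The factor is split into two parts, each of which lets the recursion of
    \<open>r\<close> lower the index of one of the two factors.\<close>
  have "(1 - p ^ (2 * m + 2)) * (\<Sum>i\<le>Suc m. ?a i * r (Suc m - i)) = (\<Sum>i\<le>Suc m. ?F i + ?G i)"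
    unfolding sum_distrib_left
  proof (intro sum.cong refl)
    fix i assume "i \<in> {..Suc m}"
    then have "p ^ (2 * m + 2) = p ^ (2 * i) * p ^ (2 * (Suc m - i))"
      unfolding power_add[symmetric] by (intro arg_cong[of _ _ "power p"]) auto
    then show "(1 - p ^ (2 * m + 2)) * (?a i * r (Suc m - i)) = ?F i + ?G i"
      by (simp only: algebra_simps mult_1_left mult_1_right)
  qed
  also have "\<dots> = (\<Sum>i\<le>m. ?F i) + (\<Sum>i\<le>m. ?G (Suc i))"
    unfolding sum.distrib sum.atMost_Suc[of ?F] sum.atMost_Suc_shift[of ?G] by simp
  also have "\<dots> = (\<Sum>i\<le>m. (1 - p ^ (2 * m + 2)) * (?a i * r (m - i)))"
    unfolding sum.distrib[symmetric]
  proof (intro sum.cong refl)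
    fix i assume "i \<in> {..m}"
    then obtain j where j: "m = i + j" using le_Suc_ex by auto
    have 1: "(1 - p ^ (2 * (Suc m - i))) * r (Suc m - i) = (1 + p ^ (2 * j + 1)) * r j"
      using r[of j] by (simp add: j)
    have 2: "(1 - p ^ (2 * Suc i)) * ?a (Suc i) = - p * (1 + p ^ (2 * i + 1)) * ?a i"
    proof -
      have "(1 - p ^ (2 * Suc i)) * ?a (Suc i) = (- p) ^ Suc i * ((1 - p ^ (2 * i + 2)) * r (Suc i))"
        by (simp add: algebra_simps)
      then show ?thesis unfolding r by (simp add: algebra_simps)
    qed
    have "?F i + ?G (Suc i) = ?a i * ((1 + p ^ (2 * j + 1)) * r j) + (- p * (1 + p ^ (2 * i + 1)) * ?a i) * (p ^ (2 * j) * r j)"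
      unfolding 1 2 by (simp add: j)
    also have "\<dots> = (1 - p ^ (2 * m + 2)) * (?a i * r (m - i))"
      by (simp add: j power_add algebra_simps mult_2)
    finally show "?F i + ?G (Suc i) = (1 - p ^ (2 * m + 2)) * (?a i * r (m - i))" .
  qed
  also have "\<dots> = 1 - p ^ (2 * m + 2)"
    using Suc.IH by (simp flip: sum_distrib_left)
  finally show ?case using p[of "2 * m + 2"] by simp
qed

text \<open>In \<open>q_binomial_convolution\<close> at 2n + 1 the summands i = n - k and i = n + 1
  + k share the product \<open>r (n - k) * r (n + k + 1)\<close>, and their powers of -p differ by
  (-p)^(2k+1); this produces 1 - p^(2k+1). Up to normalisation the result is the coefficient of 1/y
  at infinity in \<open>partial_fraction_quotient\<close>.\<close>

lemma q_binomial_folded_convolution: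
  fixes p :: "'a::idom" and r :: "nat \<Rightarrow> 'a"
  assumes p: "\<And>n. n > 0 \<Longrightarrow> p ^ n \<noteq> 1"
    and r: "\<And>m. (1 - p ^ (2 * m + 2)) * r (Suc m) = (1 + p ^ (2 * m + 1)) * r m" and r0: "r 0 = 1"
  shows "(\<Sum>k\<le>n. (- 1) ^ k * p ^ k * (1 - p ^ (2 * k + 1)) * r (n - k) * r (n + k + 1) * p ^ (2 * (n - k))) = (- p) ^ n"
proof -
  let ?h = "\<lambda>i. (- p) ^ i * r i * r (2 * n + 1 - i)"
  let ?c = "\<lambda>k. (- 1) ^ k * p ^ k * (1 - p ^ (2 * k + 1)) * r (n - k) * r (n + k + 1) * p ^ (2 * (n - k))"
  have *: "?c k = (- p) ^ n * (?h (n - k) + ?h (n + 1 + k))" if "k \<le> n" for k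
  proof -
    obtain d where d: "n = k + d" using \<open>k \<le> n\<close> le_Suc_ex by blast
    have "?c k = (- p) ^ k * (1 + (- p) ^ (2 * k + 1)) * r (n - k) * r (n + k + 1) * (- p) ^ (2 * d)"
    proof -
      have "(- p) ^ k = (- 1) ^ k * p ^ k" by (rule power_minus)
      moreover have "(- p) ^ (2 * d) = p ^ (2 * d)" "(- p) ^ (2 * k + 1) = - (p ^ (2 * k + 1))" by simp_all
      moreover have "n - k = d" using d by simp
      ultimately show ?thesis by (simp only: diff_conv_add_uminus)
    qed
    also have "\<dots> = (- p) ^ (k + 2 * d) * (1 + (- p) ^ (2 * k + 1)) * r (n - k) * r (n + k + 1)"
      by (simp only: power_add mult_ac)
    also have "\<dots> = ((- p) ^ (n + d) + (- p) ^ (n + (n + 1 + k))) * (r (n - k) * r (n + k + 1))"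
    proof -
      have "k + 2 * d = n + d" "n + (n + 1 + k) = (n + d) + (2 * k + 1)" using d by auto
      then have "(- p) ^ (k + 2 * d) = (- p) ^ (n + d)" "(- p) ^ (n + (n + 1 + k)) = (- p) ^ (n + d) * (- p) ^ (2 * k + 1)"
        by (simp_all only: power_add[of _ "n + d"])
      then show ?thesis by (simp only: distrib_left distrib_right mult_1_left mult_1_right mult_ac)
    qed
    also have "\<dots> = (- p) ^ n * (?h (n - k) + ?h (n + 1 + k))"
    proof -
      have "2 * n + 1 - (n - k) = n + k + 1" "2 * n + 1 - (n + 1 + k) = n - k" "n - k = d" "n + 1 + k = n + k + 1" using d by auto
      then show ?thesis by (simp only: power_add[of "- p" n] distrib_left distrib_right mult_ac)
    qed
    finally show ?thesis .
  qed
  have "(\<Sum>k\<le>n. ?c k) = (- p) ^ n * ((\<Sum>k\<le>n. ?h (n - k)) + (\<Sum>k\<le>n. ?h (n + 1 + k)))"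
    unfolding sum.distrib[symmetric] sum_distrib_left using * by (intro sum.cong) auto
  also have "(\<Sum>k\<le>n. ?h (n - k)) = (\<Sum>i\<in>{..n}. ?h i)"
    by (intro sum.reindex_bij_witness[of _ "\<lambda>i. n - i" "\<lambda>i. n - i"]) auto
  also have "(\<Sum>k\<le>n. ?h (n + 1 + k)) = (\<Sum>i\<in>{n+1..2*n+1}. ?h i)"
    by (intro sum.reindex_bij_witness[of _ "\<lambda>i. i - (n + 1)" "\<lambda>i. n + 1 + i"]) auto
  also have "(\<Sum>i\<in>{..n}. ?h i) + (\<Sum>i\<in>{n+1..2*n+1}. ?h i) = (\<Sum>i\<le>2*n+1. ?h i)"
  proof -
    have "{..2 * n + 1} = {..n} \<union> {n + 1..2 * n + 1}" by auto
    then show ?thesis by (simp only:) (subst sum.union_disjoint; simp)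
  qed
  also have "\<dots> = 1"
    by (rule q_binomial_convolution[of p r]) (rule p r r0 | assumption)+
  finally show ?thesis by simp
qed

text \<open>The case \<open>n = \<infinity>\<close> expands a quotient of two theta functions into simple fractions.\<close>
lemma partial_fraction_quotient:
  fixes p y :: "'a::idom" and r D g :: "nat \<Rightarrow> 'a"
  assumes p: "\<And>n. n > 0 \<Longrightarrow> p ^ n \<noteq> 1"
    and r: "\<And>m. (1 - p ^ (2 * m + 2)) * r (Suc m) = (1 + p ^ (2 * m + 1)) * r m" and r0: "r 0 = 1"
    and D: "\<And>k. D k = 1 - y * p ^ (2 * k) + p ^ (4 * k + 2)"
    and g: "\<And>k. D k * g k = 1"
  shows "(\<Prod>j<n. 1 + y * p ^ (2 * j + 1) + p ^ (4 * j + 4)) * (\<Prod>j\<le>n. g j) =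
    (\<Sum>k\<le>n. (- 1) ^ k * p ^ k * (1 - p ^ (2 * k + 1)) * r (n - k) * r (n + k + 1) * g k)"
proof (induction n)
  case 0
  have "(1 - p) * (r (Suc 0) * (1 + p)) = (1 + p) * 1"
    using r[of 0] r0 by (simp add: algebra_simps power2_eq_square)
  moreover have "1 + p \<noteq> 0"
  proof
    assume "1 + p = 0"
    then have "(1 + p) * (1 - p) = 0" by simp
    then show False using p[of 2] by (simp add: algebra_simps power2_eq_square)
  qed
  ultimately have "(1 - p) * r (Suc 0) = 1" by (metis mult.assoc mult.commute mult_right_cancel)
  then show ?case by (simp add: r0)
next
  case (Suc n)
  let ?c = "\<lambda>n k. (- 1) ^ k * p ^ k * (1 - p ^ (2 * k + 1)) * r (n - k) * r (n + k + 1)"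
  let ?N = "1 + y * p ^ (2 * n + 1) + p ^ (4 * n + 4)"
  have step: "?N * (?c n k * g k) + p * (?c n k * p ^ (2 * (n - k))) =
      D (Suc n) * (?c (Suc n) k * g k) - ?c (Suc n) k * p ^ (2 * (Suc n - k))"
    if "k \<le> n" for k
  proof -
    obtain d where d: "n = k + d" using \<open>k \<le> n\<close> le_Suc_ex by blast
    let ?e = "(- 1) ^ k * p ^ k * (1 - p ^ (2 * k + 1))"
    have 1: "(1 - p ^ (2 * d + 2)) * r (Suc d) = (1 + p ^ (2 * d + 1)) * r d" by (rule r)
    have 2: "(1 - p ^ (2 * (n + k + 1) + 2)) * r (Suc (n + k + 1)) = (1 + p ^ (2 * (n + k + 1) + 1)) * r (n + k + 1)"
      by (rule r)
    have 3: "(1 - p ^ (2 * d + 2)) * (1 - p ^ (2 * (n + k + 1) + 2)) = D (Suc n) - p ^ (2 * d + 2) * D k"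
      unfolding D by (simp add: d power_add mult_2 eval_nat_numeral algebra_simps)
    have 4: "(1 + p ^ (2 * d + 1)) * (1 + p ^ (2 * (n + k + 1) + 1)) = ?N + p ^ (2 * d + 1) * D k"
      unfolding D by (simp add: d power_add mult_2 eval_nat_numeral algebra_simps)
    have "?e * r d * r (n + k + 1) * ((?N + p ^ (2 * d + 1) * D k) * g k) =
        ?e * ((1 + p ^ (2 * d + 1)) * r d) * ((1 + p ^ (2 * (n + k + 1) + 1)) * r (n + k + 1)) * g k"
      unfolding 4[symmetric] by (simp only: mult_ac)
    also have "\<dots> = ?e * r (Suc d) * r (Suc (n + k + 1)) * ((D (Suc n) - p ^ (2 * d + 2) * D k) * g k)"
      unfolding 1[symmetric] 2[symmetric] 3[symmetric] by (simp only: mult_ac)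
    finally have "?e * r d * r (n + k + 1) * (?N * g k + p ^ (2 * d + 1) * (D k * g k)) =
        ?e * r (Suc d) * r (Suc (n + k + 1)) * (D (Suc n) * g k - p ^ (2 * d + 2) * (D k * g k))"
      by (simp only: algebra_simps)
    then show ?thesis
      unfolding g using d by (simp add: algebra_simps Suc_diff_le)
  qed
  have last: "D (Suc n) * (?c (Suc n) (Suc n) * g (Suc n)) - ?c (Suc n) (Suc n) * p ^ (2 * (Suc n - Suc n)) = 0"
    unfolding mult.left_commute[of "D (Suc n)"] g by simp
  have conv: "(\<Sum>k\<le>n. ?c n k * p ^ (2 * (n - k))) = (- p) ^ n" for n
    by (rule q_binomial_folded_convolution) (rule p r r0 | assumption)+
  \<comment> \<open>The terms free of \<open>g\<close> cancel: p (-p)^n on the left against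
    -(-p)^(n+1) on the right.\<close>
  have "?N * (\<Sum>k\<le>n. ?c n k * g k) + p * (\<Sum>k\<le>n. ?c n k * p ^ (2 * (n - k))) =
      (\<Sum>k\<le>n. D (Suc n) * (?c (Suc n) k * g k) - ?c (Suc n) k * p ^ (2 * (Suc n - k)))"
    unfolding sum_distrib_left sum.distrib[symmetric] by (intro sum.cong refl step) simp
  also have "\<dots> = (\<Sum>k\<le>Suc n. D (Suc n) * (?c (Suc n) k * g k) - ?c (Suc n) k * p ^ (2 * (Suc n - k)))"
    unfolding sum.atMost_Suc last add_0_right ..
  also have "\<dots> = D (Suc n) * (\<Sum>k\<le>Suc n. ?c (Suc n) k * g k) - (- p) ^ Suc n"
    unfolding sum_subtractf sum_distrib_left[symmetric] conv ..
  finally have "?N * (\<Sum>k\<le>n. ?c n k * g k) = D (Suc n) * (\<Sum>k\<le>Suc n. ?c (Suc n) k * g k)"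
    unfolding conv by simp
  then have "g (Suc n) * (?N * (\<Sum>k\<le>n. ?c n k * g k)) = (D (Suc n) * g (Suc n)) * (\<Sum>k\<le>Suc n. ?c (Suc n) k * g k)"
    by (simp only: mult_ac)
  then show ?case
    unfolding g Suc.IH[symmetric] prod.atMost_Suc prod.lessThan_Suc by (simp only: mult_ac mult_1_left)
qed

text \<open>Here \<open>t k\<close> stands for x^k q^(k(k-1)/2) and \<open>x'\<close> for q/x.
  Negative powers of x need not exist in the ring, so only relations between neighbouring values of
  \<open>t\<close> are assumed; the bound on k keeps their exponents nonnegative. \<open>I\<close>
  extends 1/(q;q)_m by 0 to m < 0, so that shifted sums can be taken over one common range.\<close>

lemma finite_jacobi_triple_product:
  fixes q x x' :: "'a::idom" and iq :: "nat \<Rightarrow> 'a" and t I :: "int \<Rightarrow> 'a"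
  assumes q: "\<And>n. n > 0 \<Longrightarrow> q ^ n \<noteq> 1"
    and iq: "\<And>m. iq m = (1 - q ^ Suc m) * iq (Suc m)" and iq0: "iq 0 = 1"
    and I: "\<And>m. I m = (if m < 0 then 0 else iq (nat m))"
    and x: "\<And>n k. \<bar>k\<bar> \<le> int n \<Longrightarrow> x * q ^ n * t k = q ^ nat (int n - k) * t (k + 1)"
    and x': "\<And>n k. \<bar>k\<bar> \<le> int n \<Longrightarrow> x' * q ^ n * t k = q ^ nat (int n + k) * t (k - 1)"
    and xx': "x * x' = q" and t0: "t 0 = 1"
  shows "(\<Prod>j<n. (1 + x * q ^ j) * (1 + x' * q ^ j)) * iq (2 * n) =
    (\<Sum>k\<in>{- int n..int n}. I (int n - k) * I (int n + k) * t k)"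
proof (induction n)
  case 0
  then show ?case by (simp add: I iq0 t0)
next
  case (Suc n)
  let ?d = "\<lambda>n k. I (int n - k) * I (int n + k)"
  let ?Z = "{- int (Suc n)..int (Suc n)}"
  have I_rec: "I (m - 1) = (1 - q ^ nat m) * I m" for m
  proof (cases "m \<le> 0")
    case True
    then show ?thesis by (simp add: I)
  next
    case False
    then have "nat m = Suc (nat (m - 1))" by simp
    then show ?thesis using False iq[of "nat (m - 1)"] by (simp add: I)
  qed
  have coeff: "(1 + q ^ (2 * n + 1)) * ?d n k + q ^ nat (int n - (k - 1)) * ?d n (k - 1) + q ^ nat (int n + (k + 1)) * ?d n (k + 1)
      = (1 - q ^ (2 * n + 1)) * (1 - q ^ (2 * n + 2)) * ?d (Suc n) k" if "k \<in> ?Z" for k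
  proof -
    define u v where "u = int n + 1 - k" and "v = int n + 1 + k"
    have uv: "u \<ge> 0" "v \<ge> 0" "u + v = 2 * int n + 2" using that by (auto simp: u_def v_def)
    have eqs: "int n - k = u - 1" "int n + k = v - 1" "int n - (k - 1) = u" "int n + (k + 1) = v"
      "int n + (k - 1) = v - 1 - 1" "int n - (k + 1) = u - 1 - 1" "int (Suc n) - k = u" "int (Suc n) + k = v"
      by (auto simp: u_def v_def)
    define a b a' b' where "a = q ^ nat u" and "b = q ^ nat v" and "a' = q ^ nat (u - 1)" and "b' = q ^ nat (v - 1)"
    \<comment> \<open>At u = 0 the value of \<open>a'\<close> is 1 instead of the inverse of q,
      which is harmless as its term carries the factor 1 - a = 0; likewise at v = 0.\<close>
    have pow: "(1 + q ^ (2 * n + 1)) * (1 - a) * (1 - b) + a * (1 - b) * (1 - b') + b * (1 - a) * (1 - a')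
        = (1 - q ^ (2 * n + 1)) * (1 - q ^ (2 * n + 2))"
    proof (cases "u = 0 \<or> v = 0")
      case True
      then show ?thesis
      proof
        assume "u = 0"
        then have "nat v = 2 * n + 2" "nat (v - 1) = 2 * n + 1" using uv by auto
        then show ?thesis using \<open>u = 0\<close> by (simp add: a_def b_def a'_def b'_def mult_ac)
      next
        assume "v = 0"
        then have "nat u = 2 * n + 2" "nat (u - 1) = 2 * n + 1" using uv by auto
        then show ?thesis using \<open>v = 0\<close> by (simp add: a_def b_def a'_def b'_def mult_ac)
      qed
    next
      case False
      then have "nat u = Suc (nat (u - 1))" "nat v = Suc (nat (v - 1))" "2 * n + 1 = Suc (nat (u - 1) + nat (v - 1))"
        using uv by auto
      then have "a = q * a'" "b = q * b'" "q ^ (2 * n + 1) = q * (a' * b')" "q ^ (2 * n + 2) = q * q * (a' * b')"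
        by (simp_all add: a_def b_def a'_def b'_def power_add)
      then show ?thesis by (simp only:) (simp add: algebra_simps)
    qed
    have "(1 + q ^ (2 * n + 1)) * (((1 - a) * I u) * ((1 - b) * I v)) + a * (I u * ((1 - b') * ((1 - b) * I v)))
       + b * (((1 - a') * ((1 - a) * I u)) * I v)
       = ((1 + q ^ (2 * n + 1)) * (1 - a) * (1 - b) + a * (1 - b) * (1 - b') + b * (1 - a) * (1 - a')) * (I u * I v)"
      by (simp add: algebra_simps)
    then show ?thesis
      unfolding eqs I_rec pow a_def[symmetric] b_def[symmetric] a'_def[symmetric] b'_def[symmetric] .
  qed
  have I0: "I m = 0" if "m < 0" for m using that by (simp add: I)
  have inner: "(1 + x * q ^ n) * (1 + x' * q ^ n) * (?d n k * t k) =
      (1 + q ^ (2 * n + 1)) * (?d n k * t k) + ?d n k * (q ^ nat (int n - k) * t (k + 1)) + ?d n k * (q ^ nat (int n + k) * t (k - 1))"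
    if "\<bar>k\<bar> \<le> int n" for k
  proof -
    have "(1 + x * q ^ n) * (1 + x' * q ^ n) = 1 + x * q ^ n + x' * q ^ n + x * x' * q ^ (2 * n)"
      unfolding mult_2 power_add by (simp add: algebra_simps)
    then have "(1 + x * q ^ n) * (1 + x' * q ^ n) * (?d n k * t k) =
      (1 + q ^ (2 * n + 1)) * (?d n k * t k) + ?d n k * (x * q ^ n * t k) + ?d n k * (x' * q ^ n * t k)"
      unfolding xx' by (simp add: algebra_simps)
    then show ?thesis unfolding x[OF that] x'[OF that] .
  qed
  have ext: "(\<Sum>k\<in>{- int n..int n}. ?d n k * t k) = (\<Sum>k\<in>?Z. ?d n k * t k)"
    by (intro sum.mono_neutral_left) (auto simp: I0)
  have "(1 + x * q ^ n) * (1 + x' * q ^ n) * (\<Sum>k\<in>{- int n..int n}. ?d n k * t k) =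
     (1 + q ^ (2 * n + 1)) * (\<Sum>k\<in>{- int n..int n}. ?d n k * t k)
     + (\<Sum>k\<in>{- int n..int n}. ?d n k * (q ^ nat (int n - k) * t (k + 1)))
     + (\<Sum>k\<in>{- int n..int n}. ?d n k * (q ^ nat (int n + k) * t (k - 1)))"
    unfolding sum_distrib_left sum.distrib[symmetric] by (intro sum.cong refl inner) auto
  also note ext
  also have "(\<Sum>k\<in>{- int n..int n}. ?d n k * (q ^ nat (int n - k) * t (k + 1))) =
      (\<Sum>k\<in>?Z. ?d n (k - 1) * (q ^ nat (int n - (k - 1)) * t k))"
    by (rule trans[OF sum.reindex_bij_witness[of _ "\<lambda>k. k - 1" "\<lambda>k. k + 1" "{- int n + 1..int n + 1}"]
          sum.mono_neutral_left]) (auto simp: I0)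
  also have "(\<Sum>k\<in>{- int n..int n}. ?d n k * (q ^ nat (int n + k) * t (k - 1))) =
      (\<Sum>k\<in>?Z. ?d n (k + 1) * (q ^ nat (int n + (k + 1)) * t k))"
    by (rule trans[OF sum.reindex_bij_witness[of _ "\<lambda>k. k + 1" "\<lambda>k. k - 1" "{- int n - 1..int n - 1}"]
          sum.mono_neutral_left]) (auto simp: I0)
  also have "(1 + q ^ (2 * n + 1)) * (\<Sum>k\<in>?Z. ?d n k * t k) + (\<Sum>k\<in>?Z. ?d n (k - 1) * (q ^ nat (int n - (k - 1)) * t k))
     + (\<Sum>k\<in>?Z. ?d n (k + 1) * (q ^ nat (int n + (k + 1)) * t k)) =
     (\<Sum>k\<in>?Z. ((1 + q ^ (2 * n + 1)) * ?d n k + q ^ nat (int n - (k - 1)) * ?d n (k - 1) + q ^ nat (int n + (k + 1)) * ?d n (k + 1)) * t k)"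
    unfolding sum_distrib_left sum.distrib[symmetric] by (intro sum.cong refl) (simp only: distrib_right distrib_left mult_ac)
  also have "\<dots> = (1 - q ^ (2 * n + 1)) * (1 - q ^ (2 * n + 2)) * (\<Sum>k\<in>?Z. ?d (Suc n) k * t k)"
    unfolding sum_distrib_left by (intro sum.cong refl) (simp only: coeff mult.assoc)
  finally have *: "(1 + x * q ^ n) * (1 + x' * q ^ n) * (\<Sum>k\<in>{- int n..int n}. ?d n k * t k) =
      (1 - q ^ (2 * n + 1)) * (1 - q ^ (2 * n + 2)) * (\<Sum>k\<in>?Z. ?d (Suc n) k * t k)"
    unfolding ext .
  have "iq (2 * n) = (1 - q ^ (2 * n + 1)) * ((1 - q ^ (2 * n + 2)) * iq (2 * Suc n))"
    using iq[of "2 * n"] iq[of "2 * n + 1"] by simp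
  then have "(1 - q ^ (2 * n + 1)) * (1 - q ^ (2 * n + 2)) * ((\<Prod>j<Suc n. (1 + x * q ^ j) * (1 + x' * q ^ j)) * iq (2 * Suc n))
     = (1 + x * q ^ n) * (1 + x' * q ^ n) * ((\<Prod>j<n. (1 + x * q ^ j) * (1 + x' * q ^ j)) * iq (2 * n))"
    by (simp only: prod.lessThan_Suc mult_ac)
  also have "\<dots> = (1 - q ^ (2 * n + 1)) * (1 - q ^ (2 * n + 2)) * (\<Sum>k\<in>?Z. ?d (Suc n) k * t k)"
    unfolding Suc.IH * ..
  finally show ?case using q[of "2 * n + 1"] q[of "2 * n + 2"] by simp
qed

section \<open>Locally finite sums of power series\<close>

definition locally_finite :: "('i \<Rightarrow> 'a::zero fps) \<Rightarrow> bool" where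
  "locally_finite f \<longleftrightarrow> (\<forall>n. finite {i. f i $ n \<noteq> 0})"

text \<open>Each coefficient is a finite sum over an unordered index type, so bijections of the
  index set and exchanges of summation are purely algebraic. The value is meaningful for
  \<open>locally_finite\<close> families, since an infinite support would give the default
  0.\<close>

definition fps_Sum :: "('i \<Rightarrow> 'a::comm_monoid_add fps) \<Rightarrow> 'a fps" where
  "fps_Sum f = Abs_fps (\<lambda>n. \<Sum>i | f i $ n \<noteq> 0. f i $ n)"

lemma fps_Sum_nth: "finite S \<Longrightarrow> {i. f i $ n \<noteq> 0} \<subseteq> S \<Longrightarrow> fps_Sum f $ n = (\<Sum>i\<in>S. f i $ n)"
  unfolding fps_Sum_def fps_nth_Abs_fps by (rule sum.mono_neutral_left) auto

lemma locally_finiteI: "(\<And>n. finite (F n)) \<Longrightarrow> (\<And>n i. f i $ n \<noteq> 0 \<Longrightarrow> i \<in> F n) \<Longrightarrow> locally_finite f"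
  unfolding locally_finite_def by (metis (mono_tags, lifting) finite_subset mem_Collect_eq subsetI)

lemma locally_finiteD: "locally_finite f \<Longrightarrow> finite {i. f i $ n \<noteq> 0}"
  by (simp add: locally_finite_def)

lemma locally_finite_upto:
  assumes "locally_finite f" shows "finite {i. \<exists>m\<le>n. f i $ m \<noteq> 0}"
proof -
  have "{i. \<exists>m\<le>n. f i $ m \<noteq> 0} = (\<Union>m\<le>n. {i. f i $ m \<noteq> 0})" by auto
  then show ?thesis using assms by (auto simp: locally_finite_def)
qed

lemma fps_mult_nth_nonzeroD:
  fixes f g :: "'a::semiring_0 fps"
  assumes "(f * g) $ n \<noteq> 0" shows "\<exists>i\<le>n. \<exists>j\<le>n. f $ i \<noteq> 0 \<and> g $ j \<noteq> 0"
proof (rule ccontr)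
  assume "\<not> ?thesis"
  then have "f $ i * g $ (n - i) = 0" if "i \<le> n" for i
    using that by (metis diff_le_self mult_zero_left mult_zero_right)
  then have "(f * g) $ n = 0" by (simp add: fps_mult_nth)
  with assms show False by simp
qed

lemma fps_Sum_add:
  assumes "locally_finite f" "locally_finite g"
  shows "fps_Sum (\<lambda>i. f i + g i) = fps_Sum f + fps_Sum g"
proof (rule fps_ext)
  fix n
  let ?S = "{i. f i $ n \<noteq> 0} \<union> {i. g i $ n \<noteq> 0}"
  have "finite ?S" using assms by (simp add: locally_finite_def)
  then show "fps_Sum (\<lambda>i. f i + g i) $ n = (fps_Sum f + fps_Sum g) $ n"
    by (subst fps_Sum_nth[of ?S], assumption, force)
      (simp add: fps_Sum_nth[of ?S] sum.distrib)
qed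

lemma fps_Sum_cmult:
  fixes g :: "'a::comm_semiring_1 fps"
  assumes f: "locally_finite f"
  shows "fps_Sum (\<lambda>i. g * f i) = g * fps_Sum f"
proof (rule fps_ext)
  fix n
  let ?S = "{i. \<exists>m\<le>n. f i $ m \<noteq> 0}"
  have S: "finite ?S" by (rule locally_finite_upto[OF f])
  have "fps_Sum (\<lambda>i. g * f i) $ n = (\<Sum>i\<in>?S. (g * f i) $ n)"
    by (rule fps_Sum_nth[OF S]) (auto dest: fps_mult_nth_nonzeroD)
  also have "\<dots> = (\<Sum>j=0..n. g $ j * (\<Sum>i\<in>?S. f i $ (n - j)))"
    unfolding fps_mult_nth sum_distrib_left by (rule sum.swap)
  also have "\<dots> = (\<Sum>j=0..n. g $ j * fps_Sum f $ (n - j))"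
    by (intro sum.cong refl arg_cong2[of _ _ _ _ "(*)"] fps_Sum_nth[OF S, symmetric])
      (auto intro: diff_le_self)
  finally show "fps_Sum (\<lambda>i. g * f i) $ n = (g * fps_Sum f) $ n" by (simp add: fps_mult_nth)
qed

lemma fps_Sum_reindex:
  assumes h: "inj h" and z: "\<And>i. i \<notin> range h \<Longrightarrow> f i = 0"
  shows "fps_Sum f = fps_Sum (\<lambda>j. f (h j))"
proof (rule fps_ext)
  fix n
  have "{i. f i $ n \<noteq> 0} = h ` {j. f (h j) $ n \<noteq> 0}"
    using z by (auto simp: image_iff) (metis fps_zero_nth rangeE)
  then show "fps_Sum f $ n = fps_Sum (\<lambda>j. f (h j)) $ n"
    using h by (simp add: fps_Sum_def sum.reindex inj_on_def)
qed

lemma locally_finite_reindex: "inj h \<Longrightarrow> locally_finite f \<Longrightarrow> locally_finite (\<lambda>j. f (h j))"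
  unfolding locally_finite_def using finite_vimageI[of "{i. f i $ n \<noteq> 0}" h for n] by (simp add: vimage_def)

lemma fps_Sum_fubini:
  assumes f: "locally_finite f"
  shows "fps_Sum f = fps_Sum (\<lambda>i. fps_Sum (\<lambda>j. f (i, j)))" "locally_finite (\<lambda>i. fps_Sum (\<lambda>j. f (i, j)))"
proof -
  let ?S = "\<lambda>n. {i. f i $ n \<noteq> 0}"
  have fin: "finite (?S n)" for n by (rule locally_finiteD[OF f])
  have inner: "fps_Sum (\<lambda>j. f (i, j)) $ n = (\<Sum>j\<in>snd ` ?S n. f (i, j) $ n)" for i n
    by (rule fps_Sum_nth) (use fin in \<open>force+\<close>)
  have zero: "fps_Sum (\<lambda>j. f (i, j)) $ n = 0" if "i \<notin> fst ` ?S n" for i n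
    unfolding inner using that by (intro sum.neutral) force
  show "locally_finite (\<lambda>i. fps_Sum (\<lambda>j. f (i, j)))"
    using zero fin by (intro locally_finiteI[where F = "\<lambda>n. fst ` ?S n"]) auto
  show "fps_Sum f = fps_Sum (\<lambda>i. fps_Sum (\<lambda>j. f (i, j)))"
  proof (rule fps_ext)
    fix n
    have "fps_Sum f $ n = (\<Sum>p\<in>fst ` ?S n \<times> snd ` ?S n. f p $ n)"
      by (rule fps_Sum_nth) (use fin in \<open>force+\<close>)
    also have "\<dots> = (\<Sum>i\<in>fst ` ?S n. fps_Sum (\<lambda>j. f (i, j)) $ n)"
      unfolding inner sum.cartesian_product by (intro sum.cong) auto
    also have "\<dots> = fps_Sum (\<lambda>i. fps_Sum (\<lambda>j. f (i, j))) $ n"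
      using zero fin by (intro fps_Sum_nth[symmetric]) auto
    finally show "fps_Sum f $ n = fps_Sum (\<lambda>i. fps_Sum (\<lambda>j. f (i, j))) $ n" .
  qed
qed

lemma locally_finite_mult:
  fixes f :: "'i \<Rightarrow> 'a::comm_semiring_1 fps"
  assumes f: "locally_finite f" and g: "locally_finite g"
  shows "locally_finite (\<lambda>(i, j). f i * g j)"
  by (rule locally_finiteI[where F = "\<lambda>n. {i. \<exists>m\<le>n. f i $ m \<noteq> 0} \<times> {j. \<exists>m\<le>n. g j $ m \<noteq> 0}"])
    (auto intro: locally_finite_upto[OF f] locally_finite_upto[OF g] dest: fps_mult_nth_nonzeroD)

lemma fps_Sum_mult:
  fixes f :: "'i \<Rightarrow> 'a::comm_semiring_1 fps"
  assumes f: "locally_finite f" and g: "locally_finite g"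
  shows "fps_Sum f * fps_Sum g = fps_Sum (\<lambda>(i, j). f i * g j)"
proof -
  have "fps_Sum (\<lambda>(i, j). f i * g j) = fps_Sum (\<lambda>i. fps_Sum (\<lambda>j. f i * g j))"
    using fps_Sum_fubini(1)[OF locally_finite_mult[OF f g]] by simp
  also have "\<dots> = fps_Sum g * fps_Sum f"
    by (simp add: fps_Sum_cmult[OF f] fps_Sum_cmult[OF g] flip: mult.commute[of "fps_Sum g"])
  finally show ?thesis by (simp add: mult.commute)
qed

text \<open>Tannery's theorem in the X-adic topology: one finite index set \<open>S k\<close>,
  independent of n, controls coefficient k of all families at once.\<close>

lemma tendsto_fps_Sum:
  fixes f :: "nat \<Rightarrow> 'i \<Rightarrow> 'a::ab_group_add fps"
  assumes fin: "\<And>k. finite (S k)" and z: "\<And>n k i. f n i $ k \<noteq> 0 \<Longrightarrow> i \<in> S k"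
    and lim: "\<And>i. (\<lambda>n. f n i) \<longlonglongrightarrow> g i"
  shows "(\<lambda>n. fps_Sum (f n)) \<longlonglongrightarrow> fps_Sum g" "locally_finite g"
proof -
  have g: "i \<in> S k" if "g i $ k \<noteq> 0" for i k
  proof -
    have "eventually (\<lambda>n. f n i $ k = g i $ k) sequentially"
      using lim[of i] by (simp add: tendsto_fps_iff)
    then obtain n where "f n i $ k = g i $ k" by (auto simp: eventually_sequentially)
    with that show ?thesis using z[of n i k] by simp
  qed
  show "locally_finite g" using fin g by (rule locally_finiteI)
  show "(\<lambda>n. fps_Sum (f n)) \<longlonglongrightarrow> fps_Sum g"
  proof (rule tendsto_fpsI)
    fix k
    have "eventually (\<lambda>n. \<forall>i\<in>S k. f n i $ k = g i $ k) sequentially"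
      using lim by (simp add: eventually_ball_finite_distrib fin tendsto_fps_iff)
    then show "eventually (\<lambda>n. fps_Sum (f n) $ k = fps_Sum g $ k) sequentially"
    proof eventually_elim
      case (elim n)
      have "fps_Sum (f n) $ k = (\<Sum>i\<in>S k. f n i $ k)" using z by (intro fps_Sum_nth fin) auto
      also have "\<dots> = (\<Sum>i\<in>S k. g i $ k)" using elim by simp
      also have "\<dots> = fps_Sum g $ k" using g by (intro fps_Sum_nth[symmetric] fin) auto
      finally show ?case .
    qed
  qed
qed

lemma fps_Sum_finite: "finite A \<Longrightarrow> (\<And>i. i \<notin> A \<Longrightarrow> f i = 0) \<Longrightarrow> fps_Sum f = (\<Sum>i\<in>A. f i)"
  by (rule fps_ext) (subst fps_Sum_nth[of A]; force simp: fps_sum_nth)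

lemma tendsto_fps_mult:
  fixes f g :: "nat \<Rightarrow> 'a::comm_ring_1 fps"
  assumes "f \<longlonglongrightarrow> F" "g \<longlonglongrightarrow> G"
  shows "(\<lambda>n. f n * g n) \<longlonglongrightarrow> F * G"
proof (rule tendsto_fpsI)
  fix k
  have "eventually (\<lambda>n. \<forall>i\<in>{..k}. f n $ i = F $ i \<and> g n $ i = G $ i) sequentially"
    using assms by (simp add: eventually_ball_finite_distrib eventually_conj_iff tendsto_fps_iff)
  then show "eventually (\<lambda>n. (f n * g n) $ k = (F * G) $ k) sequentially"
    by eventually_elim (simp add: fps_mult_nth)
qed

text \<open>Write G as g_n (f_n G): once f_n G agrees with 1 up to order k, this product has the
  same coefficient k as g_n.\<close>

lemma tendsto_fps_inverse:
  fixes f g :: "nat \<Rightarrow> 'a::comm_ring_1 fps"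
  assumes f: "f \<longlonglongrightarrow> F" and inv: "\<And>n. f n * g n = 1" and FG: "F * G = 1"
  shows "g \<longlonglongrightarrow> G"
proof (rule tendsto_fpsI)
  fix k
  have "(\<lambda>n. f n * G) \<longlonglongrightarrow> F * G"
    using tendsto_fps_mult[OF f tendsto_const] .
  then have "eventually (\<lambda>n. \<forall>i\<in>{..k}. (f n * G) $ i = 1 $ i) sequentially"
    by (simp only: FG eventually_ball_finite_distrib[OF finite_atMost]) (simp add: tendsto_fps_iff)
  then show "eventually (\<lambda>n. g n $ k = G $ k) sequentially"
  proof eventually_elim
    case (elim n)
    have "g n * (f n * G) = (f n * g n) * G" by (simp only: mult_ac)
    then have "G $ k = (g n * (f n * G)) $ k" by (simp add: inv)
    also have "\<dots> = (g n * 1) $ k" unfolding fps_mult_nth[of "g n"] using elim by (intro sum.cong) auto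
    finally show ?case by simp
  qed
qed

lemma tendsto_fps_eventually_nth:
  fixes f :: "nat \<Rightarrow> 'a::comm_ring_1 fps"
  shows "f \<longlonglongrightarrow> F \<Longrightarrow> eventually (\<lambda>n. f n $ k = F $ k) sequentially"
  by (simp add: tendsto_fps_iff)

section \<open>Infinite products\<close>

text \<open>If q has constant term 0, the factors from index i + 1 on are 1 modulo X^(i+1), so
  coefficient i is final after i + 1 factors; \<open>qpoch_tendsto\<close> identifies the result as
  the limit.\<close>

definition qpoch_inf :: "'a::comm_ring_1 fps \<Rightarrow> 'a fps \<Rightarrow> 'a fps" where
  "qpoch_inf a q = Abs_fps (\<lambda>i. qpoch a q (Suc i) $ i)"

lemma qpoch_Suc: "qpoch a q (Suc n) = qpoch a q n * (1 - a * q ^ n)"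
  by (simp add: qpoch_def)

lemma qpoch_0 [simp]: "qpoch a q 0 = 1"
  by (simp add: qpoch_def)

lemma qpoch_tendsto:
  assumes "q $ 0 = 0"
  shows "(\<lambda>n. qpoch a q n) \<longlonglongrightarrow> qpoch_inf a q"
proof (rule tendsto_fpsI)
  fix i
  have "qpoch a q (Suc (i + d)) $ i = qpoch a q (Suc i) $ i" for d
  proof (induction d)
    case (Suc d)
    have "(qpoch a q (Suc (i + d)) * a * q ^ Suc (i + d)) $ i = 0"
      unfolding fps_mult_nth[of _ "q ^ _"] using startsby_zero_power_prefix[OF assms, of "Suc (i + d)"]
      by (intro sum.neutral) auto
    with Suc show ?case
      by (subst add_Suc_right, subst qpoch_Suc) (simp add: right_diff_distrib mult.assoc)
  qed simp
  then show "eventually (\<lambda>n. qpoch a q n $ i = qpoch_inf a q $ i) sequentially"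
    unfolding eventually_sequentially qpoch_inf_def fps_nth_Abs_fps
    by (metis Suc_le_D Suc_le_mono le_Suc_ex)
qed

lemma qpoch_inf_rec:
  assumes "q $ 0 = 0"
  shows "qpoch_inf a q = (1 - a) * qpoch_inf (a * q) q"
proof (rule LIMSEQ_unique)
  have "qpoch a q (Suc n) = (1 - a) * qpoch (a * q) q n" for n
    unfolding qpoch_def prod.lessThan_Suc_shift by (simp add: mult_ac)
  then show "(\<lambda>n. qpoch a q (Suc n)) \<longlonglongrightarrow> (1 - a) * qpoch_inf (a * q) q"
    by (simp only:) (intro tendsto_fps_mult tendsto_const qpoch_tendsto assms)
  show "(\<lambda>n. qpoch a q (Suc n)) \<longlonglongrightarrow> qpoch_inf a q"
    using qpoch_tendsto[OF assms] by (rule LIMSEQ_Suc)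
qed

lemma qpoch_inf_mult_minus:
  assumes "q $ 0 = 0"
  shows "qpoch_inf a q * qpoch_inf (- a) q = qpoch_inf (a ^ 2) (q ^ 2)"
proof (rule LIMSEQ_unique)
  have "qpoch a q n * qpoch (- a) q n = qpoch (a ^ 2) (q ^ 2) n" for n
    unfolding qpoch_def prod.distrib[symmetric]
    by (intro prod.cong refl) (simp add: algebra_simps power2_eq_square power_mult_distrib)
  moreover have "(\<lambda>n. qpoch a q n * qpoch (- a) q n) \<longlonglongrightarrow> qpoch_inf a q * qpoch_inf (- a) q"
    by (intro tendsto_fps_mult qpoch_tendsto assms)
  ultimately show "(\<lambda>n. qpoch (a ^ 2) (q ^ 2) n) \<longlonglongrightarrow> qpoch_inf a q * qpoch_inf (- a) q"
    by simp
  show "(\<lambda>n. qpoch (a ^ 2) (q ^ 2) n) \<longlonglongrightarrow> qpoch_inf (a ^ 2) (q ^ 2)"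
    by (rule qpoch_tendsto) (simp add: assms fps_power_zeroth)
qed

lemma tendsto_fps_prod:
  fixes f :: "'i \<Rightarrow> nat \<Rightarrow> 'a::comm_ring_1 fps"
  assumes "\<And>i. i \<in> A \<Longrightarrow> f i \<longlonglongrightarrow> F i"
  shows "(\<lambda>n. \<Prod>i\<in>A. f i n) \<longlonglongrightarrow> (\<Prod>i\<in>A. F i)"
  using assms by (induction A rule: infinite_finite_induct) (auto intro: tendsto_fps_mult)

lemma qpoch_inf_split:
  assumes "q $ 0 = 0" and m: "m > 0"
  shows "qpoch_inf a q = (\<Prod>i<m. qpoch_inf (a * q ^ i) (q ^ m))"
proof (rule LIMSEQ_unique)
  have "qpoch a q (m * n) = (\<Prod>i<m. qpoch (a * q ^ i) (q ^ m) n)" for n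
  proof -
    have "qpoch a q (m * n) = (\<Prod>(k, i)\<in>{..<n} \<times> {..<m}. 1 - a * q ^ (m * k + i))"
      unfolding qpoch_def
    proof (rule prod.reindex_bij_witness[of _ "\<lambda>(k, i). m * k + i" "\<lambda>j. (j div m, j mod m)"]; safe)
      fix j assume "j < m * n"
      then show "j div m < n" "j mod m < m" by (simp_all add: m less_mult_imp_div_less mult.commute)
      show "m * (j div m) + j mod m = j" by simp
    next
      fix k i assume *: "k < n" "i < m"
      then show "m * k + i < m * n"
        using mult_le_mono2[of "Suc k" n m] by simp
      show "(m * k + i) div m = k" "(m * k + i) mod m = i" using * by auto
    qed simp
    also have "\<dots> = (\<Prod>i<m. \<Prod>k<n. 1 - a * q ^ (m * k + i))"
      by (subst prod.cartesian_product[symmetric], rule prod.swap)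
    also have "\<dots> = (\<Prod>i<m. qpoch (a * q ^ i) (q ^ m) n)"
      unfolding qpoch_def power_add power_mult by (simp only: mult_ac)
    finally show ?thesis .
  qed
  moreover have "(\<lambda>n. \<Prod>i<m. qpoch (a * q ^ i) (q ^ m) n) \<longlonglongrightarrow> (\<Prod>i<m. qpoch_inf (a * q ^ i) (q ^ m))"
    by (intro tendsto_fps_prod qpoch_tendsto) (use assms in \<open>simp_all add: fps_power_zeroth zero_power\<close>)
  ultimately show "(\<lambda>n. qpoch a q (m * n)) \<longlonglongrightarrow> (\<Prod>i<m. qpoch_inf (a * q ^ i) (q ^ m))"
    by simp
  have "filterlim (\<lambda>n. m * n) sequentially sequentially"
    using m by (intro filterlim_subseq) (simp add: strict_mono_def)
  then show "(\<lambda>n. qpoch a q (m * n)) \<longlonglongrightarrow> qpoch_inf a q"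
    by (rule filterlim_compose[OF qpoch_tendsto[OF assms(1)]])
qed

section \<open>Reciprocals of the products (q;q)_n and their limit\<close>

definition iqpoch :: "'a::comm_ring_1 fps \<Rightarrow> nat \<Rightarrow> 'a fps" where
  "iqpoch q n = fps_right_inverse (qpoch q q n) 1"

definition iqpoch_inf :: "'a::comm_ring_1 fps \<Rightarrow> 'a fps" where
  "iqpoch_inf q = fps_right_inverse (qpoch_inf q q) 1"

lemma fps_inverse_unique_comm: "(f :: 'a::comm_ring_1 fps) * g = 1 \<Longrightarrow> f * h = 1 \<Longrightarrow> g = h"
  by (metis mult.assoc mult.commute mult_1)

lemma fps_right_inverse_1: "(f :: 'a::comm_ring_1 fps) $ 0 = 1 \<Longrightarrow> f * fps_right_inverse f 1 = 1"
  by (rule fps_right_inverse) simp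

context
  fixes q :: "'a::comm_ring_1 fps"
  assumes q0: "q $ 0 = 0"
begin

lemma qpoch_iqpoch: "qpoch q q n * iqpoch q n = 1"
  unfolding iqpoch_def by (intro fps_right_inverse_1 qpoch_nth_0 q0)

lemma qpoch_iqpoch_inf: "qpoch_inf q q * iqpoch_inf q = 1"
  unfolding iqpoch_inf_def
  by (rule fps_right_inverse_1) (simp add: qpoch_inf_def qpoch_nth_0 q0)

lemma iqpoch_0: "iqpoch q 0 = 1"
  using qpoch_iqpoch[of 0] by simp

lemma iqpoch_rec: "iqpoch q m = (1 - q ^ Suc m) * iqpoch q (Suc m)"
  by (rule fps_inverse_unique_comm[OF qpoch_iqpoch])
    (use qpoch_iqpoch[of "Suc m"] in \<open>simp add: qpoch_Suc mult.assoc\<close>)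

lemma iqpoch_tendsto: "(\<lambda>n. iqpoch q n) \<longlonglongrightarrow> iqpoch_inf q"
  by (rule tendsto_fps_inverse[OF qpoch_tendsto[OF q0] qpoch_iqpoch qpoch_iqpoch_inf])

lemma power_neq_1: "n > 0 \<Longrightarrow> q ^ n \<noteq> 1"
  using q0 by (metis fps_one_nth fps_power_zeroth power_0_left less_numeral_extra(3) zero_neq_one)

end

lemma tendsto_sum_atMost:
  fixes f :: "nat \<Rightarrow> nat \<Rightarrow> 'a::ab_group_add fps"
  assumes z: "\<And>n k i. k \<le> n \<Longrightarrow> i < k \<Longrightarrow> f n k $ i = 0"
    and lim: "\<And>k. (\<lambda>n. f n k) \<longlonglongrightarrow> g k"
  shows "(\<lambda>n. \<Sum>k\<le>n. f n k) \<longlonglongrightarrow> fps_Sum g" "locally_finite g"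
proof -
  let ?f = "\<lambda>n k. if k \<le> n then f n k else 0"
  have eq: "fps_Sum (?f n) = (\<Sum>k\<le>n. f n k)" for n
    by (subst fps_Sum_finite[of "{..n}"]) auto
  have z': "k \<in> {..i}" if "?f n k $ i \<noteq> 0" for n k i
    using that z[of k n i] by (auto split: if_splits simp: not_le[symmetric])
  have lim': "(\<lambda>n. ?f n k) \<longlonglongrightarrow> g k" for k
    using lim[of k] by (rule Lim_transform_eventually) (auto simp: eventually_sequentially)
  show "(\<lambda>n. \<Sum>k\<le>n. f n k) \<longlonglongrightarrow> fps_Sum g"
    using tendsto_fps_Sum(1)[of "\<lambda>i. {..i}" ?f g, OF finite_atMost z' lim'] unfolding eq .
  show "locally_finite g"
    using tendsto_fps_Sum(2)[of "\<lambda>i. {..i}" ?f g, OF finite_atMost z' lim'] .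
qed

section \<open>The Jacobi triple product\<close>

text \<open>Weights and exponents are arbitrary functions on an index type, so that forms in several
  variables can be shifted and reflected freely. Exponents are integers; \<open>nat\<close> loses
  nothing when they are nonnegative on the support of \<open>c\<close>, which is part of
  \<open>admissible\<close> below.\<close>

definition theta :: "('i \<Rightarrow> int) \<Rightarrow> ('i \<Rightarrow> int) \<Rightarrow> int fps" where
  "theta c e = fps_Sum (\<lambda>i. fps_const (c i) * fps_X ^ nat (e i))"

abbreviation alt :: "int \<Rightarrow> int \<Rightarrow> int" where
  "alt \<epsilon> k \<equiv> (if even k then 1 else \<epsilon>)"

lemma quadratic_exponent_bound:
  fixes a c k :: int
  assumes "c > 0" "0 \<le> a" "a \<le> 2 * c"
  shows "\<bar>k\<bar> - 1 \<le> c * k ^ 2 + (a - c) * k" "0 \<le> c * k ^ 2 + (a - c) * k"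
proof -
  have "- (c * \<bar>k\<bar>) \<le> (a - c) * k"
  proof -
    have "\<bar>(a - c) * k\<bar> \<le> c * \<bar>k\<bar>" unfolding abs_mult using assms by (intro mult_right_mono) auto
    then show ?thesis by linarith
  qed
  then have *: "c * (\<bar>k\<bar> * (\<bar>k\<bar> - 1)) \<le> c * k ^ 2 + (a - c) * k"
    by (simp add: algebra_simps power2_eq_square)
  have "0 \<le> \<bar>k\<bar> * (\<bar>k\<bar> - 1)" by (cases "k = 0") auto
  moreover have "\<bar>k\<bar> - 1 \<le> \<bar>k\<bar> * (\<bar>k\<bar> - 1)"
    using mult_right_mono[of 1 "\<bar>k\<bar>" "\<bar>k\<bar> - 1"] by (cases "k = 0") auto
  moreover have "1 * (\<bar>k\<bar> * (\<bar>k\<bar> - 1)) \<le> c * (\<bar>k\<bar> * (\<bar>k\<bar> - 1))"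
    using assms(1) calculation(1) by (intro mult_right_mono) auto
  ultimately show "\<bar>k\<bar> - 1 \<le> c * k ^ 2 + (a - c) * k" "0 \<le> c * k ^ 2 + (a - c) * k"
    using * by linarith+
qed

text \<open>The limit of the finite form in base X^(2c) at x = \<epsilon> X^a and x' = \<epsilon>
  X^b, where x^k q^(k(k-1)/2) becomes \<epsilon>^k X^(ck^2 + (a-c)k). The growth bound on this
  exponent supplies the finite index sets for the passage to the limit.\<close>

lemma jacobi_triple_product:
  fixes a b c :: nat and \<epsilon> :: int
  assumes \<epsilon>: "\<epsilon> * \<epsilon> = 1" and ab: "a + b = 2 * c" and c: "c > 0"
  shows "theta (alt \<epsilon>) (\<lambda>k. int c * k ^ 2 + (int a - int c) * k) =
    qpoch_inf (- (fps_const \<epsilon> * fps_X ^ a)) (fps_X ^ (2 * c)) *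
    qpoch_inf (- (fps_const \<epsilon> * fps_X ^ b)) (fps_X ^ (2 * c)) *
    qpoch_inf (fps_X ^ (2 * c)) (fps_X ^ (2 * c))"
proof -
  define e where "e = (\<lambda>k. int c * k ^ 2 + (int a - int c) * k)"
  define q :: "int fps" where "q = fps_X ^ (2 * c)"
  define x x' :: "int fps" where "x = fps_const \<epsilon> * fps_X ^ a" and "x' = fps_const \<epsilon> * fps_X ^ b"
  define t :: "int \<Rightarrow> int fps" where "t = (\<lambda>k. fps_const (alt \<epsilon> k) * fps_X ^ nat (e k))"
  define I where "I = (\<lambda>m::int. if m < 0 then 0 else iqpoch q (nat m))"
  have q0: "q $ 0 = 0" using c by (simp add: q_def)
  have e_bounds: "\<bar>k\<bar> - 1 \<le> e k" "0 \<le> e k" for k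
    unfolding e_def using c ab by (intro quadratic_exponent_bound; linarith)+
  have sign_power_Suc: "e (k + 1) = e k + 2 * int c * k + int a" for k
    by (simp add: e_def algebra_simps power2_eq_square)
  have e_pred: "e (k - 1) = e k - 2 * int c * k + int b" for k
    using ab by (simp add: e_def algebra_simps power2_eq_square)
  have finite_id: "(\<Prod>j<n. (1 + x * q ^ j) * (1 + x' * q ^ j)) * iqpoch q (2 * n) =
    (\<Sum>k\<in>{- int n..int n}. I (int n - k) * I (int n + k) * t k)" for n
  proof (rule finite_jacobi_triple_product)
    show "I m = (if m < 0 then 0 else iqpoch q (nat m))" for m by (simp add: I_def)
    show "x * q ^ n * t k = q ^ nat (int n - k) * t (k + 1)" if "\<bar>k\<bar> \<le> int n" for n k
    proof -
      have "a + 2 * c * n + nat (e k) = 2 * c * nat (int n - k) + nat (e (k + 1))"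
        using that[THEN abs_le_D1] e_bounds(2)[of k] e_bounds(2)[of "k + 1"] sign_power_Suc[of k]
        by (intro int_int_eq[THEN iffD1]) (simp add: algebra_simps)
      moreover have "\<epsilon> * alt \<epsilon> k = alt \<epsilon> (k + 1)" using \<epsilon> by simp
      moreover have "x * q ^ n * t k = fps_const (\<epsilon> * alt \<epsilon> k) * fps_X ^ (a + 2 * c * n + nat (e k))"
        unfolding x_def q_def t_def fps_const_mult[symmetric] power_add power_mult by (simp only: mult_ac)
      ultimately show ?thesis
        unfolding q_def t_def by (simp only: power_add power_mult mult_ac)
    qed
    show "x' * q ^ n * t k = q ^ nat (int n + k) * t (k - 1)" if "\<bar>k\<bar> \<le> int n" for n k
    proof -
      have "b + 2 * c * n + nat (e k) = 2 * c * nat (int n + k) + nat (e (k - 1))"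
        using that[THEN abs_le_D2] e_bounds(2)[of k] e_bounds(2)[of "k - 1"] e_pred[of k]
        by (intro int_int_eq[THEN iffD1]) (simp add: algebra_simps)
      moreover have "\<epsilon> * alt \<epsilon> k = alt \<epsilon> (k - 1)" using \<epsilon> by simp
      moreover have "x' * q ^ n * t k = fps_const (\<epsilon> * alt \<epsilon> k) * fps_X ^ (b + 2 * c * n + nat (e k))"
        unfolding x'_def q_def t_def fps_const_mult[symmetric] power_add power_mult by (simp only: mult_ac)
      ultimately show ?thesis
        unfolding q_def t_def by (simp only: power_add power_mult mult_ac)
    qed
    have "x * x' = fps_const (\<epsilon> * \<epsilon>) * fps_X ^ (a + b)"
      unfolding x_def x'_def fps_const_mult[symmetric] power_add by (simp only: mult_ac)
    then show "x * x' = q" by (simp add: \<epsilon> ab q_def)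
    show "t 0 = 1" by (simp add: t_def e_def)
  qed (rule iqpoch_rec[OF q0] iqpoch_0[OF q0] power_neq_1[OF q0] | assumption)+
  let ?f = "\<lambda>n k. I (int n - k) * I (int n + k) * t k"
  have tt: "(t k * g) $ j = 0" if "int j < e k" for k j g
    using that unfolding t_def by (simp add: mult.assoc fps_X_power_mult_nth)
  have I_lim: "(\<lambda>n. I (int n + k)) \<longlonglongrightarrow> iqpoch_inf q" for k
  proof -
    have "filterlim (\<lambda>n. nat (int n + k)) sequentially sequentially"
      unfolding filterlim_at_top eventually_sequentially
    proof
      fix Z :: nat
      show "\<exists>N. \<forall>n\<ge>N. Z \<le> nat (int n + k)"
        by (intro exI[of _ "nat (int Z - k)"]) linarith
    qed
    then have "(\<lambda>n. iqpoch q (nat (int n + k))) \<longlonglongrightarrow> iqpoch_inf q"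
      by (rule filterlim_compose[OF iqpoch_tendsto[OF q0]])
    then show ?thesis
      by (rule Lim_transform_eventually)
        (auto simp: I_def eventually_sequentially intro!: exI[of _ "nat (- k)"])
  qed
  have "(\<lambda>n. fps_Sum (?f n)) \<longlonglongrightarrow> fps_Sum (\<lambda>k. iqpoch_inf q * iqpoch_inf q * t k)"
  proof (rule tendsto_fps_Sum(1))
    show "finite {- int j - 1..int j + 1}" for j by simp
    show "k \<in> {- int j - 1..int j + 1}" if "?f n k $ j \<noteq> 0" for n k j
    proof (rule ccontr)
      assume "k \<notin> {- int j - 1..int j + 1}"
      then have "int j < e k" using e_bounds(1)[of k] by auto
      then show False using tt[of j k] that by (simp only: mult.commute[of _ "t k"])
    qed
    show "(\<lambda>n. ?f n k) \<longlonglongrightarrow> iqpoch_inf q * iqpoch_inf q * t k" for k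
      using I_lim[of "- k"] I_lim[of k] by (intro tendsto_fps_mult tendsto_const) simp_all
  qed
  moreover have "fps_Sum (?f n) = (\<Prod>j<n. (1 + x * q ^ j) * (1 + x' * q ^ j)) * iqpoch q (2 * n)" for n
    unfolding finite_id by (rule fps_Sum_finite) (auto simp: I_def)
  moreover have "(\<Prod>j<n. (1 + x * q ^ j) * (1 + x' * q ^ j)) = qpoch (- x) q n * qpoch (- x') q n" for n
    by (simp add: qpoch_def prod.distrib)
  ultimately have "(\<lambda>n. qpoch (- x) q n * qpoch (- x') q n * iqpoch q (2 * n)) \<longlonglongrightarrow>
      fps_Sum (\<lambda>k. iqpoch_inf q * iqpoch_inf q * t k)" by simp
  moreover have "(\<lambda>n. qpoch (- x) q n * qpoch (- x') q n * iqpoch q (2 * n)) \<longlonglongrightarrow>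
      qpoch_inf (- x) q * qpoch_inf (- x') q * iqpoch_inf q"
  proof (intro tendsto_fps_mult qpoch_tendsto q0)
    have "filterlim (\<lambda>n. 2 * n :: nat) sequentially sequentially"
      by (intro filterlim_subseq) (simp add: strict_mono_def)
    then show "(\<lambda>n. iqpoch q (2 * n)) \<longlonglongrightarrow> iqpoch_inf q"
      by (rule filterlim_compose[OF iqpoch_tendsto[OF q0]])
  qed
  ultimately have "fps_Sum (\<lambda>k. iqpoch_inf q * iqpoch_inf q * t k) =
      qpoch_inf (- x) q * qpoch_inf (- x') q * iqpoch_inf q"
    by (rule LIMSEQ_unique)
  moreover have "locally_finite t"
  proof (rule locally_finiteI[where F = "\<lambda>j. {- int j - 1..int j + 1}"])
    fix j k assume "t k $ j \<noteq> 0"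
    then have "\<not> int j < e k" using tt[of j k 1] by auto
    then show "k \<in> {- int j - 1..int j + 1}" using e_bounds(1)[of k] by auto
  qed simp
  ultimately have main: "iqpoch_inf q * iqpoch_inf q * theta (alt \<epsilon>) e = qpoch_inf (- x) q * qpoch_inf (- x') q * iqpoch_inf q"
    by (simp add: fps_Sum_cmult theta_def t_def)
  have "(qpoch_inf q q * iqpoch_inf q) * (qpoch_inf q q * iqpoch_inf q) * theta (alt \<epsilon>) e =
      qpoch_inf q q * qpoch_inf q q * (iqpoch_inf q * iqpoch_inf q * theta (alt \<epsilon>) e)"
    by (simp only: mult_ac)
  also have "\<dots> = qpoch_inf (- x) q * qpoch_inf (- x') q * qpoch_inf q q * (qpoch_inf q q * iqpoch_inf q)"
    unfolding main by (simp only: mult_ac)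
  finally show ?thesis
    unfolding qpoch_iqpoch_inf[OF q0] by (simp add: e_def q_def x_def x'_def)
qed

section \<open>Limits of the partial fraction identities\<close>

text \<open>This is \<open>g k\<close> of the finite identities at q = X^6 and x = X, so y = X +
  X^5. Since 6k + 5 = -(6(-1 - k) + 1), it covers both the index k and the index -1 - k of a sum
  over all integers.\<close>

definition rdenom :: "nat \<Rightarrow> int fps" where
  "rdenom k = fps_right_inverse ((1 - fps_X ^ (6 * k + 1)) * (1 - fps_X ^ (6 * k + 5))) 1"

lemma rdenom: "(1 - fps_X ^ (6 * k + 1)) * (1 - fps_X ^ (6 * k + 5)) * rdenom k = 1"
  unfolding rdenom_def by (rule fps_right_inverse_1) simp

lemma tendsto_weighted_sum:
  fixes h :: "nat \<Rightarrow> 'a::comm_ring_1 fps"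
  assumes h: "\<And>k i. i < k \<Longrightarrow> h k $ i = 0" and c: "\<And>k. (\<lambda>n. c n k) \<longlonglongrightarrow> C"
  shows "(\<lambda>n. \<Sum>k\<le>n. h k * c n k) \<longlonglongrightarrow> C * fps_Sum h"
proof -
  have "locally_finite h"
    using h by (intro locally_finiteI[where F = "\<lambda>n. {..n}"]) (auto simp: not_le[symmetric])
  then have eq: "fps_Sum (\<lambda>k. C * h k) = C * fps_Sum h" by (rule fps_Sum_cmult)
  have "(\<lambda>n. h k * c n k) \<longlonglongrightarrow> C * h k" for k
    using tendsto_fps_mult[OF tendsto_const[of "h k"] c] by (simp only: mult.commute)
  moreover have "(h k * c n k) $ i = 0" if "i < k" for n k i
    unfolding fps_mult_nth using h that by (intro sum.neutral) auto
  ultimately have "(\<lambda>n. \<Sum>k\<le>n. h k * c n k) \<longlonglongrightarrow> fps_Sum (\<lambda>k. C * h k)"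
    by (intro tendsto_sum_atMost(1))
  then show ?thesis unfolding eq .
qed

abbreviation poch6 :: "nat \<Rightarrow> int fps" where
  "poch6 a \<equiv> qpoch_inf (fps_X ^ a) (fps_X ^ 6)"

abbreviation npoch6 :: "nat \<Rightarrow> int fps" where
  "npoch6 a \<equiv> qpoch_inf (- (fps_X ^ a)) (fps_X ^ 6)"

context
  fixes q :: "int fps" and e :: "nat \<Rightarrow> int fps"
  defines "q \<equiv> fps_X ^ 6" and "e \<equiv> \<lambda>k. (- 1) ^ k * fps_X ^ (3 * k ^ 2 + 3 * k)"
begin

lemma base_nth_0: "q $ 0 = 0"
  by (simp add: q_def)

lemma sign_power_Suc: "e (Suc k) = - (q ^ Suc k) * e k"
proof -
  have "3 * (Suc k)\<^sup>2 + 3 * Suc k = 6 * Suc k + (3 * k\<^sup>2 + 3 * k)"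
    by (simp add: power2_eq_square)
  then show ?thesis by (simp only: e_def q_def power_Suc power_add power_mult[symmetric]) (simp add: power_add mult_ac)
qed

lemma sign_power_0: "e 0 = 1"
  by (simp add: e_def)

lemma denom_eq: "(1 - fps_X ^ (6 * k + 1)) * (1 - fps_X ^ (6 * k + 5)) = 1 - (fps_X + fps_X ^ 5) * q ^ k + q ^ (2 * k + 1)"
  by (simp add: q_def power_add algebra_simps flip: power_mult) (simp add: eval_nat_numeral power_add algebra_simps flip: power_mult)

lemma rdenom': "(1 - (fps_X + fps_X ^ 5) * q ^ k + q ^ (2 * k + 1)) * rdenom k = 1"
  unfolding denom_eq[symmetric] by (rule rdenom)

lemma q_odd_power: "q ^ (2 * k + 1) = fps_X ^ (12 * k + 6)"
  unfolding q_def power_mult[symmetric] by (rule arg_cong[of _ _ "power fps_X"]) simp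

lemma X_power_mult_nth_eq_0: "i < k \<Longrightarrow> k \<le> m \<Longrightarrow> (f * fps_X ^ m * g) $ i = 0" for f g :: "int fps"
  unfolding mult.commute[of f] mult.assoc by (simp add: fps_X_power_mult_nth)

lemma prod_rdenom_tendsto:
  obtains G where "(\<lambda>n. \<Prod>j\<le>n. rdenom j) \<longlonglongrightarrow> G" "poch6 1 * poch6 5 * G = 1"
proof -
  let ?G = "fps_right_inverse (poch6 1 * poch6 5) 1"
  have G: "poch6 1 * poch6 5 * ?G = 1"
    by (rule fps_right_inverse_1) (simp add: qpoch_inf_def qpoch_nth_0)
  have "(\<lambda>n. qpoch (fps_X ^ 1) q (Suc n) * qpoch (fps_X ^ 5) q (Suc n)) \<longlonglongrightarrow> poch6 1 * poch6 5"
    unfolding q_def by (intro tendsto_fps_mult LIMSEQ_Suc[OF qpoch_tendsto]) simp_all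
  moreover have "qpoch (fps_X ^ 1) q (Suc n) * qpoch (fps_X ^ 5) q (Suc n) * (\<Prod>j\<le>n. rdenom j) = 1" for n
    unfolding qpoch_def lessThan_Suc_atMost prod.distrib[symmetric]
    using rdenom by (intro prod.neutral) (simp add: q_def power_add mult_ac flip: power_mult)
  ultimately have "(\<lambda>n. \<Prod>j\<le>n. rdenom j) \<longlonglongrightarrow> ?G"
    using G by (rule tendsto_fps_inverse)
  with G show ?thesis by (rule that[rotated])
qed

lemma poch6_iqpoch_inf: "poch6 6 * iqpoch_inf q = 1"
  unfolding q_def by (rule qpoch_iqpoch_inf) simp

lemma iqpoch_diff_tendsto: "(\<lambda>n. iqpoch q (n - k)) \<longlonglongrightarrow> iqpoch_inf q"
  by (rule filterlim_compose[OF iqpoch_tendsto[OF base_nth_0] filterlim_minus_const_nat_at_top])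

lemma iqpoch_add_tendsto: "(\<lambda>n. iqpoch q (n + k + 1)) \<longlonglongrightarrow> iqpoch_inf q"
  using LIMSEQ_ignore_initial_segment[OF iqpoch_tendsto[OF base_nth_0], of "k + 1"] by (simp add: add.assoc)

text \<open>The limit of \<open>partial_fraction_reciprocal\<close>: both weights
  \<open>iqpoch\<close> tend to the same reciprocal, whose square is then cleared from the
  right-hand side.\<close>

lemma reciprocal_theta_expansion:
  "poch6 6 ^ 2 = poch6 1 * poch6 5 *
    fps_Sum (\<lambda>k. (- 1) ^ k * fps_X ^ (3 * k ^ 2 + 3 * k) * ((1 - fps_X ^ (12 * k + 6)) * rdenom k))"
proof -
  obtain G where G: "(\<lambda>n. \<Prod>j\<le>n. rdenom j) \<longlonglongrightarrow> G" "poch6 1 * poch6 5 * G = 1"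
    by (rule prod_rdenom_tendsto)
  let ?h = "\<lambda>k. e k * ((1 - q ^ (2 * k + 1)) * rdenom k)"
  let ?c = "\<lambda>n k. iqpoch q (n - k) * iqpoch q (n + k + 1)"
  have "(\<Prod>j\<le>n. rdenom j) =
      (\<Sum>k\<le>n. e k * (1 - q ^ (2 * k + 1)) * iqpoch q (n - k) * iqpoch q (n + k + 1) * rdenom k)" for n
    by (rule partial_fraction_reciprocal[where y = "fps_X + fps_X ^ 5"])
      (rule power_neq_1[OF base_nth_0] iqpoch_rec[OF base_nth_0] iqpoch_0[OF base_nth_0] sign_power_Suc sign_power_0 rdenom' refl | assumption)+
  then have "(\<Prod>j\<le>n. rdenom j) = (\<Sum>k\<le>n. ?h k * ?c n k)" for n
    by (simp only: mult_ac)
  moreover have "(\<lambda>n. \<Sum>k\<le>n. ?h k * ?c n k) \<longlonglongrightarrow> (iqpoch_inf q * iqpoch_inf q) * fps_Sum ?h"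
  proof (rule tendsto_weighted_sum)
    show "?h k $ i = 0" if "i < k" for k i
      unfolding e_def using that by (rule X_power_mult_nth_eq_0) simp
  qed (intro tendsto_fps_mult iqpoch_diff_tendsto iqpoch_add_tendsto)
  ultimately have main: "G = (iqpoch_inf q * iqpoch_inf q) * fps_Sum ?h"
    using G(1) LIMSEQ_unique by force
  have "poch6 6 ^ 2 = poch6 6 ^ 2 * (poch6 1 * poch6 5 * G)" using G by simp
  also have "\<dots> = poch6 1 * poch6 5 * ((poch6 6 * iqpoch_inf q) * (poch6 6 * iqpoch_inf q) * fps_Sum ?h)"
    unfolding main by (simp only: power2_eq_square mult_ac)
  also have "fps_Sum ?h = fps_Sum (\<lambda>k. (- 1) ^ k * fps_X ^ (3 * k ^ 2 + 3 * k) * ((1 - fps_X ^ (12 * k + 6)) * rdenom k))"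
    unfolding q_odd_power e_def ..
  finally show ?thesis unfolding poch6_iqpoch_inf by simp
qed

text \<open>The sum on the left is the universal mock theta function g_3(x;q), with terms q^(n(n+1))
  / ((x;q)_(n+1) (q/x;q)_(n+1)), at x = X and q = X^6. The identity is the limit of
  \<open>bailey_pair_sum\<close>.\<close>

lemma universal_mock_theta_expansion:
  "poch6 6 * fps_Sum (\<lambda>n. fps_X ^ (6 * n ^ 2 + 6 * n) * (\<Prod>j\<le>n. rdenom j)) =
    fps_Sum (\<lambda>k. (- 1) ^ k * fps_X ^ (9 * k ^ 2 + 9 * k) * ((1 - fps_X ^ (12 * k + 6)) * rdenom k))"
proof -
  let ?l = "\<lambda>n. fps_X ^ (6 * n ^ 2 + 6 * n) * (\<Prod>j\<le>n. rdenom j)"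
  let ?h = "\<lambda>k. (- 1) ^ k * fps_X ^ (9 * k ^ 2 + 9 * k) * ((1 - fps_X ^ (12 * k + 6)) * rdenom k)"
  let ?c = "\<lambda>n k. iqpoch q (n - k) * iqpoch q (n + k + 1)"
  have qe: "q ^ (k * (k + 1)) * e k = (- 1) ^ k * fps_X ^ (9 * k ^ 2 + 9 * k)" for k
  proof -
    have "9 * k ^ 2 + 9 * k = 6 * (k * (k + 1)) + (3 * k ^ 2 + 3 * k)" by (simp add: power2_eq_square)
    then show ?thesis by (simp only: e_def q_def power_mult[symmetric] power_add mult_ac)
  qed
  have ql: "q ^ (k * (k + 1)) = fps_X ^ (6 * k ^ 2 + 6 * k)" for k
    unfolding q_def power_mult[symmetric] by (rule arg_cong[of _ _ "power fps_X"]) (simp add: power2_eq_square)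
  have pair: "(\<Sum>n\<le>N. q ^ (n * (n + 1)) * iqpoch q (N - n) * (\<Prod>j\<le>n. rdenom j)) =
    (\<Sum>k\<le>N. q ^ (k * (k + 1)) * e k * (1 - q ^ (2 * k + 1)) * iqpoch q (N - k) * iqpoch q (N + k + 1) * rdenom k)" for N
    by (rule bailey_pair_sum[where y = "fps_X + fps_X ^ 5"])
      (rule power_neq_1[OF base_nth_0] iqpoch_rec[OF base_nth_0] iqpoch_0[OF base_nth_0] sign_power_Suc sign_power_0 rdenom' refl | assumption)+
  have eq: "(\<Sum>n\<le>N. ?l n * iqpoch q (N - n)) = (\<Sum>k\<le>N. ?h k * ?c N k)" for N
    using pair[of N, unfolded qe, unfolded ql q_odd_power] by (simp only: mult_ac)
  have "(\<lambda>N. \<Sum>n\<le>N. ?l n * iqpoch q (N - n)) \<longlonglongrightarrow> iqpoch_inf q * fps_Sum ?l"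
  proof (rule tendsto_weighted_sum)
    show "?l k $ i = 0" if "i < k" for k i
      using X_power_mult_nth_eq_0[OF that, of "6 * k ^ 2 + 6 * k" 1] by simp
  qed (rule iqpoch_diff_tendsto)
  moreover have "(\<lambda>n. \<Sum>k\<le>n. ?h k * ?c n k) \<longlonglongrightarrow> (iqpoch_inf q * iqpoch_inf q) * fps_Sum ?h"
  proof (rule tendsto_weighted_sum)
    show "?h k $ i = 0" if "i < k" for k i
      using that by (rule X_power_mult_nth_eq_0) simp
  qed (intro tendsto_fps_mult iqpoch_diff_tendsto iqpoch_add_tendsto)
  ultimately have main: "iqpoch_inf q * fps_Sum ?l = iqpoch_inf q * iqpoch_inf q * fps_Sum ?h"
    unfolding eq by (rule LIMSEQ_unique)
  have "poch6 6 * fps_Sum ?l = (poch6 6 * iqpoch_inf q) * (poch6 6 * fps_Sum ?l)"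
    unfolding poch6_iqpoch_inf by simp
  also have "\<dots> = poch6 6 * poch6 6 * (iqpoch_inf q * fps_Sum ?l)" by (simp only: mult_ac)
  also have "\<dots> = (poch6 6 * iqpoch_inf q) * (poch6 6 * iqpoch_inf q) * fps_Sum ?h"
    unfolding main by (simp only: mult_ac)
  finally show ?thesis unfolding poch6_iqpoch_inf by simp
qed

text \<open>The limit of \<open>partial_fraction_quotient\<close> at p = X^3. Its numerator is the
  denominator with x replaced by -px, which is why exponents 4 and 8 with plus signs appear in the
  finite products.\<close>

lemma theta_quotient_expansion:
  "poch6 6 ^ 2 * npoch6 2 * npoch6 4 = poch6 1 * poch6 5 * npoch6 3 ^ 2 *
    fps_Sum (\<lambda>k. (- 1) ^ k * fps_X ^ (3 * k) * ((1 + fps_X ^ 2) * (1 - fps_X ^ (6 * k + 3)) * rdenom k))"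
proof -
  obtain G where G: "(\<lambda>n. \<Prod>j\<le>n. rdenom j) \<longlonglongrightarrow> G" "poch6 1 * poch6 5 * G = 1"
    by (rule prod_rdenom_tendsto)
  define p :: "int fps" where "p = fps_X ^ 3"
  have p0: "p $ 0 = 0" by (simp add: p_def)
  have pq: "p ^ (2 * k) = q ^ k" for k by (simp add: p_def q_def flip: power_mult)
  define r where "r = (\<lambda>n. qpoch (- p) q n * iqpoch q n)"
  define R where "R = npoch6 3 * iqpoch_inf q"
  have r_tendsto: "r \<longlonglongrightarrow> R"
    unfolding r_def R_def p_def q_def[symmetric]
    by (intro tendsto_fps_mult qpoch_tendsto iqpoch_tendsto base_nth_0)
  let ?h = "\<lambda>k. (- 1) ^ k * fps_X ^ (3 * k) * ((1 - fps_X ^ (6 * k + 3)) * rdenom k)"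
  let ?c = "\<lambda>n k. r (n - k) * r (n + k + 1)"
  have quotient: "(\<Prod>j<n. 1 + (fps_X + fps_X ^ 5) * p ^ (2 * j + 1) + p ^ (4 * j + 4)) * (\<Prod>j\<le>n. rdenom j) =
    (\<Sum>k\<le>n. (- 1) ^ k * p ^ k * (1 - p ^ (2 * k + 1)) * r (n - k) * r (n + k + 1) * rdenom k)" for n
  proof (rule partial_fraction_quotient[of p r "\<lambda>k. 1 - (fps_X + fps_X ^ 5) * p ^ (2 * k) + p ^ (4 * k + 2)"])
    show "(1 - p ^ (2 * m + 2)) * r (Suc m) = (1 + p ^ (2 * m + 1)) * r m" for m
    proof -
      have 1: "p ^ (2 * m + 2) = q ^ Suc m" using pq[of "Suc m"] by simp
      have 2: "p ^ (2 * m + 1) = p * q ^ m" using pq[of m] by simp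
      have 3: "(1 - q ^ Suc m) * r (Suc m) = qpoch (- p) q m * (1 - - p * q ^ m) * ((1 - q ^ Suc m) * iqpoch q (Suc m))"
        unfolding r_def qpoch_Suc by (simp only: mult_ac)
      show ?thesis
        unfolding 1 2 3 iqpoch_rec[OF base_nth_0, symmetric] by (simp add: r_def mult_ac)
    qed
    show "r 0 = 1" by (simp add: r_def iqpoch_0[OF base_nth_0])
    show "(1 - (fps_X + fps_X ^ 5) * p ^ (2 * k) + p ^ (4 * k + 2)) * rdenom k = 1" for k
    proof -
      have "p ^ (4 * k + 2) = q ^ (2 * k + 1)" using pq[of "2 * k + 1"] by simp
      then show ?thesis unfolding pq by (simp only: rdenom')
    qed
  qed (use power_neq_1[OF p0] in auto)
  have numerator: "(\<Prod>j<n. 1 + (fps_X + fps_X ^ 5) * p ^ (2 * j + 1) + p ^ (4 * j + 4)) =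
      qpoch (- (fps_X ^ 4)) q n * qpoch (- (fps_X ^ 8)) q n" for n
    unfolding qpoch_def prod.distrib[symmetric]
  proof (intro prod.cong refl)
    fix j
    have "p ^ (2 * j + 1) = fps_X ^ 3 * q ^ j" using pq[of j] by (simp add: p_def)
    moreover have "p ^ (4 * j + 4) = fps_X ^ 12 * q ^ j * q ^ j"
      unfolding p_def q_def power_mult[symmetric] power_add[symmetric]
      by (rule arg_cong[of _ _ "power fps_X"]) simp
    ultimately show "1 + (fps_X + fps_X ^ 5) * p ^ (2 * j + 1) + p ^ (4 * j + 4) =
        (1 - - (fps_X ^ 4) * q ^ j) * (1 - - (fps_X ^ 8) * q ^ j)"
      by (simp add: algebra_simps flip: power_add power_Suc)
  qed
  have p_pow: "p ^ k = fps_X ^ (3 * k)" "p ^ (2 * k + 1) = fps_X ^ (6 * k + 3)" for k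
    unfolding p_def power_mult[symmetric] by (rule arg_cong[of _ _ "power fps_X"], simp)+
  have eq: "qpoch (- (fps_X ^ 4)) q n * qpoch (- (fps_X ^ 8)) q n * (\<Prod>j\<le>n. rdenom j) = (\<Sum>k\<le>n. ?h k * ?c n k)" for n
    using quotient[of n, unfolded numerator, unfolded p_pow(2), unfolded p_pow(1)] by (simp only: mult_ac)
  have "(\<lambda>n. qpoch (- (fps_X ^ 4)) q n * qpoch (- (fps_X ^ 8)) q n * (\<Prod>j\<le>n. rdenom j)) \<longlonglongrightarrow> npoch6 4 * npoch6 8 * G"
    unfolding q_def by (intro tendsto_fps_mult qpoch_tendsto G(1)) simp_all
  moreover have "(\<lambda>n. \<Sum>k\<le>n. ?h k * ?c n k) \<longlonglongrightarrow> (R * R) * fps_Sum ?h"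
  proof (rule tendsto_weighted_sum)
    show "?h k $ i = 0" if "i < k" for k i
      using that by (rule X_power_mult_nth_eq_0) simp
    show "(\<lambda>n. r (n - k) * r (n + k + 1)) \<longlonglongrightarrow> R * R" for k
    proof (rule tendsto_fps_mult)
      show "(\<lambda>n. r (n - k)) \<longlonglongrightarrow> R"
        by (rule filterlim_compose[OF r_tendsto filterlim_minus_const_nat_at_top])
      show "(\<lambda>n. r (n + k + 1)) \<longlonglongrightarrow> R"
        using LIMSEQ_ignore_initial_segment[OF r_tendsto, of "k + 1"] by (simp add: add.assoc)
    qed
  qed
  ultimately have main: "npoch6 4 * npoch6 8 * G = R * R * fps_Sum ?h"
    unfolding eq by (rule LIMSEQ_unique)
  have lf: "locally_finite ?h"
  proof (rule locally_finiteI[where F = "\<lambda>n. {..n}"])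
    show "k \<in> {..n}" if "?h k $ n \<noteq> 0" for n k
      using that X_power_mult_nth_eq_0[of n k "3 * k"] by (auto simp: not_le[symmetric])
  qed simp
  \<comment> \<open>The finite numerator supplies the exponents 8, 14, ... only; the factor 1 + X^2
    completes them to a theta function with exponents 2 and 4 modulo 6.\<close>
  have "npoch6 2 = (1 + fps_X ^ 2) * npoch6 8"
    by (subst qpoch_inf_rec) (simp_all flip: power_add)
  then have "poch6 6 ^ 2 * npoch6 2 * npoch6 4 =
      poch6 6 ^ 2 * ((1 + fps_X ^ 2) * npoch6 8) * npoch6 4 * (poch6 1 * poch6 5 * G)"
    unfolding G(2) by simp
  also have "\<dots> = poch6 6 ^ 2 * (poch6 1 * poch6 5) * (1 + fps_X ^ 2) * (npoch6 4 * npoch6 8 * G)"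
    by (simp only: mult_ac)
  also have "\<dots> = poch6 1 * poch6 5 * npoch6 3 ^ 2 * (poch6 6 * iqpoch_inf q) * (poch6 6 * iqpoch_inf q) * ((1 + fps_X ^ 2) * fps_Sum ?h)"
    unfolding main R_def by (simp only: power2_eq_square mult_ac)
  also have "(1 + fps_X ^ 2) * fps_Sum ?h = fps_Sum (\<lambda>k. (1 + fps_X ^ 2) * ?h k)"
    by (rule fps_Sum_cmult[OF lf, symmetric])
  also have "\<dots> = fps_Sum (\<lambda>k. (- 1) ^ k * fps_X ^ (3 * k) * ((1 + fps_X ^ 2) * (1 - fps_X ^ (6 * k + 3)) * rdenom k))"
    by (simp only: mult_ac)
  finally show ?thesis unfolding poch6_iqpoch_inf by simp
qed

end

section \<open>Theta series and Lambert series\<close>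

definition admissible :: "('i \<Rightarrow> int) \<Rightarrow> ('i \<Rightarrow> int) \<Rightarrow> bool" where
  "admissible c e \<longleftrightarrow> (\<forall>i. c i \<noteq> 0 \<longrightarrow> 0 \<le> e i) \<and> (\<forall>n. finite {i. c i \<noteq> 0 \<and> e i \<le> int n})"

lemma admissibleI:
  assumes "\<And>i. c i \<noteq> 0 \<Longrightarrow> 0 \<le> e i" "\<And>n. finite (F n)" "\<And>n i. c i \<noteq> 0 \<Longrightarrow> e i \<le> int n \<Longrightarrow> i \<in> F n"
  shows "admissible c e"
proof -
  have "{i. c i \<noteq> 0 \<and> e i \<le> int n} \<subseteq> F n" for n using assms(3) by blast
  then show ?thesis unfolding admissible_def using assms(1,2) finite_subset by blast
qed

lemma admissible_nonneg: "admissible c e \<Longrightarrow> c i \<noteq> 0 \<Longrightarrow> 0 \<le> e i"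
  by (simp add: admissible_def)

lemma admissible_finite: "admissible c e \<Longrightarrow> finite {i. c i \<noteq> 0 \<and> e i \<le> int n}"
  by (simp add: admissible_def)

lemma admissible_finite_eq: "admissible c e \<Longrightarrow> finite {i. c i \<noteq> 0 \<and> e i = int n}"
  by (erule finite_subset[OF _ admissible_finite[of c e n], rotated]) auto

lemma admissible_mono: "admissible c e \<Longrightarrow> (\<And>i. c' i \<noteq> 0 \<Longrightarrow> c i \<noteq> 0) \<Longrightarrow> admissible c' e"
  by (rule admissibleI[where F = "\<lambda>n. {i. c i \<noteq> 0 \<and> e i \<le> int n}"])
    (simp_all add: admissible_finite admissible_nonneg)

lemma admissible_add:
  assumes "admissible c e" "admissible c' e" shows "admissible (\<lambda>i. c i + c' i) e"
proof (rule admissibleI[where F = "\<lambda>n. {i. c i \<noteq> 0 \<and> e i \<le> int n} \<union> {i. c' i \<noteq> 0 \<and> e i \<le> int n}"])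
  fix i assume "c i + c' i \<noteq> 0"
  then have "c i \<noteq> 0 \<or> c' i \<noteq> 0" by auto
  then show "0 \<le> e i" using assms[THEN admissible_nonneg] by blast
qed (use assms[THEN admissible_finite] in auto)

lemma admissible_locally_finite:
  assumes "admissible c e" shows "locally_finite (\<lambda>i. fps_const (c i) * fps_X ^ nat (e i))"
proof (rule locally_finiteI[where F = "\<lambda>n. {i. c i \<noteq> 0 \<and> e i \<le> int n}"])
  fix n i assume "(fps_const (c i) * fps_X ^ nat (e i)) $ n \<noteq> 0"
  then have "n = nat (e i)" "c i \<noteq> 0" by (auto split: if_splits)
  then show "i \<in> {i. c i \<noteq> 0 \<and> e i \<le> int n}" by simp
qed (rule admissible_finite[OF assms])

lemma theta_nth:
  assumes "admissible c e" shows "theta c e $ n = (\<Sum>i | c i \<noteq> 0 \<and> e i = int n. c i)"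
proof -
  have *: "(fps_const (c i) * fps_X ^ nat (e i)) $ n = 0 \<or> c i \<noteq> 0 \<and> e i = int n" for i
    using admissible_nonneg[OF assms, of i] by (auto split: if_splits)
  have "theta c e $ n = (\<Sum>i | c i \<noteq> 0 \<and> e i = int n. (fps_const (c i) * fps_X ^ nat (e i)) $ n)"
    unfolding theta_def by (intro fps_Sum_nth admissible_finite_eq[OF assms]) (use * in blast)
  also have "\<dots> = (\<Sum>i | c i \<noteq> 0 \<and> e i = int n. c i)"
    by (intro sum.cong) auto
  finally show ?thesis .
qed

lemma admissible_mult:
  assumes "admissible c e" "admissible c' e'"
  shows "admissible (\<lambda>(i, j). c i * c' j) (\<lambda>(i, j). e i + e' j)"
proof (rule admissibleI[where F = "\<lambda>n. {i. c i \<noteq> 0 \<and> e i \<le> int n} \<times> {j. c' j \<noteq> 0 \<and> e' j \<le> int n}"])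
  fix n p assume "(case p of (i, j) \<Rightarrow> c i * c' j) \<noteq> 0" "(case p of (i, j) \<Rightarrow> e i + e' j) \<le> int n"
  then show "p \<in> {i. c i \<noteq> 0 \<and> e i \<le> int n} \<times> {j. c' j \<noteq> 0 \<and> e' j \<le> int n}"
    using admissible_nonneg[OF assms(1), of "fst p"] admissible_nonneg[OF assms(2), of "snd p"]
    by (cases p) auto
next
  fix p assume "(case p of (i, j) \<Rightarrow> c i * c' j) \<noteq> 0"
  then show "0 \<le> (case p of (i, j) \<Rightarrow> e i + e' j)"
    using admissible_nonneg[OF assms(1), of "fst p"] admissible_nonneg[OF assms(2), of "snd p"]
    by (cases p) auto
qed (simp add: admissible_finite[OF assms(1)] admissible_finite[OF assms(2)])

lemma theta_mult:
  assumes "admissible c e" "admissible c' e'"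
  shows "theta c e * theta c' e' = theta (\<lambda>(i, j). c i * c' j) (\<lambda>(i, j). e i + e' j)"
proof -
  have "fps_const (c i) * fps_X ^ nat (e i) * (fps_const (c' j) * fps_X ^ nat (e' j)) =
      fps_const (c i * c' j) * fps_X ^ nat (e i + e' j)" for i j
  proof (cases "c i = 0 \<or> c' j = 0")
    case False
    then have "nat (e i + e' j) = nat (e i) + nat (e' j)"
      using assms by (simp add: admissible_nonneg nat_add_distrib)
    then show ?thesis
      unfolding fps_const_mult[symmetric] by (simp only: power_add mult_ac)
  qed auto
  then show ?thesis
    unfolding theta_def fps_Sum_mult[OF assms[THEN admissible_locally_finite]]
    by (simp only: case_prod_unfold)
qed

lemma theta_reindex: "bij h \<Longrightarrow> theta c e = theta (\<lambda>i. c (h i)) (\<lambda>i. e (h i))"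
  unfolding theta_def by (rule fps_Sum_reindex) (auto simp: bij_def)

lemma theta_add: "admissible c e \<Longrightarrow> admissible c' e \<Longrightarrow> theta (\<lambda>i. c i + c' i) e = theta c e + theta c' e"
  unfolding theta_def fps_const_add[symmetric] distrib_right
  by (intro fps_Sum_add admissible_locally_finite)

lemma theta_scale: "admissible c e \<Longrightarrow> theta (\<lambda>i. a * c i) e = fps_const a * theta c e"
  unfolding theta_def fps_const_mult[symmetric] mult.assoc by (intro fps_Sum_cmult admissible_locally_finite)

lemma admissible_scale: "admissible c e \<Longrightarrow> admissible (\<lambda>i. a * c i) e"
  by (erule admissible_mono) auto

lemma admissible_reindex:
  assumes "inj h" "admissible c e" shows "admissible (\<lambda>i. c (h i)) (\<lambda>i. e (h i))"
proof (rule admissibleI[where F = "\<lambda>n. h -` {i. c i \<noteq> 0 \<and> e i \<le> int n}"])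
  show "finite (h -` {i. c i \<noteq> 0 \<and> e i \<le> int n})" for n
    by (intro finite_vimageI admissible_finite assms)
qed (use admissible_nonneg[OF assms(2)] in auto)

text \<open>The difference of the two weights is odd under \<open>h\<close>, and \<open>h\<close>
  permutes the indices of each fixed exponent. So every coefficient of the difference equals its own
  negative.\<close>

lemma theta_eqI_involution:
  assumes adm: "admissible c e" "admissible c' e"
    and h: "\<And>i. h (h i) = i" "\<And>i. e (h i) = e i" "\<And>i. c (h i) - c' (h i) = - (c i - c' i)"
  shows "theta c e = theta c' e"
proof -
  have adm': "admissible (\<lambda>i. c i + - 1 * c' i) e"
    by (intro admissible_add admissible_scale adm)
  have "theta (\<lambda>i. c i + - 1 * c' i) e $ n = 0" for n
  proof -
    let ?S = "{i. c i + - 1 * c' i \<noteq> 0 \<and> e i = int n}"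
    have "(\<Sum>i\<in>?S. c i + - 1 * c' i) = (\<Sum>i\<in>?S. - (c i + - 1 * c' i))"
    proof (rule sum.reindex_bij_witness[of _ h h])
      fix i assume i: "i \<in> ?S"
      show "h i \<in> ?S" "h i \<in> ?S" using i h(2,3)[of i] by auto
      show "- (c (h i) + - 1 * c' (h i)) = c i + - 1 * c' i" using h(3)[of i] by simp
    qed (simp_all add: h)
    then show ?thesis
      unfolding theta_nth[OF adm'] sum_negf by linarith
  qed
  then have "theta (\<lambda>i. c i + - 1 * c' i) e = 0" by (intro fps_ext) simp
  then have "theta c e + fps_const (- 1) * theta c' e = 0"
    by (simp only: theta_add[OF adm(1) admissible_scale[OF adm(2)]] theta_scale[OF adm(2)])
  moreover have "fps_const (- 1) = (- 1 :: int fps)" by (simp flip: fps_const_neg)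
  ultimately show ?thesis by simp
qed

lemma admissible_quadratic:
  assumes "c > 0" "0 \<le> a" "a \<le> 2 * c"
  shows "admissible f (\<lambda>k. c * k ^ 2 + (a - c) * k)"
proof (rule admissibleI[where F = "\<lambda>n. {- int n - 1..int n + 1}"])
  fix n k assume "c * k ^ 2 + (a - c) * k \<le> int n"
  then show "k \<in> {- int n - 1..int n + 1}" using quadratic_exponent_bound(1)[OF assms, of k] by auto
qed (use quadratic_exponent_bound(2)[OF assms] in auto)

text \<open>The sign with which \<open>z\<^sup>m\<close> occurs in \<open>1/(1 - z)\<close> for \<open>z = q\<^bsup>6k+1\<^esup>\<close>: for negative \<open>k\<close> the expansion
  in powers of \<open>q\<close> is \<open>- z\<^sup>-\<^sup>1 - z\<^sup>-\<^sup>2 - \<dots>\<close>.\<close>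
definition quadrant_sign :: "int \<Rightarrow> int \<Rightarrow> int" where
  "quadrant_sign k m = (if k \<ge> 0 \<and> m \<ge> 0 then 1 else if k < 0 \<and> m < 0 then - 1 else 0)"

abbreviation lambert_coeff :: "int \<times> int \<Rightarrow> int" where
  "lambert_coeff \<equiv> \<lambda>(k, m). quadrant_sign k m * alt (- 1) k"

abbreviation lambert_exp :: "(int \<Rightarrow> int) \<Rightarrow> int \<times> int \<Rightarrow> int" where
  "lambert_exp u \<equiv> \<lambda>(k, m). u k + (6 * k + 1) * m"

text \<open>On both quadrants of the support the mixed term 6km is nonnegative, so the exponent
  grows in both directions. The second hypothesis bounds the first exponent in the negative
  quadrant, the one at (-1 - k, -1).\<close>

lemma admissible_lambert:
  assumes u: "\<And>k. k \<ge> 0 \<Longrightarrow> u k \<ge> k" "\<And>k. k \<ge> 0 \<Longrightarrow> u (- 1 - k) + 6 * k + 5 \<ge> k"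
  shows "admissible lambert_coeff (lambert_exp u)"
proof -
  have bound: "\<bar>k\<bar> + \<bar>m\<bar> - 2 \<le> lambert_exp u (k, m) \<and> 0 \<le> lambert_exp u (k, m)" if "lambert_coeff (k, m) \<noteq> 0" for k m
  proof -
    from that consider "k \<ge> 0" "m \<ge> 0" | "k < 0" "m < 0"
      by (auto simp: quadrant_sign_def split: if_splits)
    then show ?thesis
    proof cases
      case 1
      then have "0 \<le> k * m" by simp
      moreover have "lambert_exp u (k, m) = u k + 6 * (k * m) + m" by (simp add: algebra_simps)
      ultimately show ?thesis using u(1)[of k] 1 by linarith
    next
      case 2
      define a b where "a = - 1 - k" and "b = - 1 - m"
      have ab: "a \<ge> 0" "b \<ge> 0" "k = - 1 - a" "m = - 1 - b" using 2 by (auto simp: a_def b_def)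
      then have "0 \<le> a * b" by simp
      moreover have "lambert_exp u (k, m) = u (- 1 - a) + 6 * a + 5 + 6 * (a * b) + 5 * b"
        by (simp add: ab algebra_simps)
      ultimately show ?thesis using u(2)[of a] ab by linarith
    qed
  qed
  show ?thesis
  proof (rule admissibleI[where F = "\<lambda>n. {- int n - 2..int n + 2} \<times> {- int n - 2..int n + 2}"])
    fix i assume "lambert_coeff i \<noteq> 0"
    then show "0 \<le> lambert_exp u i" using bound[of "fst i" "snd i"] by (cases i) auto
  next
    fix n i assume "lambert_coeff i \<noteq> 0" "lambert_exp u i \<le> int n"
    moreover obtain k m where "i = (k, m)" by (cases i)
    ultimately show "i \<in> {- int n - 2..int n + 2} \<times> {- int n - 2..int n + 2}"
      using bound[of k m] by (auto simp: abs_if split: if_splits)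
  qed auto
qed

lemma geometric_fps_Sum:
  fixes d :: nat assumes "d > 0"
  shows "locally_finite (\<lambda>m. (fps_X :: int fps) ^ (d * m))" "(1 - fps_X ^ d) * fps_Sum (\<lambda>m. fps_X ^ (d * m)) = (1 :: int fps)"
proof -
  have fin: "finite {m. d * m = n}" for n
    by (rule finite_subset[of _ "{..n}"]) (use assms in auto)
  show lf: "locally_finite (\<lambda>m. (fps_X :: int fps) ^ (d * m))"
    using fin by (intro locally_finiteI[where F = "\<lambda>n. {m. d * m = n}"]) (auto split: if_splits)
  let ?f = "\<lambda>m. (fps_X :: int fps) ^ (d * m)"
  let ?g = "\<lambda>m::nat. if m = 0 then 1 else 0 :: int fps"
  have g: "locally_finite ?g"
    by (rule locally_finiteI[where F = "\<lambda>n. {0}"]) (auto split: if_splits)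
  let ?h = "\<lambda>m. if m = 0 then 0 else ?f m"
  have h: "locally_finite ?h"
    using fin by (intro locally_finiteI[where F = "\<lambda>n. {m. d * m = n}"]) (auto split: if_splits)
  have "fps_Sum ?f = fps_Sum (\<lambda>m. ?g m + ?h m)" by (rule arg_cong[of _ _ fps_Sum]) auto
  also have "\<dots> = fps_Sum ?g + fps_Sum ?h" by (rule fps_Sum_add[OF g h])
  also have "fps_Sum ?g = 1" by (subst fps_Sum_finite[of "{0}"]) auto
  also have "fps_Sum ?h = fps_Sum (\<lambda>m. ?h (Suc m))"
    by (rule fps_Sum_reindex) (auto simp: image_iff gr0_conv_Suc)
  also have "\<dots> = fps_Sum (\<lambda>m. fps_X ^ d * ?f m)" by (simp add: power_add)
  also have "\<dots> = fps_X ^ d * fps_Sum ?f" by (rule fps_Sum_cmult[OF lf])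
  finally show "(1 - fps_X ^ d) * fps_Sum ?f = 1" by (simp add: algebra_simps)
qed

lemma fps_const_alt_nat: "fps_const (alt (- 1) (int k)) = (- 1) ^ k"
  by (cases "even k") (auto simp flip: fps_const_neg)

text \<open>Summing over m first gives geometric series. In the negative quadrant, k and m are
  replaced by -1 - k and -1 - m; the quadrant sign -1 and the parity change of k cancel, and the
  ratio becomes X^(6k+5). Both fractions are then written with \<open>rdenom k\<close>.\<close>

lemma lambert_expansion:
  assumes u: "\<And>k. k \<ge> 0 \<Longrightarrow> u k \<ge> k" "\<And>k. k \<ge> 0 \<Longrightarrow> u (- 1 - k) + 6 * k + 5 \<ge> k"
  shows "theta lambert_coeff (lambert_exp u) = fps_Sum (\<lambda>k.
    (- 1) ^ k * (fps_X ^ nat (u (int k)) * (1 - fps_X ^ (6 * k + 5)) +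
      fps_X ^ nat (u (- 1 - int k) + 6 * int k + 5) * (1 - fps_X ^ (6 * k + 1))) * rdenom k)"
proof -
  let ?e = "lambert_exp u"
  let ?c1 = "\<lambda>(k, m). if k \<ge> 0 \<and> m \<ge> 0 then alt (- 1) k else 0"
  let ?c2 = "\<lambda>(k, m). if k < 0 \<and> m < 0 then - alt (- 1) k else 0"
  note adm = admissible_lambert[of u, OF u]
  have adm1: "admissible ?c1 ?e" and adm2: "admissible ?c2 ?e"
    by (rule admissible_mono[OF adm]; force simp: quadrant_sign_def split: if_splits)+
  have "lambert_coeff = (\<lambda>i. ?c1 i + ?c2 i)"
    by (auto simp: fun_eq_iff quadrant_sign_def)
  then have sum: "theta lambert_coeff ?e = theta ?c1 ?e + theta ?c2 ?e"
    by (simp only: theta_add[OF adm1 adm2])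
  have geo: "fps_Sum (\<lambda>m. fps_X ^ ((6 * k + 1) * m)) = (1 - fps_X ^ (6 * k + 5)) * rdenom k"
      "fps_Sum (\<lambda>m. fps_X ^ ((6 * k + 5) * m)) = (1 - fps_X ^ (6 * k + 1)) * rdenom k" for k
    by (rule fps_inverse_unique_comm[OF geometric_fps_Sum(2)], simp, use rdenom[of k] in \<open>simp only: mult_ac\<close>)+
  let ?f = "\<lambda>c e i. fps_const (c i) * fps_X ^ nat (e i) :: int fps"
  let ?h1 = "\<lambda>(k, m). (int k, int m)"
  let ?h2 = "\<lambda>(k, m). (- 1 - int k, - 1 - int m)"
  let ?g1 = "\<lambda>k. (- 1) ^ k * (fps_X ^ nat (u (int k)) * ((1 - fps_X ^ (6 * k + 5)) * rdenom k))"
  let ?g2 = "\<lambda>k. (- 1) ^ k * (fps_X ^ nat (u (- 1 - int k) + 6 * int k + 5) * ((1 - fps_X ^ (6 * k + 1)) * rdenom k))"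
  have pos: "0 < 6 * k + 1" "0 < 6 * k + 5" for k :: nat by simp_all
  have inj: "inj ?h1" "inj ?h2" by (auto simp: inj_on_def)
  note lf1 = locally_finite_reindex[OF inj(1) admissible_locally_finite[OF adm1]]
  note lf2 = locally_finite_reindex[OF inj(2) admissible_locally_finite[OF adm2]]
  have f1: "?f ?c1 ?e (?h1 (k, m)) = (- 1) ^ k * fps_X ^ nat (u (int k)) * fps_X ^ ((6 * k + 1) * m)" for k m
  proof -
    have "nat (u (int k) + (6 * int k + 1) * int m) = nat (u (int k)) + (6 * k + 1) * m"
      using u(1)[of "int k"] by (simp add: nat_add_distrib nat_mult_distrib)
    moreover have "?c1 (int k, int m) = alt (- 1) (int k)" by simp
    ultimately show ?thesis
      by (simp only: case_prod_conv fps_const_alt_nat power_add mult.assoc)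
  qed
  have f2: "?f ?c2 ?e (?h2 (k, m)) = (- 1) ^ k * fps_X ^ nat (u (- 1 - int k) + 6 * int k + 5) * fps_X ^ ((6 * k + 5) * m)" for k m
  proof -
    have *: "u (- 1 - int k) + (6 * (- 1 - int k) + 1) * (- 1 - int m) = (u (- 1 - int k) + 6 * int k + 5) + int ((6 * k + 5) * m)"
      by (simp add: algebra_simps)
    have "nat (u (- 1 - int k) + (6 * (- 1 - int k) + 1) * (- 1 - int m)) = nat (u (- 1 - int k) + 6 * int k + 5) + (6 * k + 5) * m"
    proof -
      have "0 \<le> u (- 1 - int k) + 6 * int k + 5" using u(2)[of "int k"] by linarith
      then show ?thesis unfolding * by (subst nat_add_distrib) (simp_all only: nat_int of_nat_0_le_iff)
    qed
    moreover have "?c2 (- 1 - int k, - 1 - int m) = alt (- 1) (int k)" by simp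
    ultimately show ?thesis
      by (simp only: case_prod_conv fps_const_alt_nat power_add mult.assoc)
  qed
  have t1: "theta ?c1 ?e = fps_Sum ?g1" "locally_finite ?g1"
  proof -
    have "theta ?c1 ?e = fps_Sum (\<lambda>i. ?f ?c1 ?e (?h1 i))"
      unfolding theta_def
    proof (rule fps_Sum_reindex[OF inj(1)])
      fix i :: "int \<times> int" assume i: "i \<notin> range ?h1"
      obtain k m where km: "i = (k, m)" by (cases i)
      have "\<not> (k \<ge> 0 \<and> m \<ge> 0)"
      proof
        assume "k \<ge> 0 \<and> m \<ge> 0"
        then have "i = ?h1 (nat k, nat m)" using km by simp
        with i show False by blast
      qed
      then show "?f ?c1 ?e i = 0" by (auto simp: km)
    qed
    moreover have inner: "fps_Sum (\<lambda>m. ?f ?c1 ?e (?h1 (k, m))) = ?g1 k" for k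
      unfolding f1 unfolding fps_Sum_cmult[OF geometric_fps_Sum(1)[OF pos(1)]] geo by (rule mult.assoc)
    ultimately show "theta ?c1 ?e = fps_Sum ?g1" "locally_finite ?g1"
      using fps_Sum_fubini[OF lf1] by (simp_all only: inner)
  qed
  have t2: "theta ?c2 ?e = fps_Sum ?g2" "locally_finite ?g2"
  proof -
    have "theta ?c2 ?e = fps_Sum (\<lambda>i. ?f ?c2 ?e (?h2 i))"
      unfolding theta_def
    proof (rule fps_Sum_reindex[OF inj(2)])
      fix i :: "int \<times> int" assume i: "i \<notin> range ?h2"
      obtain k m where km: "i = (k, m)" by (cases i)
      have "\<not> (k < 0 \<and> m < 0)"
      proof
        assume "k < 0 \<and> m < 0"
        then have "i = ?h2 (nat (- 1 - k), nat (- 1 - m))" using km by simp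
        with i show False by blast
      qed
      then show "?f ?c2 ?e i = 0" by (auto simp: km)
    qed
    moreover have inner: "fps_Sum (\<lambda>m. ?f ?c2 ?e (?h2 (k, m))) = ?g2 k" for k
      unfolding f2 unfolding fps_Sum_cmult[OF geometric_fps_Sum(1)[OF pos(2)]] geo by (rule mult.assoc)
    ultimately show "theta ?c2 ?e = fps_Sum ?g2" "locally_finite ?g2"
      using fps_Sum_fubini[OF lf2] by (simp_all only: inner)
  qed
  show ?thesis
    unfolding sum t1(1) t2(1) fps_Sum_add[OF t1(2) t2(2), symmetric]
    by (rule arg_cong[of _ _ fps_Sum]) (simp add: fun_eq_iff algebra_simps)
qed

section \<open>The dissection of the mock theta function modulo 3\<close>

abbreviation lambert :: "(int \<Rightarrow> int) \<Rightarrow> int fps" where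
  "lambert u \<equiv> theta lambert_coeff (lambert_exp u)"

text \<open>The exponent ck^2 + ck is invariant under k to -1 - k, so the two fractions share their
  leading power and their numerators combine to 1 - X^(12k+6).\<close>

lemma lambert_quadratic_expansion:
  fixes c :: nat
  assumes c: "c > 0"
  shows "lambert (\<lambda>k. int c * k ^ 2 + int c * k) = fps_Sum (\<lambda>k. (- 1) ^ k * fps_X ^ (c * k ^ 2 + c * k) *
    ((1 - fps_X ^ (12 * k + 6)) * rdenom k))"
proof -
  have bound: "k \<le> int c * k ^ 2 + int c * k" if "k \<ge> 0" for k
  proof -
    have "1 * k \<le> int c * k" using c that by (intro mult_right_mono) auto
    moreover have "0 \<le> int c * k ^ 2" by simp
    ultimately show ?thesis by linarith
  qed
  have sym: "int c * (- 1 - k) ^ 2 + int c * (- 1 - k) = int c * k ^ 2 + int c * k" for k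
    by (simp add: power2_eq_square algebra_simps)
  have "lambert (\<lambda>k. int c * k ^ 2 + int c * k) = fps_Sum (\<lambda>k. (- 1) ^ k *
     (fps_X ^ nat (int c * int k ^ 2 + int c * int k) * (1 - fps_X ^ (6 * k + 5)) +
      fps_X ^ nat (int c * (- 1 - int k) ^ 2 + int c * (- 1 - int k) + 6 * int k + 5) * (1 - fps_X ^ (6 * k + 1))) * rdenom k)"
  proof (rule lambert_expansion)
    show "k \<le> int c * (- 1 - k) ^ 2 + int c * (- 1 - k) + 6 * k + 5" if "k \<ge> 0" for k
      using bound[OF that] that unfolding sym by linarith
  qed (rule bound)
  also have "\<dots> = fps_Sum (\<lambda>k. (- 1) ^ k * fps_X ^ (c * k ^ 2 + c * k) * ((1 - fps_X ^ (12 * k + 6)) * rdenom k))"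
  proof (rule arg_cong[of _ _ fps_Sum], rule ext)
    fix k
    let ?a = "c * k ^ 2 + c * k"
    have "nat (int c * int k ^ 2 + int c * int k) = ?a"
      by (simp only: nat_int flip: of_nat_power of_nat_mult of_nat_add)
    moreover have "nat (int c * (- 1 - int k) ^ 2 + int c * (- 1 - int k) + 6 * int k + 5) = ?a + (6 * k + 5)"
    proof -
      have "int c * int k ^ 2 + int c * int k + 6 * int k + 5 = int (?a + (6 * k + 5))" by simp
      then show ?thesis unfolding sym by (simp only: nat_int)
    qed
    moreover have "fps_X ^ ?a * (1 - fps_X ^ (6 * k + 5)) + fps_X ^ (?a + (6 * k + 5)) * (1 - fps_X ^ (6 * k + 1)) =
        (fps_X ^ ?a * (1 - fps_X ^ (12 * k + 6)) :: int fps)"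
    proof -
      have "12 * k + 6 = (6 * k + 5) + (6 * k + 1)" by simp
      then have "fps_X ^ (12 * k + 6) = (fps_X ^ (6 * k + 5) * fps_X ^ (6 * k + 1) :: int fps)"
        by (simp only: power_add)
      moreover have "a * (1 - b) + a * b * (1 - d) = a * (1 - b * d)" for a b d :: "int fps"
        by (simp add: algebra_simps)
      ultimately show ?thesis unfolding power_add[of _ ?a] by simp
    qed
    ultimately show "(- 1) ^ k *
     (fps_X ^ nat (int c * int k ^ 2 + int c * int k) * (1 - fps_X ^ (6 * k + 5)) +
      fps_X ^ nat (int c * (- 1 - int k) ^ 2 + int c * (- 1 - int k) + 6 * int k + 5) * (1 - fps_X ^ (6 * k + 1))) * rdenom k
     = (- 1) ^ k * fps_X ^ ?a * ((1 - fps_X ^ (12 * k + 6)) * rdenom k)"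
      by (simp only: mult.assoc)
  qed
  finally show ?thesis .
qed

text \<open>The reflected index has leading exponent 3k + 2, and 1 - X^(6k+5) + X^2 (1 - X^(6k+1)) =
  (1 + X^2)(1 - X^(6k+3)). This matches the sum in \<open>theta_quotient_expansion\<close>.\<close>

lemma lambert_linear_expansion:
  "lambert (\<lambda>k. 3 * k) = fps_Sum (\<lambda>k. (- 1) ^ k * fps_X ^ (3 * k) *
    ((1 + fps_X ^ 2) * (1 - fps_X ^ (6 * k + 3)) * rdenom k))"
proof -
  have "lambert (\<lambda>k. 3 * k) = fps_Sum (\<lambda>k. (- 1) ^ k *
     (fps_X ^ nat (3 * int k) * (1 - fps_X ^ (6 * k + 5)) +
      fps_X ^ nat (3 * (- 1 - int k) + 6 * int k + 5) * (1 - fps_X ^ (6 * k + 1))) * rdenom k)"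
    by (rule lambert_expansion) auto
  also have "\<dots> = fps_Sum (\<lambda>k. (- 1) ^ k * fps_X ^ (3 * k) * ((1 + fps_X ^ 2) * (1 - fps_X ^ (6 * k + 3)) * rdenom k))"
  proof (rule arg_cong[of _ _ fps_Sum], rule ext)
    fix k
    have "nat (3 * int k) = 3 * k" "nat (3 * (- 1 - int k) + 6 * int k + 5) = 3 * k + 2" by auto
    moreover have "fps_X ^ (3 * k) * (1 - fps_X ^ (6 * k + 5)) + fps_X ^ (3 * k + 2) * (1 - fps_X ^ (6 * k + 1)) =
        fps_X ^ (3 * k) * ((1 + fps_X ^ 2) * (1 - fps_X ^ (6 * k + 3)) :: int fps)"
    proof -
      have "6 * k + 5 = (6 * k + 3) + 2" "3 * k + 2 + (6 * k + 1) = 3 * k + (6 * k + 3)" by simp_all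
      then have 1: "fps_X ^ (6 * k + 5) = (fps_X ^ (6 * k + 3) * fps_X ^ 2 :: int fps)"
        and 2: "fps_X ^ (3 * k + 2) * fps_X ^ (6 * k + 1) = (fps_X ^ (3 * k) * fps_X ^ (6 * k + 3) :: int fps)"
        by (simp_all only: flip: power_add)
      have "a * (1 - b * d) + e * (1 - f) = a * ((1 + d) * (1 - b))"
        if "e = a * d" "e * f = a * b" for a b d e f :: "int fps"
      proof -
        have "e * (1 - f) = a * d - a * b" using that by (simp only: right_diff_distrib mult_1_right)
        then show ?thesis by (simp add: algebra_simps)
      qed
      then show ?thesis unfolding 1 using 2 power_add by blast
    qed
    ultimately show "(- 1) ^ k *
     (fps_X ^ nat (3 * int k) * (1 - fps_X ^ (6 * k + 5)) +
      fps_X ^ nat (3 * (- 1 - int k) + 6 * int k + 5) * (1 - fps_X ^ (6 * k + 1))) * rdenom k =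
      (- 1) ^ k * fps_X ^ (3 * k) * ((1 + fps_X ^ 2) * (1 - fps_X ^ (6 * k + 3)) * rdenom k)"
      by (simp only: mult.assoc)
  qed
  finally show ?thesis .
qed

lemma prod_rdenom: "fps_right_inverse (xi_denom (Suc n)) 1 = (\<Prod>j\<le>n. rdenom j)"
proof (rule fps_inverse_unique_comm[OF xi_denom_inverse])
  show "xi_denom (Suc n) * (\<Prod>j\<le>n. rdenom j) = 1"
    unfolding xi_denom_def qpoch_def lessThan_Suc_atMost prod.distrib[symmetric]
    using rdenom by (intro prod.neutral) (simp add: power_add mult_ac flip: power_mult)
qed

text \<open>Shifting the index by one turns 6n^2 - 6n + 1 into 6n^2 + 6n + 1, so \<open>xi\<close>
  is 1 + 2X times the mock theta function expanded in
  \<open>universal_mock_theta_expansion\<close>.\<close>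

lemma xi_lambert: "poch6 6 * xi = poch6 6 + 2 * fps_X * lambert (\<lambda>k. 9 * k ^ 2 + 9 * k)"
proof -
  let ?l = "\<lambda>n. fps_X ^ (6 * n ^ 2 + 6 * n) * (\<Prod>j\<le>n. rdenom j)"
  have xt: "xi_term (Suc n) = fps_X * ?l n" for n
  proof -
    have "6 * Suc n ^ 2 - 6 * Suc n + 1 = Suc (6 * n ^ 2 + 6 * n)" by (simp add: power2_eq_square algebra_simps)
    then show ?thesis unfolding xi_term_def prod_rdenom by (simp only: power_Suc mult.assoc)
  qed
  have lf: "locally_finite ?l"
  proof (rule locally_finiteI[where F = "\<lambda>n. {..n}"])
    show "k \<in> {..n}" if "?l k $ n \<noteq> 0" for n k
    proof (rule ccontr)
      assume "k \<notin> {..n}"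
      then have "n < 6 * k ^ 2 + 6 * k" by auto
      then show False using that by (simp add: fps_X_power_mult_nth)
    qed
  qed simp
  have "(\<lambda>n. \<Sum>k\<le>n. xi_term (Suc k)) \<longlonglongrightarrow> fps_Sum (\<lambda>k. xi_term (Suc k))"
    by (rule tendsto_sum_atMost(1)) (auto intro: xi_term_nth_eq_0)
  then have "(\<lambda>k. xi_term (Suc k)) sums fps_Sum (\<lambda>k. xi_term (Suc k))"
    by (simp add: sums_def_le)
  then have "(\<Sum>k. xi_term (Suc k)) = fps_X * fps_Sum ?l"
    unfolding xt fps_Sum_cmult[OF lf] by (simp add: sums_iff)
  then have "poch6 6 * xi = poch6 6 + 2 * fps_X * (poch6 6 * fps_Sum ?l)"
    by (simp add: xi_def algebra_simps)
  also have "poch6 6 * fps_Sum ?l = lambert (\<lambda>k. 9 * k ^ 2 + 9 * k)"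
    unfolding universal_mock_theta_expansion using lambert_quadratic_expansion[of 9] by simp
  finally show ?thesis .
qed

lemma lambert_product: "poch6 6 ^ 2 = poch6 1 * poch6 5 * lambert (\<lambda>k. 3 * k ^ 2 + 3 * k)"
  using reciprocal_theta_expansion lambert_quadratic_expansion[of 3] by simp

lemma lambert_linear_product:
  "poch6 6 ^ 2 * npoch6 2 * npoch6 4 = poch6 1 * poch6 5 * npoch6 3 ^ 2 * lambert (\<lambda>k. 3 * k)"
  unfolding lambert_linear_expansion by (rule theta_quotient_expansion)

section \<open>Euler products and the residue classes of the exponents modulo 3\<close>

abbreviation euler :: "nat \<Rightarrow> int fps" where
  "euler m \<equiv> qpoch_inf (fps_X ^ m) (fps_X ^ m)"

lemma qpoch_inf_nonzero: "a $ 0 = 0 \<Longrightarrow> qpoch_inf (a :: int fps) q \<noteq> 0"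
  by (metis fps_zero_nth fps_nth_Abs_fps qpoch_inf_def qpoch_nth_0 zero_neq_one)

lemma prod_lessThan_numerals:
  fixes f :: "nat \<Rightarrow> 'a::comm_monoid_mult"
  shows "prod f {..<2} = f 0 * f 1" "prod f {..<3} = f 0 * f 1 * f 2"
    "prod f {..<6} = f 0 * f 1 * f 2 * f 3 * f 4 * f 5"
  by (simp_all add: eval_nat_numeral)

text \<open>The triple product with exponents 2d and 4d in base X^(6d) collects the factors of the
  Euler product by their residue class modulo 3.\<close>

lemma euler_pentagonal:
  assumes d: "d > 0"
  shows "euler (2 * d) = theta (alt (- 1)) (\<lambda>k. 3 * int d * k ^ 2 + int d * k)"
proof -
  have "theta (alt (- 1)) (\<lambda>k. int (3 * d) * k ^ 2 + (int (4 * d) - int (3 * d)) * k) =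
    qpoch_inf (fps_X ^ (4 * d)) (fps_X ^ (6 * d)) * qpoch_inf (fps_X ^ (2 * d)) (fps_X ^ (6 * d)) * euler (6 * d)"
    using jacobi_triple_product[of "- 1" "4 * d" "2 * d" "3 * d"] d by (simp flip: fps_const_neg)
  also have "\<dots> = euler (2 * d)"
    by (subst (4) qpoch_inf_split[where m = 3]) (use d in \<open>simp_all add: prod_lessThan_numerals mult_ac flip: power_add power_mult\<close>)
  finally show ?thesis by (simp add: algebra_simps)
qed

lemma admissible_pentagonal: "d > 0 \<Longrightarrow> admissible (alt (- 1)) (\<lambda>k. 3 * int d * k ^ 2 + int d * k)"
  using admissible_quadratic[of "3 * int d" "4 * int d" "alt (- 1)"] by (simp add: algebra_simps)

text \<open>A factor supported on multiples of m acts on each residue class separately; with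
  \<open>euler 6\<close> as that factor, \<open>xi\<close> can be treated class by class.\<close>

lemma fps_mult_nth_dissect:
  fixes F f :: "'a::comm_ring_1 fps"
  assumes z: "\<And>n. \<not> m dvd n \<Longrightarrow> F $ n = 0" and r: "r < m"
  shows "(F * f) $ (m * n + r) = (Abs_fps (\<lambda>i. F $ (m * i)) * Abs_fps (\<lambda>i. f $ (m * i + r))) $ n"
proof -
  have "(F * f) $ (m * n + r) = (\<Sum>i\<in>(\<lambda>i. m * i) ` {0..n}. F $ i * f $ (m * n + r - i))"
    unfolding fps_mult_nth
  proof (rule sum.mono_neutral_right)
    show "(\<lambda>i. m * i) ` {0..n} \<subseteq> {0..m * n + r}" by (auto intro: le_trans[OF mult_le_mono2 le_add1])
    show "\<forall>i\<in>{0..m * n + r} - (\<lambda>i. m * i) ` {0..n}. F $ i * f $ (m * n + r - i) = 0"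
    proof
      fix i assume i: "i \<in> {0..m * n + r} - (\<lambda>i. m * i) ` {0..n}"
      have "\<not> m dvd i"
      proof
        assume "m dvd i"
        then obtain j where j: "i = m * j" by blast
        with i r have "m * j < m * Suc n" by auto
        then have "j \<le> n" unfolding mult_less_cancel1 by simp
        with i j show False by auto
      qed
      then show "F $ i * f $ (m * n + r - i) = 0" using z by simp
    qed
  qed simp
  also have "\<dots> = (\<Sum>i=0..n. F $ (m * i) * f $ (m * n + r - m * i))"
    using r by (subst sum.reindex) (auto simp: inj_on_def)
  also have "\<dots> = (\<Sum>i=0..n. F $ (m * i) * f $ (m * (n - i) + r))"
    by (intro sum.cong refl) (auto simp: diff_mult_distrib2)
  finally show ?thesis by (simp add: fps_mult_nth)
qed

lemma euler_6_nth:
  "\<not> 3 dvd n \<Longrightarrow> euler 6 $ n = 0" "euler 6 $ (3 * n) = euler 2 $ n"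
proof -
  have e6: "euler 6 = theta (alt (- 1)) (\<lambda>k. 9 * k ^ 2 + 3 * k)"
    using euler_pentagonal[of 3] by simp
  have e2: "euler 2 = theta (alt (- 1)) (\<lambda>k. 3 * k ^ 2 + k)"
    using euler_pentagonal[of 1] by simp
  have adm6: "admissible (alt (- 1)) (\<lambda>k. 9 * k ^ 2 + 3 * k)"
    using admissible_pentagonal[of 3] by simp
  have adm2: "admissible (alt (- 1)) (\<lambda>k. 3 * k ^ 2 + k)"
    using admissible_pentagonal[of 1] by simp
  show "euler 6 $ n = 0" if "\<not> 3 dvd n"
    unfolding e6 theta_nth[OF adm6]
  proof (rule sum.neutral, safe)
    fix k :: int assume "9 * k ^ 2 + 3 * k = int n"
    then have "int n = 3 * (3 * k ^ 2 + k)" by simp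
    then have "3 dvd int n" by (rule dvdI)
    with that show "alt (- 1) k = 0" by presburger
  qed
  have "(9 * k ^ 2 + 3 * k = int (3 * n)) \<longleftrightarrow> (3 * k ^ 2 + k = int n)" for k :: int
    by simp presburger
  then show "euler 6 $ (3 * n) = euler 2 $ n"
    unfolding e6 e2 theta_nth[OF adm6] theta_nth[OF adm2] by simp
qed

lemma euler_6_dissect: "Abs_fps (\<lambda>i. euler 6 $ (3 * i)) = euler 2"
  by (rule fps_ext) (simp add: euler_6_nth)

definition xi_part :: "nat \<Rightarrow> int fps" where
  "xi_part r = Abs_fps (\<lambda>n. xi $ (3 * n + r))"

lemma euler_xi_part:
  assumes "r < 3"
  shows "(euler 2 * xi_part r) $ n = (euler 6 + 2 * fps_X * lambert (\<lambda>k. 9 * k ^ 2 + 9 * k)) $ (3 * n + r)"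
  unfolding xi_part_def xi_lambert[symmetric] euler_6_dissect[symmetric]
  using assms by (intro fps_mult_nth_dissect[symmetric] euler_6_nth(1))

lemma admissible_lambert_quadratic:
  assumes "c > 0" shows "admissible lambert_coeff (lambert_exp (\<lambda>k. c * k ^ 2 + c * k))"
proof (rule admissible_lambert)
  fix k :: int assume k: "k \<ge> 0"
  have "1 * k \<le> c * k" using assms k by (intro mult_right_mono) auto
  moreover have "0 \<le> c * k ^ 2" using assms by simp
  ultimately show bound: "k \<le> c * k ^ 2 + c * k" by linarith
  have "c * (- 1 - k) ^ 2 + c * (- 1 - k) = c * k ^ 2 + c * k"
    by (simp add: power2_eq_square algebra_simps)
  then show "k \<le> c * (- 1 - k) ^ 2 + c * (- 1 - k) + 6 * k + 5" using bound k by linarith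
qed

text \<open>The numbers m and dm + r lie on the same side of the gap between -1 and 0, so the
  two-quadrant expansion survives the restriction of the second index to a residue class.\<close>

lemma quadrant_sign_mult: "d > 0 \<Longrightarrow> 0 \<le> r \<Longrightarrow> r < d \<Longrightarrow> quadrant_sign k (d * m + r) = quadrant_sign k m"
proof -
  assume d: "d > 0" "0 \<le> r" "r < d"
  have "0 \<le> d * m + r \<longleftrightarrow> 0 \<le> m"
  proof
    assume *: "0 \<le> d * m + r"
    show "0 \<le> m"
    proof (rule ccontr)
      assume "\<not> 0 \<le> m"
      then have "d * m \<le> d * (- 1)" using d by (intro mult_left_mono) auto
      with * d show False by linarith
    qed
  qed (use d in auto)
  then show ?thesis by (auto simp: quadrant_sign_def not_le[symmetric])
qed

text \<open>Class 1 consists of the terms with m = 3j, and dividing their shifted exponents by 3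
  leaves 3k^2 + 3k + (6k + 1)j. The series \<open>euler 6\<close> has no term in this class.\<close>

lemma euler_xi_part_1: "euler 2 * xi_part 1 = 2 * lambert (\<lambda>k. 3 * k ^ 2 + 3 * k)"
proof (rule fps_ext)
  fix n
  note adm3 = admissible_lambert_quadratic[of 3, simplified]
  note adm9 = admissible_lambert_quadratic[of 9, simplified]
  let ?S = "{i. lambert_coeff i \<noteq> 0 \<and> lambert_exp (\<lambda>k. 9 * k ^ 2 + 9 * k) i = int (3 * n)}"
  let ?T = "{i. lambert_coeff i \<noteq> 0 \<and> lambert_exp (\<lambda>k. 3 * k ^ 2 + 3 * k) i = int n}"
  have "\<not> 3 dvd 3 * n + 1" by presburger
  then have "(euler 2 * xi_part 1) $ n = 2 * lambert (\<lambda>k. 9 * k ^ 2 + 9 * k) $ (3 * n)"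
    by (simp add: euler_xi_part euler_6_nth(1) mult.assoc numeral_fps_const)
  also have "lambert (\<lambda>k. 9 * k ^ 2 + 9 * k) $ (3 * n) = sum lambert_coeff ?S"
    by (rule theta_nth[OF adm9])
  also have "\<dots> = sum lambert_coeff ?T"
  proof (rule sum.reindex_bij_witness[of _ "\<lambda>(k, m). (k, 3 * m)" "\<lambda>(k, m). (k, m div 3)"])
    fix i assume i: "i \<in> ?S"
    obtain k m where km: "i = (k, m)" by (cases i)
    have "9 * k ^ 2 + 9 * k + (6 * k + 1) * m = 3 * int n" using i by (simp add: km)
    then have "m = 3 * (int n - 3 * k ^ 2 - 3 * k - 2 * k * m)" by (simp add: algebra_simps)
    then obtain j where j: "m = 3 * j" by blast
    then show "(\<lambda>(k, m). (k, 3 * m)) ((\<lambda>(k, m). (k, m div 3)) i) = i" by (simp add: km)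
    show "(\<lambda>(k, m). (k, m div 3)) i \<in> ?T"
      using i quadrant_sign_mult[of 3 0 k j] by (simp add: km j algebra_simps split: if_splits)
    show "lambert_coeff ((\<lambda>(k, m). (k, m div 3)) i) = lambert_coeff i"
      using quadrant_sign_mult[of 3 0 k j] by (simp add: km j)
  next
    fix i assume i: "i \<in> ?T"
    obtain k m where km: "i = (k, m)" by (cases i)
    show "(\<lambda>(k, m). (k, m div 3)) ((\<lambda>(k, m). (k, 3 * m)) i) = i" by (simp add: km)
    show "(\<lambda>(k, m). (k, 3 * m)) i \<in> ?S"
      using i quadrant_sign_mult[of 3 0 k m] by (simp add: km algebra_simps split: if_splits)
  qed
  also have "\<dots> = lambert (\<lambda>k. 3 * k ^ 2 + 3 * k) $ n"
    by (rule theta_nth[OF adm3, symmetric])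
  finally show "(euler 2 * xi_part 1) $ n = (2 * lambert (\<lambda>k. 3 * k ^ 2 + 3 * k)) $ n"
    by (simp add: numeral_fps_const)
qed

text \<open>The series \<open>\<Sum>\<^sub>k (-1)\<^sup>k q\<^bsup>3k\<^sup>2+k\<^esup> (1 + q\<^bsup>6k+1\<^esup>)/(1 - q\<^bsup>6k+1\<^esup>)\<close> over all integers \<open>k\<close>, each
  fraction being expanded in powers of \<open>q\<close>.\<close>
definition appell :: "int fps" where
  "appell = theta (\<lambda>(k, m). ((if k \<ge> 0 then 1 else - 1) + sgn m) * alt (- 1) k) (lambert_exp (\<lambda>k. 3 * k ^ 2 + k))"

lemma admissible_shifted: "admissible (\<lambda>(k, m). quadrant_sign k (m - 1) * alt (- 1) k) (lambert_exp (\<lambda>k. 3 * k ^ 2 + k))"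
proof -
  \<comment> \<open>Replacing m by m + 1 adds 6k + 1 to 3k^2 + k.\<close>
  have "admissible lambert_coeff (lambert_exp (\<lambda>k. 3 * k ^ 2 + 7 * k + 1))"
  proof (rule admissible_lambert)
    fix k :: int assume k: "k \<ge> 0"
    have "0 \<le> k ^ 2" by simp
    then show "k \<le> 3 * k ^ 2 + 7 * k + 1" using k by linarith
    have "3 * (- 1 - k) ^ 2 + 7 * (- 1 - k) + 1 + 6 * k + 5 = 3 * k ^ 2 + 5 * k + 2"
      by (simp add: power2_eq_square algebra_simps)
    then show "k \<le> 3 * (- 1 - k) ^ 2 + 7 * (- 1 - k) + 1 + 6 * k + 5" using k \<open>0 \<le> k ^ 2\<close> by linarith
  qed
  from admissible_reindex[OF _ this, of "\<lambda>(k, m). (k, m - 1)"]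
  show ?thesis by (simp add: case_prod_unfold inj_on_def prod_eq_iff algebra_simps)
qed

text \<open>The pentagonal series is placed on the row m = 0 of the pairs (k, m), so that it can be
  added termwise to a Lambert series.\<close>

lemma euler_2_pairs:
  "euler 2 = theta (\<lambda>(k, m). if m = 0 then alt (- 1) k else 0) (lambert_exp (\<lambda>k. 3 * k ^ 2 + k))"
  "admissible (\<lambda>(k, m). if m = 0 then alt (- 1) k else 0) (lambert_exp (\<lambda>k. 3 * k ^ 2 + k))"
proof -
  have adm: "admissible (alt (- 1)) (\<lambda>k. 3 * k ^ 2 + k)"
    using admissible_pentagonal[of 1] by simp
  show "admissible (\<lambda>(k, m). if m = 0 then alt (- 1) k else 0) (lambert_exp (\<lambda>k. 3 * k ^ 2 + k))"
  proof (rule admissibleI[where F = "\<lambda>n. {k. alt (- 1) k \<noteq> 0 \<and> 3 * k ^ 2 + k \<le> int n} \<times> {0}"])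
    show "finite ({k. alt (- 1) k \<noteq> 0 \<and> 3 * k ^ 2 + k \<le> int n} \<times> {0 :: int})" for n
      using admissible_finite[OF adm] by blast
    fix i :: "int \<times> int" assume "(case i of (k, m) \<Rightarrow> if m = 0 then alt (- 1) k else 0) \<noteq> 0"
    then show "0 \<le> lambert_exp (\<lambda>k. 3 * k ^ 2 + k) i"
      using admissible_nonneg[OF adm, of "fst i"] by (cases i; cases "snd i = 0"; simp)
  qed (auto split: if_splits)
  have "theta (\<lambda>(k, m). if m = 0 then alt (- 1) k else 0) (lambert_exp (\<lambda>k. 3 * k ^ 2 + k)) =
      theta (alt (- 1)) (\<lambda>k. 3 * k ^ 2 + k)"
    unfolding theta_def by (subst fps_Sum_reindex[of "\<lambda>k. (k, 0)"]) (auto simp: inj_on_def)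
  then show "euler 2 = theta (\<lambda>(k, m). if m = 0 then alt (- 1) k else 0) (lambert_exp (\<lambda>k. 3 * k ^ 2 + k))"
    using euler_pentagonal[of 1] by simp
qed

text \<open>This is (1 + z)/(1 - z) = 1 + 2z/(1 - z). The ones sum to \<open>euler 2\<close>, and
  the extra z shifts the sign to \<open>m - 1\<close>; for k < 0 the row m = 0 thus gets the weight
  1 - 2 = -1.\<close>

lemma appell_eq:
  "appell = euler 2 + 2 * theta (\<lambda>(k, m). quadrant_sign k (m - 1) * alt (- 1) k) (lambert_exp (\<lambda>k. 3 * k ^ 2 + k))"
  "admissible (\<lambda>(k, m). ((if k \<ge> 0 then 1 else - 1) + sgn m) * alt (- 1) k) (lambert_exp (\<lambda>k. 3 * k ^ 2 + k))"
proof -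
  let ?c = "\<lambda>(k, m). quadrant_sign k (m - 1) * alt (- 1) k" and ?d = "\<lambda>(k, m). if m = 0 then alt (- 1) k else 0"
  have "((if k \<ge> 0 then 1 else - 1) + sgn m) * alt (- 1) k = ?d (k, m) + 2 * ?c (k, m)" for k m :: int
    by (auto simp: quadrant_sign_def sgn_if)
  then have eq: "(\<lambda>(k, m). ((if k \<ge> 0 then 1 else - 1) + sgn m) * alt (- 1) k) = (\<lambda>i. ?d i + 2 * ?c i)"
    by (auto simp only: fun_eq_iff case_prod_conv split_paired_All)
  note adm = euler_2_pairs(2) admissible_scale[OF admissible_shifted, of 2]
  show "admissible (\<lambda>(k, m). ((if k \<ge> 0 then 1 else - 1) + sgn m) * alt (- 1) k) (lambert_exp (\<lambda>k. 3 * k ^ 2 + k))"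
    unfolding eq by (rule admissible_add[OF adm])
  show "appell = euler 2 + 2 * theta ?c (lambert_exp (\<lambda>k. 3 * k ^ 2 + k))"
    unfolding appell_def eq theta_add[OF adm] theta_scale[OF admissible_shifted] euler_2_pairs(1)
    by (simp add: numeral_fps_const)
qed

text \<open>Class 0 consists of the terms with m = 3j - 1 = 3(j - 1) + 2, so their sign is that of j
  - 1 and a third of the exponent is 3k^2 + k + (6k + 1)j. The series \<open>euler 6\<close>
  contributes \<open>euler 2\<close>, the ones in \<open>appell_eq\<close>.\<close>

lemma euler_xi_part_0: "euler 2 * xi_part 0 = appell"
proof (rule fps_ext)
  fix n
  note adm9 = admissible_lambert_quadratic[of 9, simplified]
  let ?e = "lambert_exp (\<lambda>k. 9 * k ^ 2 + 9 * k)"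
  let ?S = "{i. lambert_coeff i \<noteq> 0 \<and> ?e i = 3 * int n - 1}"
  let ?c = "\<lambda>(k, m). quadrant_sign k (m - 1) * alt (- 1) k"
  let ?T = "{i. ?c i \<noteq> 0 \<and> lambert_exp (\<lambda>k. 3 * k ^ 2 + k) i = int n}"
  \<comment> \<open>The factor X asks for the exponent 3n - 1; for n = 0 this is -1 and the index
    set is empty.\<close>
  have shift: "(fps_X * lambert (\<lambda>k. 9 * k ^ 2 + 9 * k)) $ (3 * n) = sum lambert_coeff ?S"
  proof (cases n)
    case 0
    have "?e i \<noteq> 3 * int n - 1" if "lambert_coeff i \<noteq> 0" for i
      using admissible_nonneg[OF adm9 that] 0 by linarith
    then have "?S = {}" by blast
    then show ?thesis using 0 by (simp only:) simp
  next
    case (Suc l)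
    then have "int (3 * n - 1) = 3 * int n - 1" by simp
    then show ?thesis using theta_nth[OF adm9, of "3 * n - 1"] Suc by simp
  qed
  have "sum lambert_coeff ?S = sum ?c ?T"
  proof (rule sum.reindex_bij_witness[of _ "\<lambda>(k, m). (k, 3 * m - 1)" "\<lambda>(k, m). (k, (m + 1) div 3)"])
    fix i assume i: "i \<in> ?S"
    obtain k m where km: "i = (k, m)" by (cases i)
    have "9 * k ^ 2 + 9 * k + (6 * k + 1) * m = 3 * int n - 1" using i by (simp add: km)
    then have "m + 1 = 3 * (int n - 3 * k ^ 2 - 3 * k - 2 * k * m)" by (simp add: algebra_simps)
    then obtain j where "m + 1 = 3 * j" by blast
    then have j: "m = 3 * j - 1" by simp
    then show "(\<lambda>(k, m). (k, 3 * m - 1)) ((\<lambda>(k, m). (k, (m + 1) div 3)) i) = i" by (simp add: km)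
    have qs: "quadrant_sign k (3 * j - 1) = quadrant_sign k (j - 1)"
      using quadrant_sign_mult[of 3 2 k "j - 1"] by (simp add: algebra_simps)
    show "(\<lambda>(k, m). (k, (m + 1) div 3)) i \<in> ?T"
      using i qs by (simp add: km j algebra_simps split: if_splits)
    show "?c ((\<lambda>(k, m). (k, (m + 1) div 3)) i) = lambert_coeff i"
      using qs by (simp add: km j)
  next
    fix i assume i: "i \<in> ?T"
    obtain k m where km: "i = (k, m)" by (cases i)
    have qs: "quadrant_sign k (3 * m - 1) = quadrant_sign k (m - 1)"
      using quadrant_sign_mult[of 3 2 k "m - 1"] by (simp add: algebra_simps)
    show "(\<lambda>(k, m). (k, (m + 1) div 3)) ((\<lambda>(k, m). (k, 3 * m - 1)) i) = i" by (simp add: km)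
    show "(\<lambda>(k, m). (k, 3 * m - 1)) i \<in> ?S"
      using i qs by (simp add: km algebra_simps split: if_splits)
  qed
  also have "\<dots> = theta ?c (lambert_exp (\<lambda>k. 3 * k ^ 2 + k)) $ n"
    by (rule theta_nth[OF admissible_shifted, symmetric])
  finally show "(euler 2 * xi_part 0) $ n = appell $ n"
    using euler_xi_part[of 0 n] shift by (simp add: appell_eq(1) euler_6_nth numeral_fps_const mult.assoc)
qed

text \<open>
  After the substitution below both sides have the exponent
  \<open>3N\<^sup>2 + N - 3m\<^sup>2 + 3r\<^sup>2 - 3r\<close> with \<open>N = k + m\<close>, and their coefficients differ by a function that is
  odd under \<open>(r, m) \<mapsto> (1 - r, -m)\<close> for fixed \<open>N\<close>.
\<close>
lemma appell_theta_product:
  "theta (alt 1) (\<lambda>r. 3 * r ^ 2 - 3 * r) * appell = 2 * lambert (\<lambda>k. 3 * k) * theta (alt 1) (\<lambda>n. 3 * n ^ 2 - 2 * n)"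
proof -
  let ?\<sigma> = "\<lambda>k::int. if k \<ge> 0 then 1 else - 1 :: int"
  let ?a = "\<lambda>(k, m). (?\<sigma> k + sgn m) * alt (- 1) k"
  let ?e = "lambert_exp (\<lambda>k. 3 * k ^ 2 + k)"
  have adm0: "admissible (alt 1) (\<lambda>r. 3 * r ^ 2 - 3 * r)"
    using admissible_quadratic[of 3 0 "alt 1"] by simp
  have adm1: "admissible (alt 1) (\<lambda>n. 3 * n ^ 2 - 2 * n)"
    using admissible_quadratic[of 3 1 "alt 1"] by simp
  have admJ: "admissible lambert_coeff (lambert_exp (\<lambda>k. 3 * k))"
    by (rule admissible_lambert) auto
  note adm2 = admissible_scale[OF admJ, of 2]
  let ?c = "\<lambda>(r, i). alt 1 r * ?a i" and ?E = "\<lambda>(r, i). 3 * r ^ 2 - 3 * r + ?e i"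
  let ?c' = "\<lambda>(i, n). 2 * lambert_coeff i * alt 1 n" and ?E' = "\<lambda>(i, n). lambert_exp (\<lambda>k. 3 * k) i + (3 * n ^ 2 - 2 * n)"
  \<comment> \<open>With n = k + r and second Lambert index m - r the mixed terms in kr cancel, and
    both sides get the same exponent.\<close>
  let ?h = "\<lambda>(r :: int, k :: int, m :: int). ((k, m - r), k + r)"
  have lhs: "theta (alt 1) (\<lambda>r. 3 * r ^ 2 - 3 * r) * appell = theta ?c ?E"
    unfolding appell_def by (rule theta_mult[OF adm0 appell_eq(2)])
  have rhs: "fps_const 2 * lambert (\<lambda>k. 3 * k) * theta (alt 1) (\<lambda>n. 3 * n ^ 2 - 2 * n) = theta ?c' ?E'"
    unfolding theta_scale[OF admJ, symmetric] by (rule theta_mult[OF adm2 adm1])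
  have bij: "bij ?h"
    by (rule o_bij[of "\<lambda>((k, m), n). (n - k, k, m + (n - k))"]) (auto simp: fun_eq_iff)
  have exp_eq: "(\<lambda>i. ?E' (?h i)) = ?E"
    by (auto simp: fun_eq_iff power2_eq_square algebra_simps)
  have admc: "admissible ?c ?E" by (rule admissible_mult[OF adm0 appell_eq(2)])
  have admc': "admissible (\<lambda>i. ?c' (?h i)) ?E"
    using admissible_reindex[OF bij_is_inj[OF bij] admissible_mult[OF adm2 adm1]] unfolding exp_eq .
  have "theta ?c ?E = theta (\<lambda>i. ?c' (?h i)) ?E"
  proof (rule theta_eqI_involution[OF admc admc', where h = "\<lambda>(r, k, m). (1 - r, k + 2 * m, - m)"])
    fix i :: "int \<times> int \<times> int"
    obtain r k m where i: "i = (r, k, m)" by (cases i)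
    let ?g = "\<lambda>(r, k, m). (1 - r, k + 2 * m, - m) :: int \<times> int \<times> int"
    show "?g (?g i) = i" by (simp add: i)
    show "?E (?g i) = ?E i" by (simp add: i power2_eq_square algebra_simps)
    \<comment> \<open>Twice \<open>quadrant_sign k m\<close> is
      \<open>?\<sigma> k + ?\<sigma> m\<close>, so the parts with \<open>?\<sigma> k\<close> cancel.
      The rest is odd because the involution sends m - r to -1 - (m - r), where
      \<open>?\<sigma>\<close> changes sign.\<close>
    have diff: "?c (r, k, m) - ?c' (?h (r, k, m)) = (sgn m - ?\<sigma> (m - r)) * alt (- 1) k" for r k m
      by (auto simp: quadrant_sign_def)
    have "?c (?g i) - ?c' (?h (?g i)) = (sgn (- m) - ?\<sigma> (- m - (1 - r))) * alt (- 1) (k + 2 * m)"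
      using diff[of "1 - r" "k + 2 * m" "- m"] by (simp only: i case_prod_conv)
    moreover have "?c i - ?c' (?h i) = (sgn m - ?\<sigma> (m - r)) * alt (- 1) k"
      using diff[of r k m] by (simp only: i case_prod_conv)
    ultimately show "?c (?g i) - ?c' (?h (?g i)) = - (?c i - ?c' (?h i))"
      by (simp only:) (auto simp: sgn_if)
  qed
  also have "\<dots> = theta ?c' ?E'"
    unfolding exp_eq[symmetric] by (rule theta_reindex[OF bij, symmetric])
  finally show ?thesis
    unfolding lhs rhs[symmetric] by (simp add: numeral_fps_const)
qed

section \<open>Evaluation of the classes 0 and 1 as infinite products\<close>

lemma poch_inf_split:
  "euler 1 = poch6 1 * poch6 2 * poch6 3 * poch6 4 * poch6 5 * euler 6"
  "euler 2 = poch6 2 * poch6 4 * euler 6"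
  "euler 3 = poch6 3 * euler 6"
  "qpoch_inf (- (fps_X ^ 1)) (fps_X ^ 1) = npoch6 1 * npoch6 2 * npoch6 3 * npoch6 4 * npoch6 5 * npoch6 6"
  "qpoch_inf (- (fps_X ^ 3)) (fps_X ^ 3) = npoch6 3 * npoch6 6"
proof -
  show "euler 1 = poch6 1 * poch6 2 * poch6 3 * poch6 4 * poch6 5 * euler 6"
  proof -
    have "euler 1 = (\<Prod>i<6. qpoch_inf (fps_X ^ 1 * (fps_X ^ 1) ^ i) ((fps_X ^ 1) ^ 6))"
      by (rule qpoch_inf_split) simp_all
    then show ?thesis
      unfolding prod_lessThan_numerals mult_minus_left power_mult[symmetric] power_add[symmetric]
      by (simp add: power2_eq_square power3_eq_cube mult_ac)
  qed
  show "euler 2 = poch6 2 * poch6 4 * euler 6"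
  proof -
    have "euler 2 = (\<Prod>i<3. qpoch_inf (fps_X ^ 2 * (fps_X ^ 2) ^ i) ((fps_X ^ 2) ^ 3))"
      by (rule qpoch_inf_split) simp_all
    then show ?thesis
      unfolding prod_lessThan_numerals mult_minus_left power_mult[symmetric] power_add[symmetric]
      by (simp add: mult_ac)
  qed
  show "euler 3 = poch6 3 * euler 6"
  proof -
    have "euler 3 = (\<Prod>i<2. qpoch_inf (fps_X ^ 3 * (fps_X ^ 3) ^ i) ((fps_X ^ 3) ^ 2))"
      by (rule qpoch_inf_split) simp_all
    then show ?thesis
      unfolding prod_lessThan_numerals mult_minus_left power_mult[symmetric] power_add[symmetric]
      by (simp add: mult_ac)
  qed
  show "qpoch_inf (- (fps_X ^ 1)) (fps_X ^ 1) = npoch6 1 * npoch6 2 * npoch6 3 * npoch6 4 * npoch6 5 * npoch6 6"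
  proof -
    have "qpoch_inf (- (fps_X ^ 1)) (fps_X ^ 1) = (\<Prod>i<6. qpoch_inf (- (fps_X ^ 1) * (fps_X ^ 1) ^ i) ((fps_X ^ 1) ^ 6))"
      by (rule qpoch_inf_split) simp_all
    then show ?thesis
      unfolding prod_lessThan_numerals mult_minus_left power_mult[symmetric] power_add[symmetric]
      by (simp add: power2_eq_square power3_eq_cube mult_ac)
  qed
  show "qpoch_inf (- (fps_X ^ 3)) (fps_X ^ 3) = npoch6 3 * npoch6 6"
  proof -
    have "qpoch_inf (- (fps_X ^ 3)) (fps_X ^ 3) = (\<Prod>i<2. qpoch_inf (- (fps_X ^ 3) * (fps_X ^ 3) ^ i) ((fps_X ^ 3) ^ 2))"
      by (rule qpoch_inf_split) simp_all
    then show ?thesis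
      unfolding prod_lessThan_numerals mult_minus_left power_mult[symmetric] power_add[symmetric]
      by (simp add: mult_ac)
  qed
qed

lemma npoch_euler: "m > 0 \<Longrightarrow> qpoch_inf (- (fps_X ^ m)) (fps_X ^ m) * euler m = euler (2 * m)"
  using qpoch_inf_mult_minus[of "fps_X ^ m :: int fps" "fps_X ^ m"]
  by (simp add: mult.commute flip: power_mult)

lemma qpoch_inf_X_nonzero [simp]:
  "m > 0 \<Longrightarrow> qpoch_inf (fps_X ^ m :: int fps) q \<noteq> 0" "m > 0 \<Longrightarrow> qpoch_inf (- (fps_X ^ m) :: int fps) q \<noteq> 0"
  by (simp_all add: qpoch_inf_nonzero)

lemma xi_part_1_product: "euler 1 * xi_part 1 = 2 * euler 3 * euler 6"
proof -
  let ?J = "lambert (\<lambda>k. 3 * k ^ 2 + 3 * k)"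
  have "euler 2 * (euler 1 * xi_part 1) = euler 1 * (euler 2 * xi_part 1)" by (simp only: mult_ac)
  also have "\<dots> = 2 * (poch6 1 * poch6 5 * ?J) * (poch6 2 * poch6 4 * poch6 3 * euler 6)"
    unfolding euler_xi_part_1 poch_inf_split(1) by (simp only: mult_ac)
  also have "\<dots> = 2 * euler 6 ^ 2 * (poch6 2 * poch6 4 * poch6 3 * euler 6)"
    unfolding lambert_product ..
  also have "\<dots> = euler 2 * (2 * euler 3 * euler 6)"
    unfolding poch_inf_split(2,3) by (simp only: power2_eq_square mult_ac)
  finally show ?thesis by simp
qed

text \<open>In \<open>appell_theta_product\<close> the theta series become products by the triple
  product, and the Lambert series by \<open>lambert_linear_product\<close>. Products with plus signs
  are then eliminated through (1 + x)(1 - x) = 1 - x^2, in the form of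
  \<open>npoch_euler\<close>.\<close>

lemma appell_product: "appell * euler 1 ^ 2 * euler 6 ^ 2 = euler 2 ^ 2 * euler 3 ^ 4"
proof -
  let ?J = "lambert (\<lambda>k. 3 * k)"
  let ?n1 = "qpoch_inf (- (fps_X ^ 1)) (fps_X ^ 1) :: int fps" and ?n3 = "qpoch_inf (- (fps_X ^ 3)) (fps_X ^ 3) :: int fps"
  have C: "theta (alt 1) (\<lambda>r. 3 * r ^ 2 - 3 * r) = 2 * npoch6 6 ^ 2 * euler 6"
  proof -
    \<comment> \<open>At a = 0 the first factor is 1 + 1; this 2 cancels the one in
      \<open>appell_theta_product\<close>.\<close>
    have "qpoch_inf (- 1) (fps_X ^ 6) = 2 * npoch6 6"
      by (subst qpoch_inf_rec) simp_all
    then show ?thesis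
      using jacobi_triple_product[of 1 0 6 3] by (simp add: power2_eq_square)
  qed
  have f: "theta (alt 1) (\<lambda>n. 3 * n ^ 2 - 2 * n) = npoch6 1 * npoch6 5 * euler 6"
    using jacobi_triple_product[of 1 1 5 3] by simp
  have "2 * euler 6 * (npoch6 6 ^ 2 * appell) = 2 * euler 6 * (?J * npoch6 1 * npoch6 5)"
    using appell_theta_product unfolding C f by (simp only: mult_ac)
  then have "npoch6 6 ^ 2 * appell = ?J * npoch6 1 * npoch6 5" by simp
  then have "poch6 1 * poch6 5 * npoch6 3 ^ 2 * (npoch6 6 ^ 2 * appell) =
      (poch6 1 * poch6 5 * npoch6 3 ^ 2 * ?J) * npoch6 1 * npoch6 5"
    by (simp only: mult_ac)
  then have A: "poch6 1 * poch6 5 * npoch6 3 ^ 2 * npoch6 6 ^ 2 * appell =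
      euler 6 ^ 2 * npoch6 1 * npoch6 2 * npoch6 4 * npoch6 5"
    unfolding lambert_linear_product[symmetric] by (simp only: mult_ac)
  have "euler 6 ^ 2 * (appell * euler 1 ^ 2 * euler 6 ^ 2) = (?n3 * euler 3) ^ 3 * appell * euler 1 * (euler 1 * euler 6)"
    using npoch_euler[of 3] by (simp add: power2_eq_square power3_eq_cube mult_ac)
  also have "\<dots> = (poch6 1 * poch6 5 * npoch6 3 ^ 2 * npoch6 6 ^ 2 * appell) * (npoch6 3 * npoch6 6) *
      euler 3 ^ 3 * euler 1 * (poch6 2 * poch6 4 * euler 6) * (poch6 3 * euler 6)"
    unfolding poch_inf_split(1,5) by (simp only: power2_eq_square power3_eq_cube mult_ac)
  also have "\<dots> = euler 6 ^ 2 * (?n1 * euler 1) * euler 3 ^ 3 * euler 2 * euler 3"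
    unfolding A poch_inf_split(2)[symmetric] poch_inf_split(3)[symmetric] poch_inf_split(4)
    by (simp only: mult_ac)
  also have "\<dots> = euler 6 ^ 2 * (euler 2 ^ 2 * euler 3 ^ 4)"
    using npoch_euler[of 1] by (simp add: power2_eq_square eval_nat_numeral mult_ac)
  finally show ?thesis by simp
qed

section \<open>Congruences modulo 3 and ternary forms\<close>

definition fps_cong :: "int \<Rightarrow> int fps \<Rightarrow> int fps \<Rightarrow> bool" where
  "fps_cong m f g \<longleftrightarrow> fps_const m dvd f - g"

lemma fps_const_dvd_iff: "fps_const m dvd f \<longleftrightarrow> (\<forall>n. m dvd f $ n)" for f :: "int fps"
proof
  assume "\<forall>n. m dvd f $ n"
  then have "f = fps_const m * Abs_fps (\<lambda>n. f $ n div m)" by (intro fps_ext) simp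
  then show "fps_const m dvd f" by (rule dvdI)
qed auto

lemma fps_cong_nth: "fps_cong m f g \<Longrightarrow> [f $ n = g $ n] (mod m)"
  by (simp add: fps_cong_def fps_const_dvd_iff cong_iff_dvd_diff)

lemma fps_cong_refl [simp]: "fps_cong m f f"
  by (simp add: fps_cong_def)

lemma fps_cong_sym: "fps_cong m f g \<Longrightarrow> fps_cong m g f"
  unfolding fps_cong_def by (subst dvd_minus_iff[symmetric]) simp

lemma fps_cong_trans [trans]: "fps_cong m f g \<Longrightarrow> fps_cong m g h \<Longrightarrow> fps_cong m f h"
  unfolding fps_cong_def by (drule (1) dvd_add) simp

lemma fps_cong_mult: "fps_cong m f g \<Longrightarrow> fps_cong m f' g' \<Longrightarrow> fps_cong m (f * f') (g * g')"
proof -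
  assume "fps_cong m f g" "fps_cong m f' g'"
  then have "fps_const m dvd (f - g) * f' + g * (f' - g')" unfolding fps_cong_def by simp
  then show ?thesis unfolding fps_cong_def by (simp add: algebra_simps)
qed

lemma fps_cong_power: "fps_cong m f g \<Longrightarrow> fps_cong m (f ^ n) (g ^ n)"
  by (induction n) (auto intro: fps_cong_mult)

lemma fps_cong_prod: "(\<And>i. i \<in> A \<Longrightarrow> fps_cong m (f i) (g i)) \<Longrightarrow> fps_cong m (prod f A) (prod g A)"
  by (induction A rule: infinite_finite_induct) (auto intro: fps_cong_mult)

text \<open>A series with constant term 1 is a unit over the integers, so the congruence may be
  multiplied by its inverse.\<close>

lemma fps_cong_cancel:
  assumes "h $ 0 = 1" "fps_cong m (h * f) (h * g)" shows "fps_cong m f g"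
proof -
  have inv: "h * fps_right_inverse h 1 = 1" by (rule fps_right_inverse_1) fact
  have "fps_cong m (fps_right_inverse h 1 * (h * f)) (fps_right_inverse h 1 * (h * g))"
    by (rule fps_cong_mult[OF fps_cong_refl assms(2)])
  moreover have "fps_right_inverse h 1 * (h * f) = f" for f
  proof -
    have "fps_right_inverse h 1 * (h * f) = (h * fps_right_inverse h 1) * f" by (simp only: mult_ac)
    then show ?thesis using inv by simp
  qed
  ultimately show ?thesis by (simp only:)
qed

lemma fps_cong_tendsto:
  assumes "f \<longlonglongrightarrow> F" "g \<longlonglongrightarrow> G" "\<And>n. fps_cong m (f n) (g n)"
  shows "fps_cong m F G"
  unfolding fps_cong_def fps_const_dvd_iff
proof
  fix k
  have "eventually (\<lambda>n. f n $ k = F $ k \<and> g n $ k = G $ k) sequentially"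
    using assms(1,2) by (intro eventually_conj tendsto_fps_eventually_nth)
  then obtain n where "f n $ k = F $ k" "g n $ k = G $ k" by (auto simp: eventually_sequentially)
  then show "m dvd (F - G) $ k"
    using fps_cong_nth[OF assms(3), of n k] by (simp add: cong_iff_dvd_diff)
qed

text \<open>Cubing is additive modulo 3; this is applied factor by factor before the limit.\<close>

lemma qpoch_inf_cube_cong:
  assumes "q $ 0 = 0"
  shows "fps_cong 3 (qpoch_inf (a ^ 3) (q ^ 3)) (qpoch_inf a q ^ 3)"
proof (rule fps_cong_tendsto)
  show "(\<lambda>n. qpoch (a ^ 3) (q ^ 3) n) \<longlonglongrightarrow> qpoch_inf (a ^ 3) (q ^ 3)"
    by (rule qpoch_tendsto) (simp add: assms fps_power_zeroth)
  show "(\<lambda>n. qpoch a q n ^ 3) \<longlonglongrightarrow> qpoch_inf a q ^ 3"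
    unfolding power3_eq_cube by (intro tendsto_fps_mult qpoch_tendsto assms)
  have "fps_cong 3 (1 - x ^ 3) ((1 - x) ^ 3)" for x
  proof -
    have "(1 - x ^ 3) - (1 - x) ^ 3 = fps_const 3 * (x - x ^ 2)"
      by (simp add: power2_eq_square power3_eq_cube algebra_simps flip: numeral_fps_const)
    then show ?thesis unfolding fps_cong_def by simp
  qed
  from this[of "a * q ^ k" for k]
  show "fps_cong 3 (qpoch (a ^ 3) (q ^ 3) n) (qpoch a q n ^ 3)" for n
    unfolding qpoch_def prod_power_distrib
    by (intro fps_cong_prod) (simp add: power_mult_distrib mult.commute flip: power_mult)
qed

lemma euler_cube_cong: "m > 0 \<Longrightarrow> fps_cong 3 (euler (3 * m)) (euler m ^ 3)"
  using qpoch_inf_cube_cong[of "fps_X ^ m" "fps_X ^ m"] by (simp add: mult.commute flip: power_mult)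

lemma euler_nth_0: "m > 0 \<Longrightarrow> euler m $ 0 = 1"
  by (simp add: qpoch_inf_def qpoch_nth_0)

text \<open>Gauss's product, from the triple product with a = b = c = m; the factors that it omits
  from \<open>euler m\<close> form \<open>euler (2 * m)\<close>.\<close>

lemma gauss_theta_product:
  assumes "m > 0"
  shows "theta (alt (- 1)) (\<lambda>k. int m * k ^ 2) * euler (2 * m) = euler m ^ 2"
proof -
  have "euler m = (\<Prod>i<2. qpoch_inf (fps_X ^ m * (fps_X ^ m) ^ i) ((fps_X ^ m) ^ 2))"
    by (rule qpoch_inf_split) (use assms in simp_all)
  then have "euler m = qpoch_inf (fps_X ^ m) (fps_X ^ (2 * m)) * euler (2 * m)"
    unfolding prod_lessThan_numerals power_mult[symmetric] power_add[symmetric]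
    by (simp add: mult_2 mult_2_right)
  moreover have "theta (alt (- 1)) (\<lambda>k. int m * k ^ 2) =
      qpoch_inf (fps_X ^ m) (fps_X ^ (2 * m)) ^ 2 * euler (2 * m)"
    using jacobi_triple_product[of "- 1" m m m] assms by (simp add: power2_eq_square flip: fps_const_neg)
  ultimately show ?thesis by (simp add: power2_eq_square mult_ac)
qed

abbreviation gauss_theta :: "int \<Rightarrow> int fps" where
  "gauss_theta m \<equiv> theta (alt (- 1)) (\<lambda>k. m * k ^ 2)"

abbreviation omega_theta :: "int fps" where
  "omega_theta \<equiv> theta (alt (- 1)) (\<lambda>k. 3 * k ^ 2 - 2 * k)"

text \<open>Write E_m for \<open>euler m\<close>. The class is E_2 E_3^4 / (E_1^2 E_6^2). Modulo 3,
  replacing one E_3^2 by E_1^6 and one E_6 by E_2^3 gives (E_1^2/E_2)^2 E_3^2/E_6, the product of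
  three Gauss theta series. The multiplier \<open>?h\<close> clears denominators.\<close>

lemma xi_part_0_cong: "fps_cong 3 (xi_part 0) (gauss_theta 1 * gauss_theta 1 * gauss_theta 3)"
proof (rule fps_cong_cancel)
  let ?h = "euler 1 ^ 2 * euler 2 ^ 7"
  show "?h $ 0 = 1"
    using euler_nth_0[of 1] euler_nth_0[of 2] euler_nth_0[of 3] by (simp add: fps_power_zeroth)
  have e3: "fps_cong 3 (euler 3) (euler 1 ^ 3)" using euler_cube_cong[of 1] by simp
  have e6: "fps_cong 3 (euler 6) (euler 2 ^ 3)" using euler_cube_cong[of 2] by simp
  have g1: "gauss_theta 1 * euler 2 = euler 1 ^ 2" using gauss_theta_product[of 1] by simp
  have g3: "gauss_theta 3 * euler 6 = euler 3 ^ 2" using gauss_theta_product[of 3] by simp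
  have "?h * xi_part 0 = (euler 2 * xi_part 0) * euler 1 ^ 2 * (euler 2 ^ 3) ^ 2"
    by (simp add: eval_nat_numeral mult_ac)
  also have "fps_cong 3 \<dots> ((euler 2 * xi_part 0) * euler 1 ^ 2 * euler 6 ^ 2)"
    by (intro fps_cong_mult fps_cong_power fps_cong_sym[OF e6] fps_cong_refl)
  also have "(euler 2 * xi_part 0) * euler 1 ^ 2 * euler 6 ^ 2 = euler 2 ^ 2 * euler 3 ^ 2 * euler 3 ^ 2"
    unfolding euler_xi_part_0 appell_product by (simp add: eval_nat_numeral)
  also have "fps_cong 3 \<dots> (euler 2 ^ 2 * (euler 1 ^ 3) ^ 2 * euler 3 ^ 2)"
    by (intro fps_cong_mult fps_cong_power e3 fps_cong_refl)
  also have "euler 2 ^ 2 * (euler 1 ^ 3) ^ 2 * euler 3 ^ 2 =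
      euler 2 ^ 4 * euler 1 ^ 2 * gauss_theta 1 ^ 2 * gauss_theta 3 * euler 6"
  proof -
    have "euler 2 ^ 2 * (euler 1 ^ 3) ^ 2 * euler 3 ^ 2 = euler 2 ^ 2 * euler 1 ^ 2 * (euler 1 ^ 2) ^ 2 * euler 3 ^ 2"
      by (simp add: eval_nat_numeral mult_ac)
    then show ?thesis
      unfolding g1[symmetric] g3[symmetric] power_mult_distrib by (simp add: eval_nat_numeral mult_ac)
  qed
  also have "fps_cong 3 \<dots> (euler 2 ^ 4 * euler 1 ^ 2 * gauss_theta 1 ^ 2 * gauss_theta 3 * euler 2 ^ 3)"
    by (intro fps_cong_mult fps_cong_refl e6)
  also have "\<dots> = ?h * (gauss_theta 1 * gauss_theta 1 * gauss_theta 3)"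
    by (simp add: eval_nat_numeral mult_ac)
  finally show "fps_cong 3 (?h * xi_part 0) (?h * (gauss_theta 1 * gauss_theta 1 * gauss_theta 3))" .
qed

text \<open>With E_m for \<open>euler m\<close>, the class is 2 E_3 E_6 / E_1, while
  \<open>omega_theta\<close> is E_1 E_6^2 / (E_2 E_3). The two sides agree modulo 3 by E_3^2 = E_1^6
  and E_6 = E_2^3.\<close>

lemma xi_part_1_cong: "fps_cong 3 (xi_part 1) (2 * (gauss_theta 1 * gauss_theta 1 * omega_theta))"
proof (rule fps_cong_cancel)
  let ?h = "euler 1 * euler 2 ^ 3 * euler 3"
  show "?h $ 0 = 1"
    using euler_nth_0[of 1] euler_nth_0[of 2] euler_nth_0[of 3] by (simp add: fps_power_zeroth)
  have e3: "fps_cong 3 (euler 3) (euler 1 ^ 3)" using euler_cube_cong[of 1] by simp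
  have e6: "fps_cong 3 (euler 6) (euler 2 ^ 3)" using euler_cube_cong[of 2] by simp
  have g1: "gauss_theta 1 * euler 2 = euler 1 ^ 2" using gauss_theta_product[of 1] by simp
  have om: "omega_theta = poch6 1 * poch6 5 * euler 6"
    using jacobi_triple_product[of "- 1" 1 5 3] by (simp flip: fps_const_neg)
  have "omega_theta * euler 2 * euler 3 = euler 1 * euler 6 ^ 2"
    unfolding om poch_inf_split(1,2,3) by (simp only: power2_eq_square mult_ac)
  have "?h * xi_part 1 = (euler 1 * xi_part 1) * euler 2 ^ 3 * euler 3" by (simp only: mult_ac)
  also have "\<dots> = 2 * euler 3 * euler 6 * euler 2 ^ 3 * euler 3" unfolding xi_part_1_product ..
  also have "fps_cong 3 \<dots> (2 * euler 1 ^ 3 * euler 6 * euler 6 * euler 1 ^ 3)"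
    by (intro fps_cong_mult fps_cong_refl e3 fps_cong_sym[OF e6])
  also have "2 * euler 1 ^ 3 * euler 6 * euler 6 * euler 1 ^ 3 = 2 * euler 1 * (euler 1 ^ 2) ^ 2 * (euler 1 * euler 6 ^ 2)"
    by (simp add: eval_nat_numeral mult_ac)
  also have "\<dots> = 2 * euler 1 * (gauss_theta 1 * euler 2) ^ 2 * (omega_theta * euler 2 * euler 3)"
    unfolding g1 \<open>omega_theta * euler 2 * euler 3 = euler 1 * euler 6 ^ 2\<close> ..
  also have "\<dots> = ?h * (2 * (gauss_theta 1 * gauss_theta 1 * omega_theta))"
    by (simp add: eval_nat_numeral mult_ac)
  finally show "fps_cong 3 (?h * xi_part 1) (?h * (2 * (gauss_theta 1 * gauss_theta 1 * omega_theta)))" .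
qed

text \<open>If h(h x) = x, applying \<open>h\<close> once more gives x = h x. Hence without fixed
  points every orbit has exactly three elements, and the orbits partition \<open>S\<close>.\<close>

lemma three_dvd_card:
  assumes fin: "finite S" and h: "\<And>x. x \<in> S \<Longrightarrow> h x \<in> S" "\<And>x. x \<in> S \<Longrightarrow> h (h (h x)) = x" "\<And>x. x \<in> S \<Longrightarrow> h x \<noteq> x"
  shows "3 dvd card S"
proof -
  let ?orb = "\<lambda>x. {x, h x, h (h x)}"
  have "3 * card (?orb ` S) = card (\<Union> (?orb ` S))"
  proof (rule card_partition)
    show "finite (?orb ` S)" "finite (\<Union> (?orb ` S))" using fin by auto
    fix c assume "c \<in> ?orb ` S"
    then obtain x where x: "x \<in> S" "c = ?orb x" by blast
    have "h x \<noteq> x" "h (h x) \<noteq> h x" "h (h x) \<noteq> x"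
      using h(1,2,3)[OF x(1)] h(3)[OF h(1)[OF x(1)]] by metis+
    then show "card c = 3" unfolding x(2) by simp
  next
    fix c d assume "c \<in> ?orb ` S" "d \<in> ?orb ` S" "c \<noteq> d"
    then obtain x y where x: "x \<in> S" "c = ?orb x" and y: "y \<in> S" "d = ?orb y" by blast
    have "c = d" if "z \<in> c" "z \<in> d" for z
    proof -
      have orb: "?orb z = ?orb w" if "w \<in> S" "z \<in> ?orb w" for w
        using that h(2)[OF that(1)] by auto
      show ?thesis using orb[of x] orb[of y] x y that by simp
    qed
    with \<open>c \<noteq> d\<close> show "c \<inter> d = {}" by blast
  qed
  moreover have "\<Union> (?orb ` S) = S" using h(1) by auto
  ultimately show ?thesis by (metis dvd_triv_left)
qed

section \<open>Arithmetic of the ternary quadratic forms\<close>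

lemma square_mod_8: "(x::int) ^ 2 mod 8 = (if odd x then 1 else if 4 dvd x then 0 else 4)"
proof -
  have "x mod 8 = 0 \<or> x mod 8 = 1 \<or> x mod 8 = 2 \<or> x mod 8 = 3 \<or> x mod 8 = 4 \<or> x mod 8 = 5 \<or> x mod 8 = 6 \<or> x mod 8 = 7"
    by presburger
  moreover have "x ^ 2 mod 8 = (x mod 8) ^ 2 mod 8" by (simp add: power_mod)
  moreover have "odd x = odd (x mod 8)" "4 dvd x \<longleftrightarrow> 4 dvd x mod 8" by presburger+
  ultimately show ?thesis by (elim disjE) simp_all
qed

lemma square_mod_3: "(x::int) ^ 2 mod 3 = (if 3 dvd x then 0 else 1)"
proof -
  have "x mod 3 = 0 \<or> x mod 3 = 1 \<or> x mod 3 = 2" by presburger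
  moreover have "x ^ 2 mod 3 = (x mod 3) ^ 2 mod 3" by (simp add: power_mod)
  moreover have "3 dvd x \<longleftrightarrow> x mod 3 = 0" by presburger
  ultimately show ?thesis by (elim disjE) simp_all
qed

text \<open>Since -1 is not a square modulo 3, both x and y are divisible by 3; dividing the
  equation by 3 then makes z^2 equal to 2 modulo 3.\<close>

lemma no_representation:
  fixes x y z :: int
  shows "x ^ 2 + y ^ 2 + 3 * z ^ 2 \<noteq> 9 * int n + 6"
proof
  assume eq: "x ^ 2 + y ^ 2 + 3 * z ^ 2 = 9 * int n + 6"
  have "x ^ 2 mod 3 = 0" "y ^ 2 mod 3 = 0"
  proof -
    have "w ^ 2 mod 3 = 0 \<or> w ^ 2 mod 3 = 1" for w :: int unfolding square_mod_3 by simp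
    from this[of x] this[of y] show "x ^ 2 mod 3 = 0" "y ^ 2 mod 3 = 0" using eq by presburger+
  qed
  then have "3 dvd x" "3 dvd y" unfolding square_mod_3 by (auto split: if_splits)
  then obtain a b where "x = 3 * a" "y = 3 * b" by blast
  then have "3 * (a ^ 2) + 3 * (b ^ 2) + z ^ 2 = 3 * int n + 2" using eq by (simp add: power_mult_distrib)
  then have "z ^ 2 mod 3 = 2" by presburger
  then show False unfolding square_mod_3 by (auto split: if_splits)
qed

text \<open>
  Exactly one of \<open>x\<close> and \<open>y\<close> is odd. If it is \<open>x\<close>, the map \<open>h\<close> multiplies \<open>y + z \<surd>-3\<close> by a primitive
  cube root of unity; in the second lemma this is done with \<open>(3z - 1) + y \<surd>-3\<close>.
\<close>
lemma three_dvd_card_mod_24: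
  fixes n :: nat
  defines "S \<equiv> {((x, y), z). x ^ 2 + y ^ 2 + 3 * z ^ 2 = int (24 * n + 17)}"
  assumes fin: "finite S"
  shows "3 dvd card S"
proof -
  define A where "A = {i \<in> S. odd (fst (fst i))}"
  define B where "B = {i \<in> S. odd (snd (fst i))}"
  \<comment> \<open>The factor is \<omega> = (-1 + sqrt(-3))/2. On \<open>A\<close> the sum y + z is
    even, so the halves are integers, and the norm y^2 + 3z^2 is preserved.\<close>
  let ?h = "\<lambda>((x, y), z). ((x, (- y - 3 * z) div 2), (y - z) div 2) :: (int \<times> int) \<times> int"
  have split: "S = A \<union> B" "A \<inter> B = {}"
  proof -
    \<comment> \<open>The number 24n + 17 is 1 modulo 8, the one residue that the form misses when x
      and y have equal parity.\<close>
    have "odd x \<longleftrightarrow> even y" if "((x, y), z) \<in> S" for x y z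
    proof -
      have "x ^ 2 + y ^ 2 + 3 * z ^ 2 = 8 * (3 * int n + 2) + 1" using that unfolding S_def by simp
      then have "(x ^ 2 + y ^ 2 + 3 * z ^ 2) mod 8 = 1" by presburger
      moreover have gen: "(X + Y + 3 * Z) mod 8 = (X mod 8 + Y mod 8 + 3 * (Z mod 8)) mod 8" for X Y Z :: int
        by (intro mod_add_cong) (simp_all add: mod_mult_right_eq)
      ultimately have "(x ^ 2 mod 8 + y ^ 2 mod 8 + 3 * (z ^ 2 mod 8)) mod 8 = 1"
        unfolding gen[symmetric] by blast
      then show ?thesis unfolding square_mod_8 by (auto split: if_splits)
    qed
    then have "odd (fst (fst i)) \<longleftrightarrow> even (snd (fst i))" if "i \<in> S" for i
      using that by (cases i; cases "fst i") auto
    then show "S = A \<union> B" "A \<inter> B = {}" by (auto simp: A_def B_def)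
  qed
  have "3 dvd card A"
  proof (rule three_dvd_card[where h = ?h])
    show "finite A" using fin by (simp add: A_def)
    fix i assume i: "i \<in> A"
    obtain x y z where xyz: "i = ((x, y), z)" by (cases i) auto
    have eq: "x ^ 2 + y ^ 2 + 3 * z ^ 2 = int (24 * n + 17)" and x: "odd x"
      using i by (simp_all add: A_def S_def xyz)
    have "even (y + z)"
    proof -
      have "odd (x ^ 2 + y ^ 2 + 3 * z ^ 2)" unfolding eq by simp
      then show ?thesis using x by simp
    qed
    then have "2 dvd y - z" by presburger
    then obtain b where "y - z = 2 * b" by blast
    then have b: "y = z + 2 * b" by simp
    have h: "?h ((x, z + 2 * b), z) = ((x, b + 2 * (- z - b)), b)" for z b
      by simp
    show "?h i \<in> A"
      using eq x unfolding xyz b h A_def S_def by (simp add: power2_eq_square algebra_simps)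
    show "?h (?h (?h i)) = i"
      unfolding xyz b h by simp
    show "?h i \<noteq> i"
    proof
      assume "?h i = i"
      \<comment> \<open>Multiplication by \<omega> fixes only y + z sqrt(-3) = 0, which would leave
        x^2 = 24n + 17, a non-square modulo 3.\<close>
      then have "z = 0" "y = 0" unfolding xyz b h by auto
      then have "x ^ 2 mod 3 = 2" using eq by simp presburger
      then show False unfolding square_mod_3 by (auto split: if_splits)
    qed
  qed
  moreover have "card A = card B"
    by (rule bij_betw_same_card[OF bij_betw_byWitness[of _ "\<lambda>((x, y), z). ((y, x), z)" "\<lambda>((x, y), z). ((y, x), z)"]])
      (auto simp: A_def B_def S_def)
  moreover have "card S = card A + card B"
    unfolding split(1) using fin by (intro card_Un_disjoint split(2)) (auto simp: A_def B_def)
  ultimately show ?thesis by simp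
qed

lemma three_dvd_card_mod_8:
  fixes n :: nat
  defines "S \<equiv> {((x, y), z). x ^ 2 + y ^ 2 + (3 * z ^ 2 - 2 * z) = int (8 * n + 6)}"
  assumes fin: "finite S"
  shows "3 dvd card S"
proof -
  define A where "A = {i \<in> S. odd (fst (fst i))}"
  define B where "B = {i \<in> S. odd (snd (fst i))}"
  \<comment> \<open>The norm of (3z - 1) + y sqrt(-3) is 3(y^2 + 3z^2 - 2z) + 1. Multiplication by
    \<omega> keeps the rational part equal to -1 modulo 3, because \<omega> - 1 is divisible by
    sqrt(-3); so a new integer z can be read off.\<close>
  let ?h = "\<lambda>((x, y), z). ((x, (3 * z - 1 - y) div 2), (1 - z - y) div 2) :: (int \<times> int) \<times> int"
  have split: "S = A \<union> B" "A \<inter> B = {}"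
  proof -
    have "odd x \<longleftrightarrow> even y" if "((x, y), z) \<in> S" for x y z
    proof -
      have eq: "x ^ 2 + y ^ 2 + (3 * z ^ 2 - 2 * z) = 8 * int n + 6" using that unfolding S_def by simp
      show ?thesis
      proof (cases "even z")
        case True
        \<comment> \<open>For even z the last summand is divisible by 8, and a sum of two squares is
          never 6 modulo 8: this case is void.\<close>
        then obtain w where w: "z = 2 * w" by blast
        have "even (w * (3 * w - 1))" by simp
        then obtain v where "w * (3 * w - 1) = 2 * v" by blast
        then have "3 * z ^ 2 - 2 * z = 8 * v" by (simp add: w power2_eq_square algebra_simps)
        then have "(x ^ 2 + y ^ 2) mod 8 = 6" using eq by presburger
        moreover have "(x ^ 2 + y ^ 2) mod 8 = (x ^ 2 mod 8 + y ^ 2 mod 8) mod 8"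
          by (rule mod_add_eq[symmetric])
        ultimately show ?thesis unfolding square_mod_8 by (auto split: if_splits)
      next
        case False
        have "even (x ^ 2 + y ^ 2 + (3 * z ^ 2 - 2 * z))" unfolding eq by simp
        then show ?thesis using False by simp
      qed
    qed
    then have "odd (fst (fst i)) \<longleftrightarrow> even (snd (fst i))" if "i \<in> S" for i
      using that by (cases i; cases "fst i") auto
    then show "S = A \<union> B" "A \<inter> B = {}" by (auto simp: A_def B_def)
  qed
  have "3 dvd card A"
  proof (rule three_dvd_card[where h = ?h])
    show "finite A" using fin by (simp add: A_def)
    fix i assume i: "i \<in> A"
    obtain x y z where xyz: "i = ((x, y), z)" by (cases i) auto
    have eq: "x ^ 2 + y ^ 2 + (3 * z ^ 2 - 2 * z) = int (8 * n + 6)" and x: "odd x"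
      using i by (simp_all add: A_def S_def xyz)
    have "odd (y + z)"
    proof -
      have "even (x ^ 2 + y ^ 2 + (3 * z ^ 2 - 2 * z))" unfolding eq by simp
      then have "odd y \<longleftrightarrow> even z" using x by simp
      then show ?thesis by auto
    qed
    then have "2 dvd 1 - z - y" by presburger
    then obtain b where "1 - z - y = 2 * b" by blast
    then have b: "y = 1 - z - 2 * b" by simp
    have h: "?h ((x, 1 - z - 2 * b), z) = ((x, 1 - b - 2 * (1 - z - b)), b)" for z b
      by simp
    show "?h i \<in> A"
      using eq x unfolding xyz b h A_def S_def by (simp add: power2_eq_square algebra_simps)
    show "?h (?h (?h i)) = i"
      unfolding xyz b h by simp
    show "?h i \<noteq> i"
    proof
      assume "?h i = i"
      \<comment> \<open>A fixed point would require 3z - 1 = 0.\<close>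
      then have "b = z" "1 - b - 2 * (1 - z - b) = 1 - z - 2 * b" unfolding xyz b h by auto
      then show False by presburger
    qed
  qed
  moreover have "card A = card B"
    by (rule bij_betw_same_card[OF bij_betw_byWitness[of _ "\<lambda>((x, y), z). ((y, x), z)" "\<lambda>((x, y), z). ((y, x), z)"]])
      (auto simp: A_def B_def S_def)
  moreover have "card S = card A + card B"
    unfolding split(1) using fin by (intro card_Un_disjoint split(2)) (auto simp: A_def B_def)
  ultimately show ?thesis by simp
qed

text \<open>The three signs multiply to the sign of x + y + z. The last exponent \<open>e\<close>
  stays a parameter to serve both 3z^2 and 3z^2 - 2z.\<close>

lemma gauss_theta_triple_nth:
  assumes "admissible (alt (- 1)) e"
  shows "finite {((x, y), z). x ^ 2 + y ^ 2 + e z = int N}"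
    "(gauss_theta 1 * gauss_theta 1 * theta (alt (- 1)) e) $ N =
      (\<Sum>i\<in>{((x, y), z). x ^ 2 + y ^ 2 + e z = int N}. alt (- 1) (fst (fst i) + snd (fst i) + snd i))"
proof -
  let ?c = "\<lambda>i. alt (- 1) (fst (fst i)) * alt (- 1) (snd (fst i)) * alt (- 1) (snd i)"
  let ?e = "\<lambda>i. 1 * fst (fst i) ^ 2 + 1 * snd (fst i) ^ 2 + e (snd i)"
  let ?S = "{((x, y), z). x ^ 2 + y ^ 2 + e z = int N}"
  have adm: "admissible (alt (- 1)) (\<lambda>k. 1 * k ^ 2)"
    using admissible_quadratic[of 1 1 "alt (- 1)"] by simp
  note adm2 = admissible_mult[OF adm adm]
  have adm3: "admissible ?c ?e"
    using admissible_mult[OF adm2 assms] unfolding case_prod_unfold .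
  have S: "{i. ?c i \<noteq> 0 \<and> ?e i = int N} = ?S" by auto
  show "finite ?S" using admissible_finite_eq[OF adm3, of N] unfolding S .
  have "gauss_theta 1 * gauss_theta 1 * theta (alt (- 1)) e = theta ?c ?e"
    unfolding theta_mult[OF adm adm] theta_mult[OF adm2 assms] unfolding case_prod_unfold ..
  then have "(gauss_theta 1 * gauss_theta 1 * theta (alt (- 1)) e) $ N = sum ?c ?S"
    using theta_nth[OF adm3, of N] unfolding S by (simp only:)
  also have "sum ?c ?S = (\<Sum>i\<in>?S. alt (- 1) (fst (fst i) + snd (fst i) + snd i))"
    by (rule sum.cong[OF refl]) simp
  finally show "(gauss_theta 1 * gauss_theta 1 * theta (alt (- 1)) e) $ N =
      (\<Sum>i\<in>?S. alt (- 1) (fst (fst i) + snd (fst i) + snd i))" .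
qed

theorem theorem5p1:
  fixes n :: nat
  shows "[p_xi (24 * n + 19) = 0] (mod 3) \<and>
         [p_xi (27 * n + 18) = 0] (mod 3) \<and>
         [p_xi (72 * n + 51) = 0] (mod 3)"
proof (intro conjI)
  let ?c = "\<lambda>i. alt (- 1) (fst (fst i) + snd (fst i) + snd i)"
  let ?S0 = "\<lambda>N. {((x, y), z). x ^ 2 + y ^ 2 + 3 * z ^ 2 = int N}"
  let ?S1 = "\<lambda>N. {((x, y), z). x ^ 2 + y ^ 2 + (3 * z ^ 2 - 2 * z) = int N}"
  have adm0: "admissible (alt (- 1)) (\<lambda>k. 3 * k ^ 2)"
    using admissible_quadratic[of 3 3 "alt (- 1)"] by simp
  have adm1: "admissible (alt (- 1)) (\<lambda>k. 3 * k ^ 2 - 2 * k)"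
    using admissible_quadratic[of 3 1 "alt (- 1)"] by simp
  note fin0 = gauss_theta_triple_nth(1)[OF adm0] and nth0 = gauss_theta_triple_nth(2)[OF adm0]
  note fin1 = gauss_theta_triple_nth(1)[OF adm1] and nth1 = gauss_theta_triple_nth(2)[OF adm1]
  \<comment> \<open>Both ternary exponents have the parity of x + y + z, so at a fixed exponent all
    signs equal one \<open>s\<close> and the sum is \<open>s\<close> times a cardinality.\<close>
  have sum_dvd: "3 dvd sum ?c S" if "3 dvd card S" "\<And>i. i \<in> S \<Longrightarrow> ?c i = s" for S s
  proof -
    have "sum ?c S = s * int (card S)" using that(2) by simp
    moreover have "int 3 dvd int (card S)" using that(1) by (simp only: int_dvd_int_iff)
    ultimately show ?thesis by simp
  qed
  have part0: "[p_xi (3 * N) = 0] (mod 3)" if "3 dvd sum ?c (?S0 N)" for N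
  proof -
    have "[xi_part 0 $ N = sum ?c (?S0 N)] (mod 3)"
      using fps_cong_nth[OF xi_part_0_cong, of N] by (simp only: nth0)
    moreover have "[sum ?c (?S0 N) = 0] (mod 3)" using that by (simp only: cong_0_iff)
    ultimately have "[xi_part 0 $ N = 0] (mod 3)" by (rule cong_trans)
    then show ?thesis by (simp add: p_xi_def xi_part_def)
  qed
  have part1: "[p_xi (3 * N + 1) = 0] (mod 3)" if "3 dvd sum ?c (?S1 N)" for N
  proof -
    have "(2 * G) $ N = 2 * G $ N" for G :: "int fps" by (simp add: numeral_fps_const)
    then have "[xi_part 1 $ N = 2 * sum ?c (?S1 N)] (mod 3)"
      using fps_cong_nth[OF xi_part_1_cong, of N] by (simp only: nth1)
    moreover have "[2 * sum ?c (?S1 N) = 0] (mod 3)" using that by (simp only: cong_0_iff dvd_mult)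
    ultimately have "[xi_part 1 $ N = 0] (mod 3)" by (rule cong_trans)
    then show ?thesis by (simp add: p_xi_def xi_part_def)
  qed
  have "3 dvd sum ?c (?S1 (8 * n + 6))"
  proof (rule sum_dvd[OF three_dvd_card_mod_8[OF fin1]])
    fix i assume i: "i \<in> ?S1 (8 * n + 6)"
    obtain x y z where xyz: "i = ((x, y), z)" by (cases i) auto
    have "x ^ 2 + y ^ 2 + (3 * z ^ 2 - 2 * z) = int (8 * n + 6)" using i by (simp add: xyz)
    then have "even (x ^ 2 + y ^ 2 + (3 * z ^ 2 - 2 * z))" by simp
    then show "?c i = 1" by (simp add: xyz)
  qed
  from part1[OF this] show "[p_xi (24 * n + 19) = 0] (mod 3)" by (simp add: algebra_simps)
  have "?S0 (9 * n + 6) = {}" using no_representation[of _ _ _ n] by auto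
  then have "3 dvd sum ?c (?S0 (9 * n + 6))" by (simp only: sum.empty dvd_0_right)
  from part0[OF this] show "[p_xi (27 * n + 18) = 0] (mod 3)" by (simp add: algebra_simps)
  have "3 dvd sum ?c (?S0 (24 * n + 17))"
  proof (rule sum_dvd[OF three_dvd_card_mod_24[OF fin0]])
    fix i assume i: "i \<in> ?S0 (24 * n + 17)"
    obtain x y z where xyz: "i = ((x, y), z)" by (cases i) auto
    have "x ^ 2 + y ^ 2 + 3 * z ^ 2 = int (24 * n + 17)" using i by (simp add: xyz)
    then have "odd (x ^ 2 + y ^ 2 + 3 * z ^ 2)" by simp
    then show "?c i = - 1" by (simp add: xyz)
  qed
  from part0[OF this] show "[p_xi (72 * n + 51) = 0] (mod 3)" by (simp add: algebra_simps)
qed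

end
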